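(* Let $\mathfrak g$ be of type $B_n^{(1)}$ and let $\Lambda$ be a dominant integral weight of level $1$. (1) If $\Lambda=\Lambda_0$ or $\Lambda_1$, then for every $m\ge0$ the map $$\pi:\mathcal Z(\Lambda)_{\Lambda-m\delta}\longrightarrow\bigsqcup_{m_1+m_2+2m_3=m}\mathcal{OP}(2m_1)\times\mathcal P^{(n)}(m_2)\times\mathcal{DP}_0(m_3)$$ is a bijection. (2) If $\Lambda=\Lambda_n$, then for every $m\ge0$ the map $$\pi:\mathcal Z(\Lambda)_{\Lambda-m\delta}\longrightarrow\bigsqcup_{m_1+m_2=m}\mathcal P^{(n)}(m_1)\times\mathcal Q(m_2)$$ is a bijection. Here $\pi(Y)=(\pi_0(Y),\pi_1(\widetilde Y))$.
   Context: **Type and weights.** $\mathfrak g$ of type $B_n^{(1)}$ ($n\ge3$), colors $0,\dots,n$, $\delta=\alpha_0+\alpha_1+2(\alpha_2+\cdots+\alpha_n)$, level 1 weights $\Lambda\in\{\Lambda_0,\Lambda_1,\Lambda_n\}$, $\ell=2n$. **Proper Young walls.** There are infinitely many columns, numbered $1,2,\dots$ from right to left. Each column is a stack of unit-height floors. A floor is a unit cube of the indicated color, or a split floor $\{0,1\}$ made of two half-thickness blocks of colors $0,1$ in two positions A and B, or a floor $[n]$ made of two half-height $n$-blocks one on top of the other. The floors from bottom to top are, repeated cyclically: $\{0,1\},2,\dots,n-1,[n],n-1,\dots,2$ if $\Lambda\in\{\Lambda_0,\Lambda_1\}$; $[n],n-1,\dots,2,\{0,1\},2,\dots,n-1$ if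 $\Lambda=\Lambda_n$. On a floor $\{0,1\}$ of column $k$, position A has color $1$ for $k$ odd and $0$ for $k$ even, except that for $\Lambda=\Lambda_1$ this is reversed; B has the other color. The ground state wall $Y_\Lambda$ consists, in every column, of the A-block of the bottom floor if $\Lambda\in\{\Lambda_0,\Lambda_1\}$, and of the lower half-height $n$-block of the bottom floor if $\Lambda=\Lambda_n$. A Young wall $Y=(y_k)_{k\ge1}$ is obtained by adding finitely many blocks, where a floor may be started only when the floor below it is completely filled, the two blocks of a split floor above the bottom may be added in either order, and there is no free space to the right of any block (if a place is occupied in column $k+1$, the same place is occupied in column $k$). $|y_k|$ is the number of added blocks in column $k$. A column is full if its top floor is completely filled, i.e. $n\nmid|y_k|$; $Y$ is proper if no two full columns have the same height. Put $r=0$ if $\Lambda\in\{\Lambda_0,\Lambda_1\}$ and $r=n$ if $\Lambda=\Lambda_n$. Equivalently, a proper Young wall is a partition $(|y_k|)_k$ whose parts not divisible by $n$ are distinct, with a choice A or B for each positive part $\equiv r\pmod\ell$ (the position of the top half-thickness block), equal parts having equal choices. $\mathcal Z(\Lambda)$ is the set of proper Young walls, $\mathrm{wt}(Y)=\Lambda-\sum_ik_i\alpha_i$ with $k_i$ the number of added $i$-blocks, $\mathcal Z(\Lambda)_\lambda=\{Y:\mathrm{wt}(Y)=\lambda\}$. $\mathcal Z(\Lambda)'$ is the set of $Y\in\mathcal Z(\Lambda)$ all of whose nonzero $|y_k|$ are $\equiv r\pmod\ell$. **Beads.** Place a bead at position $|y_k|$ for each nonzero $|y_k|$, colored gray if the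 top block of column $k$ is a half-thickness block in position B on a half-filled floor, white otherwise. Runners: $R_k=\{s>0:s\equiv k\pmod\ell\}$, $1\le k\le\ell$. $R_k$ is of type I for $k\ne n,\ell$. If $\Lambda\in\{\Lambda_0,\Lambda_1\}$, $R_n$ is of type II and $R_\ell$ of type III; if $\Lambda=\Lambda_n$, $R_n$ is of type III and $R_\ell$ of type II. Type I positions hold at most one bead, positions of type II and III may hold several; gray beads occur only in type III. The bead configuration determines $Y$. Operations: $(B_1)$ if a bead is at $s>\ell$ in a runner of type I and there is no bead at $s-\ell$, move it to $s-\ell$ and switch the color (white/gray) of the beads at positions $k$, $s-\ell<k<s$, in the runner of type III; $(B_2)$ if a bead is at $s>\ell$ in the runner of type II, move it to $s-\ell$ and switch the color of the beads at positions $k$, $s-\ell<k<s$, in the runner of type III; $(B_3)$ if beads are at $s$ and $\ell-s$ ($1\le s\le n-1$), remove both, and if $R_n$ is of type III switch the color of the beads at $n$; $(B_4)$ if $R_\ell$ is of type II and there is a bead at $\ell$, remove one bead at $\ell$ and switch the color of the beads at $n$; $(B_5)$ if $R_n$ is of type II and there are at least two beads at $n$, remove two beads at $n$. $\widetilde Y$ is the proper Young wall obtained from $Y$ by applying $(B_1)$–$(B_5)$ until none applies. **Partitions.** $\mathcal P^{(k)}(m)$: $k$-tuples of partitions of total size $m$. $\mathcal{OP}(m)$: partitions of $m$ all of whose parts are odd. A partition is 2-reduced if $\lambda_i-\lambda_{i+1}\le1$ for all $i\ge1$ (trailing zeros included). $\mathcal{DP}_0(m)$: 2-reduced partitions with empty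 2-core and 2-weight $m$ (size $2m$); $\mathcal{DP}_0=\bigcup_m\mathcal{DP}_0(m)$. $\ell(\lambda)$ is the number of nonzero parts. $\mathcal Q(m)$: triples $(\mu,\nu,c)$ with (i) $\mu\in\mathcal{DP}_0$, $\ell(\mu)$ even; (ii) $\nu$ a partition with $\ell(\nu)\le\ell(\mu)$ and $|\mu|+|\nu|-\ell(\mu)/2=m$; (iii) $c\in\{0,1\}$, and $c=0$ if $\mu=(0)$. Frobenius notation: $(\lambda'|\lambda'')$, for strictly decreasing sequences of non-negative integers of the same length $r$, is the partition $\lambda$ with exactly $r$ diagonal boxes, $\lambda_k=\lambda''_k+k$, $\lambda^t_k=\lambda'_k+k$ for $1\le k\le r$. A two-colored partition has each positive part colored white ($k$) or gray ($\underline k$). $\mathcal P'$ is the set of those in which $k$ and $\underline k$ never both occur, for every $k\ge 1$. Addition is partwise; a sum of two positive parts is white if they have the same color and gray otherwise, and $a+0=a$; ordinary partitions are regarded as all white. **$\pi_0$.** Let $Y\in\mathcal Z(\Lambda)_{\Lambda-m\delta}$. For $1\le k\le n-1$, $R_k$ and $R_{\ell-k}$ contain equally many beads; for $j\in\{k,\ell-k\}$ with bead positions $N_1>N_2>\cdots$ in $R_j$ put $\mu^{(j)}=((N_i-j)/\ell)_i$, and $\lambda^{(k)}=(\mu^{(k)}|\mu^{(\ell-k)})$. If $\Lambda=\Lambda_n$, $\lambda^{(0)}=(1^{m_1},2^{m_2},\dots)$ with $m_k$ the number of beads at $k\ell$; if $\Lambda\in\{\Lambda_0,\Lambda_1\}$,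 $\lambda^{(0)}=(1^{m_1},3^{m_3},\dots)$ with $m_{2k-1}$ the number of beads at $(2k-1)n$. $\pi_0(Y)=(\lambda^{(0)},\dots,\lambda^{(n-1)})$. **$\pi_1$ for $\Lambda\in\{\Lambda_0,\Lambda_1\}$.** For $Z\in\mathcal Z(\Lambda)'$, $\lambda_Z\in\mathcal P'$ has $k$ (resp. $\underline k$) with multiplicity the number of white (resp. gray) beads at $k\ell$. Every $\lambda\in\mathcal P'$ is uniquely $\lambda^0+\lambda^1$ with $\lambda^0$ an ordinary (white) partition and $\lambda^1\in\mathcal P'$ 2-reduced, either empty or of the form $(\underline1^{m_1},2^{m_2},\underline3^{m_3},\dots)$ with $m_1\neq0$. $\pi_1(Z)=((\lambda_Z)^0,(\lambda_Z)^1)$, the second entry viewed as an ordinary partition. In (1), $\pi(Y)$ is read as the triple $\lambda^{(0)}\in\mathcal{OP}(2m_1)$, $(\lambda^{(1)},\dots,\lambda^{(n-1)},(\lambda_{\widetilde Y})^0)\in\mathcal P^{(n)}(m_2)$, $(\lambda_{\widetilde Y})^1\in\mathcal{DP}_0(m_3)$. **$\pi_1$ for $\Lambda=\Lambda_n$.** For $Z\in\mathcal Z(\Lambda)'$, $\lambda_Z\in\mathcal P'$ has $k$ (resp. $\underline k$) with multiplicity the number of white (resp. gray) beads at $(2k-1)n$; $Z\mapsto\lambda_Z$ is a bijection $\mathcal Z(\Lambda_n)'\to\mathcal P'$. A proper Young wall is reduced if no column contains a removable $\delta$-column, i.e. $2n$ successive blocks of total content $\delta$ whose removal leaves a proper Young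 wall. There are unique $\mu\in\mathcal P'$ and ordinary partition $\nu$ with $\lambda_Z=\mu+\nu$ and the wall in $\mathcal Z(\Lambda_n)'$ corresponding to $\mu$ reduced; then $\ell(\mu)=\ell(\lambda_Z)$, $\mu$ is 2-reduced and is $(0)$, or $(\underline1^{m_1},2^{m_2},\underline3^{m_3},\dots)$, or $(1^{m_1},\underline2^{m_2},3^{m_3},\dots)$ with $m_1\neq0$. Put $c=0$ in the first two cases and $c=1$ in the third. $\pi_1(Z)=(\mu,\nu,c)$, $\mu$ viewed as an ordinary partition. *)

theory Defs
  imports "HOL-Library.Multiset" "HOL-Library.More_List" "HOL-Library.Disjoint_Sets"
begin

subsection \<open>Young walls of type B_n^(1), level 1\<close>

text \<open>
  The dominant integral weights of level 1 are the fundamental weights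
  Lambda_0, Lambda_1 and Lambda_n.
\<close>

datatype level1 = Lam0 | Lam1 | LamN

text \<open>
  A floor is a unit cube of some color, a split floor \<open>{0,1}\<close>, or a floor \<open>[n]\<close> made of two
  half-height n-blocks. A place is a floor number (counted from 0 at the bottom) together with a
  slot of that floor; a column is identified with its finite set of occupied places, the ground
  state block included.
\<close>

datatype floor_kind = Cube nat | SplitFloor | HalvesFloor

datatype slot = Whole | PosA | PosB | Lower | Upper

type_synonym place = "nat \<times> slot"
type_synonym column = "place set"

text \<open>The entry \<open>Y k\<close> is the column with number \<open>Suc k\<close>, counted from the right.\<close>

type_synonym wall = "nat \<Rightarrow> column"

definition floor_pattern :: "nat \<Rightarrow> level1 \<Rightarrow> floor_kind list" where
  "floor_pattern n L =
     (if L = LamN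
      then [HalvesFloor] @ map Cube (rev [2..<n]) @ [SplitFloor] @ map Cube [2..<n]
      else [SplitFloor] @ map Cube [2..<n] @ [HalvesFloor] @ map Cube (rev [2..<n]))"

definition floor_at :: "nat \<Rightarrow> level1 \<Rightarrow> nat \<Rightarrow> floor_kind" where
  "floor_at n L f = floor_pattern n L ! (f mod length (floor_pattern n L))"

fun slots :: "floor_kind \<Rightarrow> slot set" where
  "slots (Cube i) = {Whole}"
| "slots SplitFloor = {PosA, PosB}"
| "slots HalvesFloor = {Lower, Upper}"

definition posA_color :: "level1 \<Rightarrow> nat \<Rightarrow> nat" where
  "posA_color L k = (if odd k \<longleftrightarrow> L \<noteq> Lam1 then 1 else 0)"

text \<open>The color of the block at a given place of the column with number \<open>k\<close>.\<close>

definition block_color :: "nat \<Rightarrow> level1 \<Rightarrow> nat \<Rightarrow> place \<Rightarrow> nat" where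
  "block_color n L k p =
     (case floor_at n L (fst p) of
        Cube i \<Rightarrow> i
      | HalvesFloor \<Rightarrow> n
      | SplitFloor \<Rightarrow> (if snd p = PosA then posA_color L k else 1 - posA_color L k))"

definition ground :: "level1 \<Rightarrow> column" where
  "ground L = (if L = LamN then {(0, Lower)} else {(0, PosA)})"

definition is_column :: "nat \<Rightarrow> level1 \<Rightarrow> column \<Rightarrow> bool" where
  "is_column n L C \<longleftrightarrow>
     finite C \<and> ground L \<subseteq> C \<and>
     (\<forall>f s. (f, s) \<in> C \<longrightarrow> s \<in> slots (floor_at n L f)) \<and>
     (\<forall>f s. (Suc f, s) \<in> C \<longrightarrow> (\<forall>t \<in> slots (floor_at n L f). (f, t) \<in> C)) \<and>
     (\<forall>f. (f, Upper) \<in> C \<longrightarrow> (f, Lower) \<in> C)"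

definition is_young_wall :: "nat \<Rightarrow> level1 \<Rightarrow> wall \<Rightarrow> bool" where
  "is_young_wall n L Y \<longleftrightarrow>
     (\<forall>k. is_column n L (Y k)) \<and> finite {k. Y k \<noteq> ground L} \<and> (\<forall>k. Y (Suc k) \<subseteq> Y k)"

definition added :: "level1 \<Rightarrow> column \<Rightarrow> nat" where
  "added L C = card (C - ground L)"

definition height :: "column \<Rightarrow> nat" where
  "height C = card (fst ` C)"

definition is_full :: "nat \<Rightarrow> level1 \<Rightarrow> column \<Rightarrow> bool" where
  "is_full n L C \<longleftrightarrow> (let f = Max (fst ` C) in \<forall>s \<in> slots (floor_at n L f). (f, s) \<in> C)"

definition proper_walls :: "nat \<Rightarrow> level1 \<Rightarrow> wall set" where
  "proper_walls n L =
     {Y. is_young_wall n L Y \<and>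
         (\<forall>i j. i \<noteq> j \<longrightarrow> is_full n L (Y i) \<longrightarrow> is_full n L (Y j) \<longrightarrow> height (Y i) \<noteq> height (Y j))}"

definition content :: "nat \<Rightarrow> level1 \<Rightarrow> wall \<Rightarrow> nat \<Rightarrow> nat" where
  "content n L Y i =
     card {(k, p). p \<in> Y k - ground L \<and> block_color n L (Suc k) p = i}"

definition delta :: "nat \<Rightarrow> nat \<Rightarrow> nat" where
  "delta n i = (if i \<le> 1 then 1 else if i \<le> n then 2 else 0)"

text \<open>
  The simple roots are linearly independent, so a weight in the coset of Lambda modulo the root
  lattice is represented by Lambda and its coefficients: \<open>(L, c)\<close> is
  Lambda + \<open>\<Sum>i. c i * alpha_i\<close>.
\<close>

type_synonym weight = "level1 \<times> (nat \<Rightarrow> int)"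

definition wt :: "nat \<Rightarrow> level1 \<Rightarrow> wall \<Rightarrow> weight" where
  "wt n L Y = (L, \<lambda>i. - int (content n L Y i))"

definition proper_walls_wt :: "nat \<Rightarrow> level1 \<Rightarrow> weight \<Rightarrow> wall set" where
  "proper_walls_wt n L w = {Y \<in> proper_walls n L. wt n L Y = w}"

definition minus_delta :: "nat \<Rightarrow> level1 \<Rightarrow> nat \<Rightarrow> weight" where
  "minus_delta n L m = (L, \<lambda>i. - (int m * int (delta n i)))"

definition wall_residue :: "nat \<Rightarrow> level1 \<Rightarrow> nat" where
  "wall_residue n L = (if L = LamN then n else 0)"

definition proper_walls' :: "nat \<Rightarrow> level1 \<Rightarrow> wall set" where
  "proper_walls' n L =
     {Y \<in> proper_walls n L.
        \<forall>k. added L (Y k) \<noteq> 0 \<longrightarrow> added L (Y k) mod (2 * n) = wall_residue n L}"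

text \<open>
  The \<open>2 * n\<close> blocks of \<open>D\<close> are successive (they lie on top of the column), because what remains
  is again a column.
\<close>

definition is_reduced :: "nat \<Rightarrow> level1 \<Rightarrow> wall \<Rightarrow> bool" where
  "is_reduced n L Y \<longleftrightarrow>
     \<not> (\<exists>k D. D \<subseteq> Y k - ground L \<and> card D = 2 * n \<and>
          (\<forall>i. card {p \<in> D. block_color n L (Suc k) p = i} = delta n i) \<and>
          Y(k := Y k - D) \<in> proper_walls n L)"


subsection \<open>Bead configurations\<close>

datatype colour = White | Gray

fun flip :: "colour \<Rightarrow> colour" where
  "flip White = Gray"
| "flip Gray = White"

type_synonym bead_config = "(nat \<times> colour) multiset"

text \<open>
  A block in position B whose floor has no block in position A is automatically the top block of
  its column.
\<close>

definition top_colour :: "column \<Rightarrow> colour" where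
  "top_colour C = (if \<exists>f. (f, PosB) \<in> C \<and> (f, PosA) \<notin> C then Gray else White)"

definition beads :: "nat \<Rightarrow> level1 \<Rightarrow> wall \<Rightarrow> bead_config" where
  "beads n L Y =
     image_mset (\<lambda>k. (added L (Y k), top_colour (Y k))) (mset_set {k. added L (Y k) \<noteq> 0})"

datatype runner_type = TypeI | TypeII | TypeIII

text \<open>The type of the runner containing position \<open>s > 0\<close>.\<close>

definition rtype :: "nat \<Rightarrow> level1 \<Rightarrow> nat \<Rightarrow> runner_type" where
  "rtype n L s =
     (if s mod (2 * n) = n then (if L = LamN then TypeIII else TypeII)
      else if s mod (2 * n) = 0 then (if L = LamN then TypeII else TypeIII)
      else TypeI)"

definition switch :: "nat set \<Rightarrow> bead_config \<Rightarrow> bead_config" where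
  "switch A B = image_mset (\<lambda>(s, c). (s, if s \<in> A then flip c else c)) B"

definition typeIII_between :: "nat \<Rightarrow> level1 \<Rightarrow> nat \<Rightarrow> nat \<Rightarrow> nat set" where
  "typeIII_between n L a b = {k. a < k \<and> k < b \<and> rtype n L k = TypeIII}"

inductive bead_step :: "nat \<Rightarrow> level1 \<Rightarrow> bead_config \<Rightarrow> bead_config \<Rightarrow> bool" for n L where
  B1: "\<lbrakk>(s, c) \<in># B; rtype n L s = TypeI; s > 2 * n; \<forall>d. (s - 2 * n, d) \<notin># B\<rbrakk>
       \<Longrightarrow> bead_step n L B
             (switch (typeIII_between n L (s - 2 * n) s)
               (B - {#(s, c)#} + {#(s - 2 * n, c)#}))"
| B2: "\<lbrakk>(s, c) \<in># B; rtype n L s = TypeII; s > 2 * n\<rbrakk>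
       \<Longrightarrow> bead_step n L B
             (switch (typeIII_between n L (s - 2 * n) s)
               (B - {#(s, c)#} + {#(s - 2 * n, c)#}))"
| B3: "\<lbrakk>(s, c) \<in># B; (2 * n - s, d) \<in># B; 1 \<le> s; s \<le> n - 1\<rbrakk>
       \<Longrightarrow> bead_step n L B
             (switch (if rtype n L n = TypeIII then {n} else {})
               (B - {#(s, c), (2 * n - s, d)#}))"
| B4: "\<lbrakk>rtype n L (2 * n) = TypeII; (2 * n, c) \<in># B\<rbrakk>
       \<Longrightarrow> bead_step n L B (switch {n} (B - {#(2 * n, c)#}))"
| B5: "\<lbrakk>rtype n L n = TypeII; {#(n, c), (n, d)#} \<subseteq># B\<rbrakk>
       \<Longrightarrow> bead_step n L B (B - {#(n, c), (n, d)#})"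

text \<open>The proper Young wall obtained by applying the operations until none applies.\<close>

definition bead_core :: "nat \<Rightarrow> level1 \<Rightarrow> wall \<Rightarrow> wall" where
  "bead_core n L Y =
     (THE Z. Z \<in> proper_walls n L \<and> (bead_step n L)\<^sup>*\<^sup>* (beads n L Y) (beads n L Z) \<and>
        (\<nexists>B. bead_step n L (beads n L Z) B))"


subsection \<open>Partitions\<close>

text \<open>A partition is the weakly decreasing list of its positive parts; \<open>\<ell>(\<lambda>)\<close> is its length.\<close>

definition is_partition :: "nat list \<Rightarrow> bool" where
  "is_partition p \<longleftrightarrow> sorted_wrt (\<ge>) p \<and> 0 \<notin> set p"

definition partition_tuples :: "nat \<Rightarrow> nat \<Rightarrow> nat list list set" where
  "partition_tuples k m =
     {ps. length ps = k \<and> (\<forall>p \<in> set ps. is_partition p) \<and> sum_list (map sum_list ps) = m}"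

definition odd_partitions :: "nat \<Rightarrow> nat list set" where
  "odd_partitions m = {p. is_partition p \<and> sum_list p = m \<and> (\<forall>k \<in> set p. odd k)}"

definition two_reduced :: "nat list \<Rightarrow> bool" where
  "two_reduced p \<longleftrightarrow> (\<forall>i. nth_default 0 p i \<le> nth_default 0 p (Suc i) + 1)"

definition diagram :: "nat list \<Rightarrow> (nat \<times> nat) set" where
  "diagram p = {(i, j). i < length p \<and> j < p ! i}"

text \<open>Removal of a rim 2-hook (domino) of a partition.\<close>

definition domino_removal :: "nat list \<Rightarrow> nat list \<Rightarrow> bool" where
  "domino_removal p q \<longleftrightarrow> is_partition p \<and> is_partition q \<and>
     (\<exists>i j. \<exists>D \<in> {{(i, j), (i, Suc j)}, {(i, j), (Suc i, j)}}.
        D \<subseteq> diagram p \<and> diagram q = diagram p - D)"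

definition is_two_core :: "nat list \<Rightarrow> nat list \<Rightarrow> bool" where
  "is_two_core p q \<longleftrightarrow> domino_removal\<^sup>*\<^sup>* p q \<and> (\<nexists>r. domino_removal q r)"

text \<open>For a partition with empty 2-core, 2-weight \<open>m\<close> means size \<open>2 * m\<close>.\<close>

definition DP0 :: "nat \<Rightarrow> nat list set" where
  "DP0 m = {p. is_partition p \<and> two_reduced p \<and> is_two_core p [] \<and> sum_list p = 2 * m}"

text \<open>
  The size condition \<open>|\<mu>| + |\<nu>| - \<ell>(\<mu>)/2 = m\<close> is written without subtraction.
\<close>

definition Q_triples :: "nat \<Rightarrow> (nat list \<times> nat list \<times> nat) set" where
  "Q_triples m =
     {(\<mu>, \<nu>, c). \<mu> \<in> (\<Union>k. DP0 k) \<and> even (length \<mu>) \<and>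
        is_partition \<nu> \<and> length \<nu> \<le> length \<mu> \<and>
        sum_list \<mu> + sum_list \<nu> = m + length \<mu> div 2 \<and>
        c \<in> {0, 1} \<and> (\<mu> = [] \<longrightarrow> c = 0)}"

text \<open>
  \<open>frobenius l a\<close> is \<open>(l|a)\<close>: the first sequence gives the columns (legs), the second the rows
  (arms). Rows, columns and diagonal boxes are numbered from 0 here.
\<close>

definition frobenius :: "nat list \<Rightarrow> nat list \<Rightarrow> nat list" where
  "frobenius l a =
     (THE p. is_partition p \<and> length l = length a \<and>
        card {k. (k, k) \<in> diagram p} = length a \<and>
        (\<forall>k < length a. p ! k = a ! k + Suc k \<and> card {i. (i, k) \<in> diagram p} = l ! k + Suc k))"

text \<open>
  A two-colored partition in which white \<open>k\<close> and gray \<open>k\<close> never both occur has all equal parts of the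
  same color, so it has a unique weakly decreasing list of colored parts.
\<close>

type_synonym cpart = "(nat \<times> colour) list"

definition P' :: "cpart set" where
  "P' = {x. is_partition (map fst x) \<and> (\<forall>k. \<not> ((k, White) \<in> set x \<and> (k, Gray) \<in> set x))}"

fun cpart_add :: "cpart \<Rightarrow> cpart \<Rightarrow> cpart" where
  "cpart_add [] y = y"
| "cpart_add (a # x) [] = a # x"
| "cpart_add ((j, c) # x) ((k, d) # y) = (j + k, if c = d then White else Gray) # cpart_add x y"

definition white :: "nat list \<Rightarrow> cpart" where
  "white p = map (\<lambda>k. (k, White)) p"

text \<open>
  The forms \<open>(1^m1, 2^m2, 3^m3, ...)\<close> with \<open>m1 \<noteq> 0\<close> in which exactly the odd,
  respectively exactly the even, parts are gray.
\<close>

definition gray_odd :: "cpart \<Rightarrow> bool" where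
  "gray_odd x \<longleftrightarrow> 1 \<in> fst ` set x \<and> (\<forall>(k, c) \<in> set x. c = (if odd k then Gray else White))"

definition gray_even :: "cpart \<Rightarrow> bool" where
  "gray_even x \<longleftrightarrow> 1 \<in> fst ` set x \<and> (\<forall>(k, c) \<in> set x. c = (if even k then Gray else White))"


subsection \<open>The map \<open>\<pi>\<^sub>0\<close>\<close>

text \<open>The bead positions in \<open>R_j\<close> with multiplicities, in weakly decreasing order.\<close>

definition runner_positions :: "nat \<Rightarrow> level1 \<Rightarrow> wall \<Rightarrow> nat \<Rightarrow> nat list" where
  "runner_positions n L Y j =
     rev (sorted_list_of_multiset
       (filter_mset (\<lambda>s. s mod (2 * n) = j mod (2 * n)) (image_mset fst (beads n L Y))))"

definition runner_seq :: "nat \<Rightarrow> level1 \<Rightarrow> wall \<Rightarrow> nat \<Rightarrow> nat list" where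
  "runner_seq n L Y j = map (\<lambda>s. (s - j) div (2 * n)) (runner_positions n L Y j)"

definition lambda0 :: "nat \<Rightarrow> level1 \<Rightarrow> wall \<Rightarrow> nat list" where
  "lambda0 n L Y =
     (if L = LamN then map (\<lambda>s. s div (2 * n)) (runner_positions n L Y (2 * n))
      else map (\<lambda>s. s div n) (runner_positions n L Y n))"

definition pi0 :: "nat \<Rightarrow> level1 \<Rightarrow> wall \<Rightarrow> nat list list" where
  "pi0 n L Y =
     lambda0 n L Y #
     map (\<lambda>k. frobenius (runner_seq n L Y k) (runner_seq n L Y (2 * n - k))) [1..<n]"


subsection \<open>The map \<open>\<pi>\<^sub>1\<close>\<close>

definition typeIII_position :: "nat \<Rightarrow> level1 \<Rightarrow> nat \<Rightarrow> nat" where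
  "typeIII_position n L k = (if L = LamN then (2 * k - 1) * n else k * (2 * n))"

definition wall_cpart :: "nat \<Rightarrow> level1 \<Rightarrow> wall \<Rightarrow> cpart" where
  "wall_cpart n L Z =
     (THE x. x \<in> P' \<and>
        (\<forall>k \<ge> 1. \<forall>c. count (mset x) (k, c) = count (beads n L Z) (typeIII_position n L k, c)))"

text \<open>The pair \<open>(\<lambda>\<^sup>0, \<lambda>\<^sup>1)\<close> of an element of \<open>P'\<close>.\<close>

definition cpart_split :: "cpart \<Rightarrow> nat list \<times> cpart" where
  "cpart_split x =
     (THE (p, y). is_partition p \<and> y \<in> P' \<and> two_reduced (map fst y) \<and>
        (y = [] \<or> gray_odd y) \<and> x = cpart_add (white p) y)"

definition pi1_01 :: "nat \<Rightarrow> level1 \<Rightarrow> wall \<Rightarrow> nat list \<times> nat list" where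
  "pi1_01 n L Z = (case cpart_split (wall_cpart n L Z) of (p, y) \<Rightarrow> (p, map fst y))"

text \<open>
  The decomposition \<open>\<mu> + \<nu>\<close> for Lambda_n. The condition \<open>\<ell>(\<mu>) = \<ell>(\<lambda>)\<close> is needed for
  uniqueness: the white partition \<open>(1)\<close> is \<open>(1) + (0)\<close> as well as \<open>(0) + (1)\<close>, and the walls of both
  \<open>(1)\<close> and \<open>(0)\<close> are reduced.
\<close>

definition cpart_reduce :: "nat \<Rightarrow> cpart \<Rightarrow> cpart \<times> nat list" where
  "cpart_reduce n x =
     (THE (\<mu>, \<nu>). \<mu> \<in> P' \<and> is_partition \<nu> \<and> x = cpart_add \<mu> (white \<nu>) \<and>
        length \<mu> = length x \<and>
        (\<exists>W \<in> proper_walls' n LamN. wall_cpart n LamN W = \<mu> \<and> is_reduced n LamN W))"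

definition pi1_n :: "nat \<Rightarrow> wall \<Rightarrow> nat list \<times> nat list \<times> nat" where
  "pi1_n n Z =
     (case cpart_reduce n (wall_cpart n LamN Z) of
        (\<mu>, \<nu>) \<Rightarrow> (map fst \<mu>, \<nu>, if gray_even \<mu> then 1 else 0))"


subsection \<open>The map \<open>\<pi>\<close> and its targets\<close>

text \<open>
  For Lambda_0 and Lambda_1 the components of \<open>(\<pi>\<^sub>0(Y), \<pi>\<^sub>1(Z))\<close>, \<open>Z = bead_core n L Y\<close>, are
  rearranged into a triple.
\<close>

definition pi_01 :: "nat \<Rightarrow> level1 \<Rightarrow> wall \<Rightarrow> nat list \<times> nat list list \<times> nat list" where
  "pi_01 n L Y =
     (case (pi0 n L Y, pi1_01 n L (bead_core n L Y)) of
        (ps, (p, q)) \<Rightarrow> (hd ps, tl ps @ [p], q))"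

definition pi_n :: "nat \<Rightarrow> wall \<Rightarrow> nat list list \<times> (nat list \<times> nat list \<times> nat)" where
  "pi_n n Y = (pi0 n LamN Y, pi1_n n (bead_core n LamN Y))"

text \<open>
  The summands of both targets are pairwise disjoint, because the sizes of the components determine
  the index; hence the disjoint unions are unions.
\<close>

definition target_01 :: "nat \<Rightarrow> nat \<Rightarrow> (nat list \<times> nat list list \<times> nat list) set" where
  "target_01 n m =
     (\<Union>(m1, m2, m3) \<in> {(m1, m2, m3). m1 + m2 + 2 * m3 = m}.
        odd_partitions (2 * m1) \<times> partition_tuples n m2 \<times> DP0 m3)"

definition target_n :: "nat \<Rightarrow> nat \<Rightarrow> (nat list list \<times> (nat list \<times> nat list \<times> nat)) set" where
  "target_n n m =
     (\<Union>(m1, m2) \<in> {(m1, m2). m1 + m2 = m}. partition_tuples n m1 \<times> Q_triples m2)"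

lemma disjoint_summands_01:
  "disjoint_family_on (\<lambda>(m1, m2, m3). odd_partitions (2 * m1) \<times> partition_tuples n m2 \<times> DP0 m3) UNIV"
  unfolding disjoint_family_on_def by (clarsimp simp: set_eq_iff odd_partitions_def partition_tuples_def DP0_def)

lemma disjoint_summands_n:
  "disjoint_family_on (\<lambda>(m1, m2). partition_tuples n m1 \<times> Q_triples m2) UNIV"
  unfolding disjoint_family_on_def by (clarsimp simp: set_eq_iff partition_tuples_def Q_triples_def)

end

theory Submission
  imports Defs
begin

text \<open>
  A proper Young wall is determined by the weakly decreasing list of its colored beads. Comparing the
  numbers of blocks of neighbouring colors, the weight is \<open>\<Lambda> - m\<delta>\<close> iff \<open>R_k\<close> and \<open>R_{\<ell>-k}\<close> contain
  equally many beads, the positions have sum \<open>2nm\<close>, and the numbers of 0-blocks and 1-blocks agree;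
  the last condition says that an alternating sum over the columns vanishes.

  The operations on beads preserve the color of each bead of type III once it is switched for every
  bead of type I or II above it. Hence the core keeps exactly the beads of type III, with their
  colors switched in this way, and the wall can be recovered from the core and the positions
  of the other beads. The latter are encoded bijectively by \<open>\<pi>_0\<close>: two sets of the same size are the
  Frobenius coordinates of a partition.

  The alternating sum is unchanged on passing to the core, where it depends on the sequence of colors
  only. The color sequence is equivalent to a 2-reduced partition, whose parts count color changes,
  and the alternating sum becomes the checkerboard count of its diagram, which vanishes
  iff the 2-core is empty.
\<close>

subsection \<open>Frobenius coordinates\<close>

lemma diagram_Cons_0: "(0, j) \<in> diagram (a # p) \<longleftrightarrow> j < a"
  by (simp add: diagram_def)

lemma diagram_Cons_Suc: "(Suc i, j) \<in> diagram (a # p) \<longleftrightarrow> (i, j) \<in> diagram p"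
  by (simp add: diagram_def)

lemma finite_diagram: "finite (diagram p)"
proof -
  have "diagram p \<subseteq> {..<length p} \<times> {..<Max (insert 0 (set p))}"
    by (auto simp: diagram_def intro: less_le_trans)
  then show ?thesis by (rule finite_subset) simp
qed

definition frob_coords :: "nat list \<Rightarrow> nat list \<Rightarrow> nat list \<Rightarrow> bool" where
  "frob_coords l a p \<longleftrightarrow> is_partition p \<and> length l = length a \<and>
     card {k. (k, k) \<in> diagram p} = length a \<and>
     (\<forall>k < length a. p ! k = a ! k + Suc k \<and> card {i. (i, k) \<in> diagram p} = l ! k + Suc k)"

text \<open>The first hook has leg \<open>l\<close> and arm \<open>a\<close>; removing it leaves \<open>p\<close>.\<close>

definition hook :: "nat \<Rightarrow> nat \<Rightarrow> nat list \<Rightarrow> nat list" where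
  "hook l a p = Suc a # map Suc p @ replicate (l - length p) 1"

lemma is_partition_Cons: "is_partition (a # p) \<longleftrightarrow> 0 < a \<and> (\<forall>b \<in> set p. b \<le> a) \<and> is_partition p"
  by (auto simp: is_partition_def)

lemma is_partition_hook:
  assumes "is_partition p" "length p \<le> l" "\<forall>b \<in> set p. b \<le> a"
  shows "is_partition (hook l a p)"
  using assms by (auto simp: hook_def is_partition_def sorted_wrt_append sorted_wrt_map Suc_leI
    sorted_wrt_iff_nth_less[of _ "replicate _ _"])

lemma hook_surj:
  assumes p: "is_partition p" "p \<noteq> []"
  obtains l a q where "p = hook l a q" "is_partition q" "length q \<le> l" "\<forall>b \<in> set q. b \<le> a"
proof -
  obtain b r where br: "p = b # r" using p(2) by (cases p) auto
  define q where "q = map (\<lambda>x. x - 1) (takeWhile (\<lambda>x. 1 < x) r)"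
  have r: "is_partition r" "0 < b" "\<forall>x \<in> set r. x \<le> b" using p(1) br by (auto simp: is_partition_Cons)
  have dw: "\<forall>x \<in> set (dropWhile (\<lambda>x. 1 < x) r). x = 1"
    using r(1)
  proof (induction r)
    case (Cons c r)
    show ?case
    proof (cases "1 < c")
      case False
      then have "c = 1" using Cons.prems by (simp add: is_partition_Cons)
      moreover have "x = 1" if "x \<in> set r" for x
        using that Cons.prems \<open>c = 1\<close>
          by (auto simp: is_partition_Cons) (metis is_partition_def le_antisym less_one not_le le_Suc_eq le_zero_eq)
      ultimately show ?thesis by simp
    qed (use Cons in \<open>simp add: is_partition_Cons\<close>)
  qed simp
  have "r = map Suc q @ replicate (length r - length q) 1"
  proof -
    have "map Suc q = takeWhile (\<lambda>x. 1 < x) r"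
      unfolding q_def map_map by (rule map_idI) (auto dest: set_takeWhileD)
    moreover have "dropWhile (\<lambda>x. 1 < x) r = replicate (length (dropWhile (\<lambda>x. 1 < x) r)) 1"
      using dw by (simp add: replicate_length_same)
    moreover have "length (dropWhile (\<lambda>x. 1 < x) r) = length r - length q"
      by (metis add_diff_cancel_left' append_eq_conv_conj calculation(1) length_append length_map takeWhile_dropWhile_id)
    ultimately show ?thesis by (metis takeWhile_dropWhile_id)
  qed
  then have "p = hook (length r) (b - 1) q" using r(2) br by (simp add: hook_def)
  moreover have "is_partition q"
    using r(1) unfolding is_partition_def q_def sorted_wrt_map
    by (auto dest: set_takeWhileD intro!: sorted_wrt_mono_rel[of _ "(\<ge>)"] sorted_wrt_takeWhile)
  moreover have "length q \<le> length r" by (simp add: q_def length_takeWhile_le)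
  moreover have "\<forall>x \<in> set q. x \<le> b - 1" using r(3) by (auto simp: q_def dest!: set_takeWhileD)
  ultimately show thesis using that by blast
qed

lemma diagram_hook:
  "length q \<le> l \<Longrightarrow> (i, j) \<in> diagram (hook l a q) \<longleftrightarrow>
     (case (i, j) of (0, _) \<Rightarrow> j \<le> a | (Suc i', 0) \<Rightarrow> i' < l | (Suc i', Suc j') \<Rightarrow> (i', j') \<in> diagram q)"
  by (cases i; cases j) (auto simp: hook_def diagram_def nth_append split: if_splits)

lemma sum_list_hook: "length q \<le> l \<Longrightarrow> sum_list (hook l a q) = sum_list q + l + a + 1"
  by (induction q) (auto simp: hook_def sum_list_replicate sum_list_Suc)

lemma finite_diag: "finite {k. (k, k) \<in> diagram p}" "finite {i. (i, j) \<in> diagram p}"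
proof -
  show "finite {k. (k, k) \<in> diagram p}"
    by (rule finite_subset[of _ "fst ` diagram p"]) (force simp: finite_diagram)+
  show "finite {i. (i, j) \<in> diagram p}"
    by (rule finite_subset[of _ "fst ` diagram p"]) (force simp: finite_diagram)+
qed

lemma card_insert_0_Suc: "finite A \<Longrightarrow> card (insert 0 (Suc ` A)) = Suc (card A)"
  by (simp add: card_image)

lemma card_diag_hook:
  assumes "length q \<le> l"
  shows "card {k. (k, k) \<in> diagram (hook l a q)} = Suc (card {k. (k, k) \<in> diagram q})"
proof -
  have "{k. (k, k) \<in> diagram (hook l a q)} = insert 0 (Suc ` {k. (k, k) \<in> diagram q})"
  proof (intro set_eqI)
    fix k show "k \<in> {k. (k, k) \<in> diagram (hook l a q)} \<longleftrightarrow> k \<in> insert 0 (Suc ` {k. (k, k) \<in> diagram q})"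
      using assms by (cases k) (auto simp: diagram_hook)
  qed
  then show ?thesis by (simp only: card_insert_0_Suc finite_diag)
qed

lemma card_col_hook_0:
  assumes "length q \<le> l"
  shows "card {i. (i, 0) \<in> diagram (hook l a q)} = Suc l"
proof -
  have "{i. (i, 0) \<in> diagram (hook l a q)} = {..l}"
  proof (intro set_eqI)
    fix i show "i \<in> {i. (i, 0) \<in> diagram (hook l a q)} \<longleftrightarrow> i \<in> {..l}"
      using assms by (cases i) (auto simp: diagram_hook)
  qed
  then show ?thesis by simp
qed

lemma card_col_hook_Suc:
  assumes "length q \<le> l" "Suc j \<le> a"
  shows "card {i. (i, Suc j) \<in> diagram (hook l a q)} = Suc (card {i. (i, j) \<in> diagram q})"
proof -
  have "{i. (i, Suc j) \<in> diagram (hook l a q)} = insert 0 (Suc ` {i. (i, j) \<in> diagram q})"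
  proof (intro set_eqI)
    fix k show "k \<in> {i. (i, Suc j) \<in> diagram (hook l a q)} \<longleftrightarrow> k \<in> insert 0 (Suc ` {i. (i, j) \<in> diagram q})"
      using assms by (cases k) (auto simp: diagram_hook)
  qed
  then show ?thesis by (simp only: card_insert_0_Suc finite_diag)
qed

lemma diag_less_length:
  assumes "is_partition p" "k < card {k. (k, k) \<in> diagram p}"
  shows "k < length p \<and> k < p ! k"
proof (rule ccontr)
  assume n: "\<not> (k < length p \<and> k < p ! k)"
  have "{k. (k, k) \<in> diagram p} \<subseteq> {..<k}"
  proof
    fix j assume "j \<in> {k. (k, k) \<in> diagram p}"
    then have j: "j < length p" "j < p ! j" by (auto simp: diagram_def)
    show "j \<in> {..<k}"
    proof (rule ccontr)
      assume "j \<notin> {..<k}"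
      then have "k \<le> j" by simp
      then have "p ! j \<le> p ! k"
        using assms(1) j by (cases "k = j") (auto simp: is_partition_def sorted_wrt_iff_nth_less)
      then show False using n j \<open>k \<le> j\<close> by simp
    qed
  qed
  then have "card {k. (k, k) \<in> diagram p} \<le> card {..<k}" by (rule card_mono[rotated]) simp
  then show False using assms(2) by simp
qed

lemma frob_coords_hook:
  assumes q: "is_partition q" "length q \<le> l" "\<forall>b \<in> set q. b \<le> a"
  shows "frob_coords ls as (hook l a q) \<longleftrightarrow>
    (\<exists>ls' as'. ls = l # ls' \<and> as = a # as' \<and> frob_coords ls' as' q)"
proof
  assume f: "frob_coords ls as (hook l a q)"
  then have len: "length as = Suc (card {k. (k, k) \<in> diagram q})" "length ls = length as"
    by (auto simp: frob_coords_def card_diag_hook[OF q(2)])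
  then obtain l' ls' a' as' where *: "ls = l' # ls'" "as = a' # as'" by (metis length_Suc_conv)
  have r: "hook l a q ! k = as ! k + Suc k" "card {i. (i, k) \<in> diagram (hook l a q)} = ls ! k + Suc k"
    if "k < length as" for k
    using f that by (auto simp: frob_coords_def)
  have "a' = a" using r(1)[of 0] * by (simp add: hook_def)
  moreover have "l' = l" using r(2)[of 0] * card_col_hook_0[OF q(2)] by simp
  moreover have "frob_coords ls' as' q"
    unfolding frob_coords_def
  proof (intro conjI allI impI)
    show "length ls' = length as'" "card {k. (k, k) \<in> diagram q} = length as'" using len * by auto
    fix k assume k: "k < length as'"
    then have kq: "k < length q \<and> k < q ! k" using diag_less_length[OF q(1)] len * by auto
    then show "q ! k = as' ! k + Suc k" using r(1)[of "Suc k"] k * by (simp add: hook_def nth_append)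
    have "Suc k \<le> a" using kq q(3) nth_mem by fastforce
    then show "card {i. (i, k) \<in> diagram q} = ls' ! k + Suc k"
      using r(2)[of "Suc k"] k * card_col_hook_Suc[OF q(2)] by simp
  qed (rule q)
  ultimately show "\<exists>ls' as'. ls = l # ls' \<and> as = a # as' \<and> frob_coords ls' as' q" using * by blast
next
  assume "\<exists>ls' as'. ls = l # ls' \<and> as = a # as' \<and> frob_coords ls' as' q"
  then obtain ls' as' where *: "ls = l # ls'" "as = a # as'" and f: "frob_coords ls' as' q" by blast
  show "frob_coords ls as (hook l a q)"
    unfolding frob_coords_def
  proof (intro conjI allI impI)
    show "is_partition (hook l a q)" by (rule is_partition_hook[OF q])
    show "length ls = length as" "card {k. (k, k) \<in> diagram (hook l a q)} = length as"
      using f * by (auto simp: frob_coords_def card_diag_hook[OF q(2)])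
    fix k assume k: "k < length as"
    have "hook l a q ! k = as ! k + Suc k \<and> card {i. (i, k) \<in> diagram (hook l a q)} = ls ! k + Suc k"
    proof (cases k)
      case 0
      then show ?thesis by (simp add: * card_col_hook_0[OF q(2)]) (simp add: hook_def)
    next
      case (Suc j)
      then have j: "j < length as'" using k * by simp
      then have jq: "j < length q \<and> j < q ! j" using f diag_less_length[OF q(1)]
        by (simp add: frob_coords_def)
      have "Suc j \<le> a" using jq q(3) nth_mem by fastforce
      then show ?thesis using f j jq
        by (simp add: Suc * card_col_hook_Suc[OF q(2)] frob_coords_def) (simp add: hook_def nth_append)
    qed
    then show "hook l a q ! k = as ! k + Suc k" "card {i. (i, k) \<in> diagram (hook l a q)} = ls ! k + Suc k"
      by auto
  qed
qed

lemma frob_coords_Nil: "frob_coords ls as [] \<longleftrightarrow> ls = [] \<and> as = []"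
  by (auto simp: frob_coords_def diagram_def is_partition_def)

lemma frob_coords_bounds:
  assumes "frob_coords ls as p"
  shows "length p \<le> (case ls of [] \<Rightarrow> 0 | l # _ \<Rightarrow> Suc l)" "\<forall>b \<in> set p. b \<le> (case as of [] \<Rightarrow> 0 | a # _ \<Rightarrow> Suc a)"
proof -
  have p: "is_partition p" using assms by (simp add: frob_coords_def)
  show "length p \<le> (case ls of [] \<Rightarrow> 0 | l # _ \<Rightarrow> Suc l)" "\<forall>b \<in> set p. b \<le> (case as of [] \<Rightarrow> 0 | a # _ \<Rightarrow> Suc a)"
  proof (atomize (full), cases "p = []")
    case False
    then obtain l a q where q: "p = hook l a q" "is_partition q" "length q \<le> l" "\<forall>b \<in> set q. b \<le> a"
      using hook_surj[OF p] by metis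
    then show "length p \<le> (case ls of [] \<Rightarrow> 0 | l # _ \<Rightarrow> Suc l) \<and>
        (\<forall>b \<in> set p. b \<le> (case as of [] \<Rightarrow> 0 | a # _ \<Rightarrow> Suc a))"
      using assms frob_coords_hook[OF q(2-4)] by (auto simp: hook_def)
  qed simp
qed

abbreviation strict_decr :: "nat list \<Rightarrow> bool" where
  "strict_decr \<equiv> sorted_wrt (>)"

lemma frob_coords_exists:
  "strict_decr ls \<Longrightarrow> strict_decr as \<Longrightarrow> length ls = length as \<Longrightarrow>
    \<exists>p. frob_coords ls as p \<and> sum_list p = sum_list ls + sum_list as + length ls"
proof (induction ls arbitrary: as)
  case Nil
  then show ?case by (intro exI[of _ "[]"]) (simp add: frob_coords_Nil)
next
  case (Cons l ls)
  then obtain a as' where as: "as = a # as'" by (cases as) auto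
  then have "strict_decr ls" "strict_decr as'" "length ls = length as'" using Cons.prems by auto
  from Cons.IH[OF this] obtain q
    where q: "frob_coords ls as' q" "sum_list q = sum_list ls + sum_list as' + length ls" by blast
  have qp: "is_partition q" using q by (simp add: frob_coords_def)
  have b: "length q \<le> l" "\<forall>b \<in> set q. b \<le> a"
    using frob_coords_bounds[OF q(1)] Cons.prems as by (cases ls; cases as'; auto)+
  show ?case
    using frob_coords_hook[OF qp b] q as
    by (intro exI[of _ "hook l a q"]) (auto simp: sum_list_hook[OF b(1)])
qed

lemma frob_coords_unique: "frob_coords ls as p \<Longrightarrow> frob_coords ls as p' \<Longrightarrow> p = p'"
proof (induction ls arbitrary: as p p')
  case Nil
  have "x = []" if "frob_coords [] as x" for x
  proof (rule ccontr)
    assume "x \<noteq> []"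
    moreover have "is_partition x" using that by (simp add: frob_coords_def)
    ultimately obtain l a q where q: "x = hook l a q" "is_partition q" "length q \<le> l" "\<forall>b \<in> set q. b \<le> a"
      using hook_surj by metis
    then show False using that frob_coords_hook[OF q(2-4)] by auto
  qed
  then show ?case using Nil by metis
next
  case (Cons l ls)
  have *: "\<exists>a as' q. as = a # as' \<and> x = hook l a q \<and> frob_coords ls as' q"
    if f: "frob_coords (l # ls) as x" for x
  proof -
    have "x \<noteq> []" using f by (auto simp: frob_coords_Nil)
    moreover have "is_partition x" using f by (simp add: frob_coords_def)
    ultimately obtain l a q where q: "x = hook l a q" "is_partition q" "length q \<le> l" "\<forall>b \<in> set q. b \<le> a"
      using hook_surj by metis
    then show ?thesis using f frob_coords_hook[OF q(2-4)] by auto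
  qed
  show ?case using *[OF Cons.prems(1)] *[OF Cons.prems(2)] Cons.IH by auto
qed

lemma frob_coords_of_partition:
  assumes "is_partition p"
  shows "\<exists>ls as. strict_decr ls \<and> strict_decr as \<and> frob_coords ls as p"
  using assms
proof (induction "length p" arbitrary: p rule: less_induct)
  case less
  show ?case
  proof (cases "p = []")
    case True
    then show ?thesis by (intro exI[of _ "[]"]) (simp add: frob_coords_Nil)
  next
    case False
    then obtain l a q where q: "p = hook l a q" "is_partition q" "length q \<le> l" "\<forall>b \<in> set q. b \<le> a"
      using hook_surj[OF less.prems] by metis
    have "length q < length p" using q by (simp add: hook_def)
    then obtain ls as where f: "strict_decr ls" "strict_decr as" "frob_coords ls as q"
      using less.hyps q(2) by blast
    have "strict_decr (l # ls) \<and> strict_decr (a # as)"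
    proof (cases "q = []")
      case True
      then show ?thesis using f by (simp add: frob_coords_Nil)
    next
      case False
      then obtain l' a' q' where q': "q = hook l' a' q'" "is_partition q'" "length q' \<le> l'"
          "\<forall>b \<in> set q'. b \<le> a'"
        using hook_surj[OF q(2)] by metis
      then obtain ls' as' where "ls = l' # ls'" "as = a' # as'" using f(3) frob_coords_hook[OF q'(2-4)]
        by auto
      moreover have "l' < l" "a' < a" using q q' by (auto simp: hook_def)
      ultimately show ?thesis using f by auto
    qed
    then show ?thesis using f frob_coords_hook[OF q(2-4)] q(1) by blast
  qed
qed

lemma frob_coords_inj:
  "frob_coords ls as p \<Longrightarrow> frob_coords ls' as' p \<Longrightarrow> ls = ls' \<and> as = as'"
  by (auto simp: frob_coords_def list_eq_iff_nth_eq)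

lemma frobenius_eq: "frob_coords l a p \<Longrightarrow> frobenius l a = p"
  unfolding frobenius_def frob_coords_def[symmetric]
  by (rule the_equality) (auto intro: frob_coords_unique)

lemma frob_coords_frobenius:
  assumes "strict_decr l" "strict_decr a" "length l = length a"
  shows "frob_coords l a (frobenius l a)" "is_partition (frobenius l a)"
    "sum_list (frobenius l a) = sum_list l + sum_list a + length l"
proof -
  obtain p where p: "frob_coords l a p" "sum_list p = sum_list l + sum_list a + length l"
    using frob_coords_exists[OF assms] by blast
  then show "frob_coords l a (frobenius l a)" "is_partition (frobenius l a)"
    "sum_list (frobenius l a) = sum_list l + sum_list a + length l"
    by (simp_all add: frobenius_eq) (simp add: frob_coords_def)
qed

lemma frobenius_inj:
  assumes "strict_decr l" "strict_decr a" "length l = length a"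
    "strict_decr l'" "strict_decr a'" "length l' = length a'" "frobenius l a = frobenius l' a'"
  shows "l = l' \<and> a = a'"
  using frob_coords_inj frob_coords_frobenius(1)[OF assms(1-3)] frob_coords_frobenius(1)[OF assms(4-6)] assms(7)
  by metis

lemma frobenius_surj:
  assumes "is_partition p"
  obtains l a where "strict_decr l" "strict_decr a" "length l = length a" "frobenius l a = p"
  using frob_coords_of_partition[OF assms] frobenius_eq by (metis frob_coords_def)

fun alt :: "int list \<Rightarrow> int" where
  "alt [] = 0"
| "alt (a # xs) = a - alt xs"

(*CUT*)

subsection \<open>Partitions with empty 2-core\<close>

definition checker_sum :: "nat list \<Rightarrow> int" where
  "checker_sum p = alt (map (\<lambda>k. of_bool (odd k)) p)"

lemma checker_sum_simps [simp]: "checker_sum [] = 0" "checker_sum (a # p) = of_bool (odd a) - checker_sum p"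
  by (simp_all add: checker_sum_def)

definition checkerboard :: "(nat \<times> nat) set \<Rightarrow> int" where
  "checkerboard S = (\<Sum>(i, j) \<in> S. (- 1) ^ (i + j))"

lemma diagram_Nil [simp]: "diagram [] = {}"
  by (simp add: diagram_def)

lemma diagram_Cons: "diagram (a # p) = Pair 0 ` {..<a} \<union> (\<lambda>(i, j). (Suc i, j)) ` diagram p"
proof (intro set_eqI)
  fix z :: "nat \<times> nat"
  obtain i j where "z = (i, j)" by fastforce
  then show "z \<in> diagram (a # p) \<longleftrightarrow> z \<in> Pair 0 ` {..<a} \<union> (\<lambda>(i, j). (Suc i, j)) ` diagram p"
    by (cases i) (force simp: diagram_Cons_0 diagram_Cons_Suc image_iff)+
qed

lemma diagram_ConsI:
  assumes "\<And>j. (0, j) \<in> S \<longleftrightarrow> j < a" "\<And>i j. (Suc i, j) \<in> S \<longleftrightarrow> (i, j) \<in> diagram p"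
  shows "diagram (a # p) = S"
proof (intro set_eqI)
  fix z :: "nat \<times> nat"
  obtain i j where "z = (i, j)" by fastforce
  then show "z \<in> diagram (a # p) \<longleftrightarrow> z \<in> S"
    using assms by (cases i) (auto simp: diagram_Cons_0 diagram_Cons_Suc)
qed

lemma checkerboard_diagram: "checkerboard (diagram p) = checker_sum p"
proof (induction p)
  case Nil
  then show ?case by (simp add: checkerboard_def)
next
  case (Cons a p)
  have row: "(\<Sum>j<a. (- 1) ^ j) = (of_bool (odd a) :: int)"
    by (induction a) auto
  have "checkerboard (diagram (a # p)) =
      checkerboard (Pair 0 ` {..<a}) + checkerboard ((\<lambda>(i, j). (Suc i, j)) ` diagram p)"
    unfolding checkerboard_def diagram_Cons by (rule sum.union_disjoint) (auto simp: finite_diagram)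
  also have "checkerboard (Pair 0 ` {..<a}) = of_bool (odd a)"
    unfolding checkerboard_def by (subst sum.reindex) (auto simp: inj_on_def row)
  also have "checkerboard ((\<lambda>(i, j). (Suc i, j)) ` diagram p) = - checkerboard (diagram p)"
    unfolding checkerboard_def
    by (subst sum.reindex) (auto simp: inj_on_def sum_negf case_prod_beta)
  finally show ?case using Cons by simp
qed

lemma checker_sum_domino_removal:
  assumes "domino_removal p q" shows "checker_sum q = checker_sum p"
proof -
  obtain i j D where D: "D \<in> {{(i, j), (i, Suc j)}, {(i, j), (Suc i, j)}}" "D \<subseteq> diagram p"
    "diagram q = diagram p - D"
    using assms unfolding domino_removal_def by blast
  have "checkerboard D = 0" using D(1) by (auto simp: checkerboard_def)
  then show ?thesis
    using D(2,3) finite_diagram[of p] finite_subset[OF D(2)]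
    by (simp add: checkerboard_diagram[symmetric]) (simp add: checkerboard_def sum_diff)
qed

fun stair :: "nat \<Rightarrow> nat list" where
  "stair 0 = []"
| "stair (Suc r) = Suc r # stair r"

lemma checker_sum_stair: "2 * checker_sum (stair r) = (if odd r then int r + 1 else - int r)"
  by (induction r) auto

lemma is_partition_diagram_mono:
  assumes "is_partition p" "diagram p \<subseteq> diagram q" "\<forall>b \<in> set q. b \<le> a" "b \<in> set p"
  shows "b \<le> a"
proof -
  obtain i where i: "i < length p" "p ! i = b" using assms(4) by (meson in_set_conv_nth)
  have "0 < b" using assms(1,4) by (auto simp: is_partition_def intro: Suc_leI gr0I)
  then have "(i, b - 1) \<in> diagram p" using i by (simp add: diagram_def)
  then have "(i, b - 1) \<in> diagram q" using assms(2) by blast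
  then have "i < length q" "b \<le> q ! i" by (auto simp: diagram_def)
  then show ?thesis using assms(3) nth_mem le_trans by blast
qed

lemma domino_removal_Cons:
  assumes "domino_removal p q" "is_partition (a # p)"
  shows "domino_removal (a # p) (a # q)"
proof -
  obtain i j D where D: "D \<in> {{(i, j), (i, Suc j)}, {(i, j), (Suc i, j)}}" "D \<subseteq> diagram p"
    "diagram q = diagram p - D" "is_partition q"
    using assms unfolding domino_removal_def by blast
  let ?D = "(\<lambda>(i, j). (Suc i, j)) ` D"
  have "is_partition (a # q)"
    using D is_partition_diagram_mono[of q p a] assms(2) by (auto simp: is_partition_Cons)
  moreover have "?D \<in> {{(Suc i, j), (Suc i, Suc j)}, {(Suc i, j), (Suc (Suc i), j)}}" using D(1) by auto
  moreover have "?D \<subseteq> diagram (a # p)" using D(2) by (auto simp: diagram_Cons)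
  moreover have "diagram (a # q) = diagram (a # p) - ?D"
    using D(3) by (auto simp: diagram_Cons image_iff)
  ultimately show ?thesis using assms(2) unfolding domino_removal_def by blast
qed

lemma domino_removal_or_stair:
  assumes "is_partition p"
  shows "(\<exists>q. domino_removal p q \<and> sum_list q < sum_list p) \<or> p = stair (length p)"
  using assms
proof (induction p)
  case (Cons a p)
  have p: "is_partition p" using Cons.prems by (simp add: is_partition_Cons)
  show ?case
  proof (cases "\<exists>q. domino_removal p q \<and> sum_list q < sum_list p")
    case True
    then obtain q where "domino_removal p q" "sum_list q < sum_list p" by blast
    then show ?thesis using domino_removal_Cons[OF _ Cons.prems, of q]
      by (intro disjI1 exI[of _ "a # q"]) simp
  next
    case False
    then have st: "p = stair (length p)" using Cons.IH[OF p] by blast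
    define r where "r = length p"
    have pr: "p = stair r" using st by (simp add: r_def)
    have ra: "\<forall>b \<in> set p. b \<le> r" unfolding pr by (induction r) (auto simp: le_Suc_eq)
    have "r \<le> a" using Cons.prems unfolding pr by (cases r) (auto simp: is_partition_Cons)
    then consider "a = Suc r" | "r + 2 \<le> a" | "a = r" by linarith
    then show ?thesis
    proof cases
      case 1
      have "length (a # p) = Suc r" by (simp add: r_def)
      then show ?thesis using 1 pr by simp
    next
      case 2
      show ?thesis
      proof (cases "a = 2")
        case True
        then have "r = 0" using 2 by simp
        have "domino_removal (a # p) []"
          unfolding domino_removal_def
        proof (intro conjI exI bexI)
          show "is_partition []" by (simp add: is_partition_def)
          have d: "diagram (a # p) = {(0, 0), (0, Suc 0)}"
            using True pr \<open>r = 0\<close> by (intro diagram_ConsI) auto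
          show "{(0, 0), (0, Suc 0)} \<subseteq> diagram (a # p)" "diagram [] = diagram (a # p) - {(0, 0), (0, Suc 0)}"
            unfolding d by auto
          show "{(0, 0), (0, Suc 0)} \<in> {{(0::nat, 0::nat), (0, Suc 0)}, {(0, 0), (Suc 0, 0)}}" by simp
        qed (rule Cons.prems)
        then show ?thesis using Cons.prems by (intro disjI1 exI[of _ "[]"]) (auto simp: is_partition_Cons)
      next
        case False
        have "domino_removal (a # p) ((a - 2) # p)"
          unfolding domino_removal_def
        proof (intro conjI exI bexI)
          show "is_partition ((a - 2) # p)" using Cons.prems False 2 ra by (fastforce simp: is_partition_Cons)
          show "{(0, a - 2), (0, Suc (a - 2))} \<subseteq> diagram (a # p)" using 2 by (auto simp: diagram_Cons_0)
          show "diagram ((a - 2) # p) = diagram (a # p) - {(0, a - 2), (0, Suc (a - 2))}"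
            using 2 by (intro diagram_ConsI) (auto simp: diagram_Cons_0 diagram_Cons_Suc)
          show "{(0, a - 2), (0, Suc (a - 2))} \<in> {{(0, a - 2), (0, Suc (a - 2))}, {(0, a - 2), (Suc 0, a - 2)}}" by simp
        qed (rule Cons.prems)
        then show ?thesis using 2 by (intro disjI1 exI[of _ "(a - 2) # p"]) auto
      qed
    next
      case 3
      then obtain s where s: "r = Suc s" using Cons.prems by (cases r) (auto simp: is_partition_Cons)
      have sp: "\<forall>b \<in> set (stair s). b \<le> s" by (induction s) (auto simp: le_Suc_eq)
      have ps: "is_partition (stair s)" using p pr s by (simp add: is_partition_Cons)
      define q where "q = (if s = 0 then [] else s # s # stair s)"
      have "domino_removal (a # p) q"
        unfolding domino_removal_def
      proof (intro conjI exI bexI)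
        show "is_partition q" using sp ps by (auto simp: q_def is_partition_Cons is_partition_def)
        show "{(0, s), (Suc 0, s)} \<subseteq> diagram (a # p)" using 3 s pr
          by (auto simp: diagram_Cons_0 diagram_Cons_Suc)
        have dq: "diagram q = diagram (s # s # stair s)" by (auto simp: q_def diagram_Cons)
        show "diagram q = diagram (a # p) - {(0, s), (Suc 0, s)}"
          unfolding dq
        proof (rule diagram_ConsI)
          show "(0, j) \<in> diagram (a # p) - {(0, s), (Suc 0, s)} \<longleftrightarrow> j < s" for j
            using 3 s by (auto simp: diagram_Cons_0)
          show "(Suc i, j) \<in> diagram (a # p) - {(0, s), (Suc 0, s)} \<longleftrightarrow> (i, j) \<in> diagram (s # stair s)" for i j
            using s pr by (cases i) (auto simp: diagram_Cons_0 diagram_Cons_Suc)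
        qed
        show "{(0, s), (Suc 0, s)} \<in> {{(0, s), (0, Suc s)}, {(0, s), (Suc 0, s)}}" by simp
      qed (rule Cons.prems)
      moreover have "sum_list q < sum_list (a # p)" using 3 s pr by (auto simp: q_def)
      ultimately show ?thesis by blast
    qed
  qed
qed simp

lemma domino_removal_Nil: "\<not> domino_removal [] r"
  by (auto simp: domino_removal_def)

lemma is_two_core_Nil_iff:
  assumes "is_partition p" shows "is_two_core p [] \<longleftrightarrow> checker_sum p = 0"
proof
  assume "is_two_core p []"
  then have "domino_removal\<^sup>*\<^sup>* p []" by (simp add: is_two_core_def)
  then have "checker_sum [] = checker_sum p" by induction (auto simp: checker_sum_domino_removal)
  then show "checker_sum p = 0" by simp
next
  assume "checker_sum p = 0"
  with assms have "domino_removal\<^sup>*\<^sup>* p []"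
  proof (induction "sum_list p" arbitrary: p rule: less_induct)
    case less
    consider q where "domino_removal p q" "sum_list q < sum_list p" | "p = stair (length p)"
      using domino_removal_or_stair[OF less.prems(1)] by blast
    then show ?case
    proof cases
      case 1
      then have "is_partition q" by (simp add: domino_removal_def)
      then show ?thesis using less 1 checker_sum_domino_removal[OF 1(1)]
        by (metis converse_rtranclp_into_rtranclp)
    next
      case 2
      then have "2 * checker_sum (stair (length p)) = 0" using less.prems(2) by simp
      then have "length p = 0" unfolding checker_sum_stair by (auto split: if_splits)
      then show ?thesis by simp
    qed
  qed
  then show "is_two_core p []" by (simp add: is_two_core_def domino_removal_Nil)
qed

lemma DP0_iff: "p \<in> DP0 m \<longleftrightarrow> is_partition p \<and> two_reduced p \<and> checker_sum p = 0 \<and> sum_list p = 2 * m"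
  by (auto simp: DP0_def is_two_core_Nil_iff)

lemma checker_sum_parity: "even (checker_sum p) \<longleftrightarrow> even (sum_list p)"
  by (induction p) auto

lemma DP0_Union_iff: "p \<in> (\<Union>k. DP0 k) \<longleftrightarrow> is_partition p \<and> two_reduced p \<and> checker_sum p = 0"
  using checker_sum_parity[of p] by (auto simp: DP0_iff elim!: evenE)

subsection \<open>Two-colored partitions\<close>

abbreviation part_at :: "nat list \<Rightarrow> nat \<Rightarrow> nat" where
  "part_at \<equiv> nth_default 0"

abbreviation cpart_at :: "cpart \<Rightarrow> nat \<Rightarrow> nat \<times> colour" where
  "cpart_at \<equiv> nth_default (0, White)"

lemma all_nat_Suc: "(\<forall>i. Q i) \<longleftrightarrow> Q 0 \<and> (\<forall>i. Q (Suc i))"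
  by (metis not0_implies_Suc)

lemma is_partition_Cons_at: "is_partition (a # p) \<longleftrightarrow> 0 < a \<and> is_partition p \<and> part_at p 0 \<le> a"
  by (cases p) (auto simp: is_partition_Cons)

lemma is_partition_iff: "is_partition p \<longleftrightarrow> 0 \<notin> set p \<and> (\<forall>i. part_at p (Suc i) \<le> part_at p i)"
proof (induction p)
  case (Cons a p)
  show ?case unfolding is_partition_Cons_at Cons by (subst (2) all_nat_Suc) auto
qed (simp add: is_partition_def)

lemma is_partition_Nil [simp]: "is_partition []"
  by (simp add: is_partition_def)

lemma two_reduced_Nil [simp]: "two_reduced []"
  by (simp add: two_reduced_def)

lemma two_reduced_Cons: "two_reduced (a # p) \<longleftrightarrow> two_reduced p \<and> a \<le> part_at p 0 + 1"
  unfolding two_reduced_def by (subst all_nat_Suc) auto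

lemma P'_Cons: "b # x \<in> P' \<longleftrightarrow> 0 < fst b \<and> x \<in> P' \<and> (fst (cpart_at x 0) < fst b \<or> cpart_at x 0 = b)"
proof (cases x)
  case Nil
  then show ?thesis by (cases b) (auto simp: P'_def is_partition_def)
next
  case (Cons b' y)
  obtain k c k' c' where b: "b = (k, c)" "b' = (k', c')" by fastforce
  show ?thesis
  proof
    assume a: "b # x \<in> P'"
    then show "0 < fst b \<and> x \<in> P' \<and> (fst (cpart_at x 0) < fst b \<or> cpart_at x 0 = b)"
      unfolding Cons b by (cases c; cases c') (auto simp: P'_def is_partition_Cons)
  next
    assume a: "0 < fst b \<and> x \<in> P' \<and> (fst (cpart_at x 0) < fst b \<or> cpart_at x 0 = b)"
    have le: "\<forall>k2 \<in> fst ` set x. k2 \<le> k'"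
      using a unfolding Cons b by (auto simp: P'_def is_partition_Cons)
    have eq: "c2 = c" if "(k, c2) \<in> set x" for c2
    proof -
      have "k \<le> k'" using le that by force
      then have "b' = b" using a unfolding Cons b by auto
      then show ?thesis using a that unfolding Cons b by (cases c; cases c2) (auto simp: P'_def)
    qed
    show "b # x \<in> P'"
      unfolding P'_def
    proof (intro CollectI conjI allI notI)
      show "is_partition (map fst (b # x))" using a le by (fastforce simp: P'_def is_partition_Cons Cons b)
      fix k2 assume h: "(k2, White) \<in> set (b # x) \<and> (k2, Gray) \<in> set (b # x)"
      have "\<not> ((k2, White) \<in> set x \<and> (k2, Gray) \<in> set x)" using a by (simp add: P'_def)
      with h eq b show False by (cases c) auto
    qed
  qed
qed

lemma P'_Nil [simp]: "[] \<in> P'"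
  by (simp add: P'_def is_partition_def)

lemma P'_iff: "x \<in> P' \<longleftrightarrow> 0 \<notin> fst ` set x \<and>
    (\<forall>i. fst (cpart_at x (Suc i)) < fst (cpart_at x i) \<or> cpart_at x (Suc i) = cpart_at x i)"
proof (induction x)
  case (Cons b x)
  show ?case unfolding P'_Cons Cons by (subst (2) all_nat_Suc) auto
qed simp

lemma cpart_at_add: "cpart_at (cpart_add x y) i =
    (fst (cpart_at x i) + fst (cpart_at y i), if snd (cpart_at x i) = snd (cpart_at y i) then White else Gray)"
proof (induction x y arbitrary: i rule: cpart_add.induct)
  case (1 y)
  then show ?case by (cases "cpart_at y i"; cases "snd (cpart_at y i)") auto
next
  case (2 a x)
  then show ?case by (cases "cpart_at (a # x) i"; cases "snd (cpart_at (a # x) i)") auto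
next
  case (3 j c x k d y)
  then show ?case by (cases i) auto
qed

lemma cpart_add_Nil2 [simp]: "cpart_add x [] = x"
  by (cases x) auto

lemma cpart_add_pos: "0 \<notin> fst ` set x \<Longrightarrow> 0 \<notin> fst ` set y \<Longrightarrow> 0 \<notin> fst ` set (cpart_add x y)"
  by (induction x y rule: cpart_add.induct) auto

lemma sum_cpart_add: "sum_list (map fst (cpart_add x y)) = sum_list (map fst x) + sum_list (map fst y)"
  by (induction x y rule: cpart_add.induct) auto

lemma length_cpart_add: "length (cpart_add x y) = max (length x) (length y)"
  by (induction x y rule: cpart_add.induct) auto

lemma partition_eqI:
  "is_partition p \<Longrightarrow> is_partition q \<Longrightarrow> (\<And>i. part_at p i = part_at q i) \<Longrightarrow> p = q"
proof (induction p arbitrary: q)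
  case Nil
  then show ?case using Nil(3)[of 0] by (cases q) (auto simp: is_partition_Cons)
next
  case (Cons a p)
  then obtain b q' where q: "q = b # q'" using Cons.prems(3)[of 0] by (cases q) (auto simp: is_partition_Cons)
  have "part_at p i = part_at q' i" for i using Cons.prems(3)[of "Suc i"] q by simp
  then show ?case using Cons.IH[of q'] Cons.prems(1,2) Cons.prems(3)[of 0] q by (simp add: is_partition_Cons)
qed

lemma two_reduced_eqI:
  assumes p: "is_partition p" "two_reduced p" and q: "is_partition q" "two_reduced q"
    and par: "\<And>i. odd (part_at p i) \<longleftrightarrow> odd (part_at q i)"
  shows "p = q"
proof (rule partition_eqI[OF p(1) q(1)])
  fix i
  have "part_at p (N - k) = part_at q (N - k)" if "N = length p + length q" "k \<le> N" for N k
    using that(2)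
  proof (induction k)
    case 0
    then show ?case using that by (simp add: nth_default_def)
  next
    case (Suc k)
    then have S: "N - k = Suc (N - Suc k)" by simp
    have "part_at p (N - k) \<le> part_at p (N - Suc k)" "part_at q (N - k) \<le> part_at q (N - Suc k)"
      "part_at p (N - Suc k) \<le> part_at p (N - k) + 1" "part_at q (N - Suc k) \<le> part_at q (N - k) + 1"
      unfolding S using p q by (auto simp: is_partition_iff two_reduced_def)
    moreover have "part_at p (N - k) = part_at q (N - k)" using Suc by simp
    moreover have "x = y" if "z \<le> x" "z \<le> y" "x \<le> z + 1" "y \<le> z + 1" "odd x = odd y" for x y z :: nat
      using that by presburger
    ultimately show ?case using par[of "N - Suc k"] by metis
  qed
  from this[OF refl, of "length p + length q - i"]
  show "part_at p i = part_at q i" by (cases "i \<le> length p + length q") (auto simp: nth_default_def)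
qed

definition parity_colour :: "nat \<Rightarrow> nat \<Rightarrow> colour" where
  "parity_colour c k = (if odd k \<longleftrightarrow> c = 0 then Gray else White)"

definition colour_parts :: "nat \<Rightarrow> nat list \<Rightarrow> cpart" where
  "colour_parts c p = map (\<lambda>k. (k, parity_colour c k)) p"

lemma map_fst_colour_parts [simp]: "map fst (colour_parts c p) = p"
  by (simp add: colour_parts_def comp_def)

lemma fst_set_colour_parts [simp]: "fst ` set (colour_parts c p) = set p"
  by (simp add: colour_parts_def image_image)

abbreviation split_sum :: "nat list \<Rightarrow> nat list \<Rightarrow> cpart" where
  "split_sum p q \<equiv> cpart_add (white p) (colour_parts 0 q)"

abbreviation reduce_sum :: "nat \<Rightarrow> nat list \<Rightarrow> nat list \<Rightarrow> cpart" where
  "reduce_sum c q \<nu> \<equiv> cpart_add (colour_parts c q) (white \<nu>)"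

lemma length_colour_parts [simp]: "length (colour_parts c p) = length p"
  by (simp add: colour_parts_def)

lemma colour_parts_Cons [simp]: "colour_parts c (a # p) = (a, parity_colour c a) # colour_parts c p"
  by (simp add: colour_parts_def)

lemma colour_parts_Nil [simp]: "colour_parts c [] = []"
  by (simp add: colour_parts_def)

lemma white_simps [simp]: "white [] = []" "white (a # p) = (a, White) # white p" "length (white p) = length p"
  "map fst (white p) = p"
  by (simp_all add: white_def comp_def)

lemma cpart_at_colour_parts:
  "cpart_at (colour_parts c p) i =
      (if i < length p then (part_at p i, parity_colour c (part_at p i)) else (0, White))"
  by (simp add: nth_default_def colour_parts_def)

lemma cpart_at_white: "cpart_at (white p) i = (part_at p i, White)"
  by (simp add: nth_default_def white_def)

lemma parity_colour_0: "parity_colour 0 0 = White"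
  by (simp add: parity_colour_def)

lemma cpart_at_colour_parts_0: "cpart_at (colour_parts 0 p) i = (part_at p i, parity_colour 0 (part_at p i))"
  by (simp add: nth_default_def colour_parts_def parity_colour_0)

lemma pos_colour_parts: "is_partition p \<Longrightarrow> 0 \<notin> fst ` set (colour_parts c p)"
  by (auto simp: colour_parts_def is_partition_def)

lemma pos_white: "is_partition p \<Longrightarrow> 0 \<notin> fst ` set (white p)"
  by (auto simp: white_def is_partition_def)

lemma colour_parts_P': "is_partition p \<Longrightarrow> colour_parts c p \<in> P'"
proof (induction p)
  case (Cons a p)
  then show ?case by (cases p) (auto simp: P'_Cons is_partition_Cons)
qed simp

lemma alt_zero: "(\<And>b. b \<in> set x \<Longrightarrow> f b = 0) \<Longrightarrow> alt (map f x) = 0"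
  by (induction x) auto

lemma cpart_at_split: "cpart_at (split_sum p q) i =
    (part_at p i + part_at q i, parity_colour 0 (part_at q i))"
  by (simp add: cpart_at_add cpart_at_white cpart_at_colour_parts_0 parity_colour_def)

lemma split_P':
  assumes "is_partition p" "is_partition q"
  shows "split_sum p q \<in> P'"
  unfolding P'_iff
proof (intro conjI allI)
  show "0 \<notin> fst ` set (split_sum p q)"
    using assms by (intro cpart_add_pos pos_white pos_colour_parts)
  fix i
  have "part_at p (Suc i) \<le> part_at p i" "part_at q (Suc i) \<le> part_at q i"
    using assms by (auto simp: is_partition_iff)
  then show "fst (cpart_at (split_sum p q) (Suc i)) < fst (cpart_at (split_sum p q) i) \<or>
    cpart_at (split_sum p q) (Suc i) = cpart_at (split_sum p q) i"
    unfolding cpart_at_split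
      by (cases "part_at p (Suc i) = part_at p i \<and> part_at q (Suc i) = part_at q i") auto
qed

lemma split_inj:
  assumes "is_partition p" "is_partition q" "two_reduced q" "is_partition p'" "is_partition q'"
      "two_reduced q'"
    and eq: "split_sum p q = split_sum p' q'"
  shows "p = p' \<and> q = q'"
proof -
  have at: "part_at p i + part_at q i = part_at p' i + part_at q' i"
    "parity_colour 0 (part_at q i) = parity_colour 0 (part_at q' i)" for i
    using arg_cong[OF eq, of "\<lambda>x. cpart_at x i"] unfolding cpart_at_split by auto
  have "odd (part_at q i) = odd (part_at q' i)" for i
    using at(2)[of i] by (auto simp: parity_colour_def split: if_splits)
  then have "q = q'" using assms by (intro two_reduced_eqI) auto
  then show ?thesis using at(1) assms by (auto intro: partition_eqI)
qed

lemma split_surj: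
  "x \<in> P' \<Longrightarrow> \<exists>p q. is_partition p \<and> is_partition q \<and> two_reduced q \<and> x = split_sum p q"
proof (induction x)
  case Nil
  then show ?case by (intro exI[of _ "[]"]) (simp add: is_partition_def two_reduced_def)
next
  case (Cons b x)
  obtain k c where b: "b = (k, c)" by fastforce
  have k: "0 < k" and x: "x \<in> P'" and hd: "fst (cpart_at x 0) < k \<or> cpart_at x 0 = (k, c)"
    using Cons.prems by (auto simp: P'_Cons b)
  obtain p q where pq: "is_partition p" "is_partition q" "two_reduced q" "x = split_sum p q"
    using Cons.IH x by blast
  define v where "v = part_at q 0"
  define w where "w = (if c = parity_colour 0 v then v else Suc v)"
  have x0: "cpart_at x 0 = (part_at p 0 + v, parity_colour 0 v)" by (simp add: pq(4) cpart_at_split v_def)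
  have wk: "part_at p 0 + w \<le> k" using hd x0 by (auto simp: w_def)
  have cw: "parity_colour 0 w = c" by (cases c) (auto simp: w_def parity_colour_def)
  define q' where "q' = (if w = 0 then [] else w # q)"
  define p' where "p' = (if k - w = 0 then [] else (k - w) # p)"
  have q0: "q = []" if "w = 0"
    using that pq(2) by (cases q) (auto simp: w_def v_def is_partition_Cons split: if_splits)
  have p0: "p = []" if "k - w = 0"
    using that wk pq(1) by (cases p) (auto simp: is_partition_Cons)
  have vw: "v \<le> w" "w \<le> v + 1" by (auto simp: w_def)
  have "is_partition q'" "two_reduced q'"
    using pq vw by (auto simp: q'_def is_partition_Cons_at two_reduced_Cons v_def)
  moreover have "is_partition p'"
    using pq wk by (auto simp: p'_def is_partition_Cons_at)
  moreover have "b # x = split_sum p' q'"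
    using pq(4) q0 p0 cw wk k b
    by (cases "w = 0"; cases "k - w = 0") (auto simp: p'_def q'_def parity_colour_def)
  ultimately show ?case by blast
qed

lemma alt_gray_split:
  "alt (map (\<lambda>b. of_bool (snd b = Gray)) (split_sum p q)) = checker_sum q"
proof (induction p arbitrary: q)
  case Nil
  show ?case by (induction q) (auto simp: parity_colour_def)
next
  case (Cons a p)
  show ?case
  proof (cases q)
    case Nil
    have "alt (map (\<lambda>b. of_bool (snd b = Gray)) (white (a # p))) = 0"
      by (rule alt_zero) (auto simp: white_def)
    then show ?thesis using Nil by simp
  next
    case (Cons b q')
    then show ?thesis using Cons.IH[of q'] by (auto simp: parity_colour_def)
  qed
qed

lemma gray_odd_iff: "gray_odd y \<longleftrightarrow> 1 \<in> fst ` set y \<and> y = colour_parts 0 (map fst y)"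
proof -
  have "(\<forall>(k, c) \<in> set y. c = (if odd k then Gray else White)) \<longleftrightarrow> y = colour_parts 0 (map fst y)"
    by (induction y) (auto simp: parity_colour_def colour_parts_def split: if_splits)
  then show ?thesis by (simp add: gray_odd_def)
qed

lemma gray_even_iff: "gray_even y \<longleftrightarrow> 1 \<in> fst ` set y \<and> y = colour_parts 1 (map fst y)"
proof -
  have "(\<forall>(k, c) \<in> set y. c = (if even k then Gray else White)) \<longleftrightarrow> y = colour_parts 1 (map fst y)"
    by (induction y) (auto simp: parity_colour_def colour_parts_def split: if_splits)
  then show ?thesis by (simp add: gray_even_def)
qed

lemma two_reduced_last:
  assumes "is_partition p" "two_reduced p" "p \<noteq> []"
  shows "last p = 1"
proof -
  have "part_at p (length p - 1) \<le> part_at p (Suc (length p - 1)) + 1" using assms(2)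
    by (simp add: two_reduced_def)
  then have "last p \<le> 1" using assms(3) by (simp add: nth_default_def last_conv_nth)
  moreover have "last p \<noteq> 0" using assms(1,3) last_in_set by (metis is_partition_def)
  ultimately show ?thesis by simp
qed

lemma two_reduced_last_at: "is_partition p \<Longrightarrow> two_reduced p \<Longrightarrow> p \<noteq> [] \<Longrightarrow> part_at p (length p - 1) = 1"
  using two_reduced_last[of p] by (simp add: nth_default_nth last_conv_nth)

lemma one_mem_two_reduced: "is_partition p \<Longrightarrow> two_reduced p \<Longrightarrow> p \<noteq> [] \<Longrightarrow> 1 \<in> set p"
  using two_reduced_last last_in_set by metis

lemma cpart_split_eq:
  assumes "is_partition p" "is_partition q" "two_reduced q"
  shows "cpart_split (split_sum p q) = (p, colour_parts 0 q)"
  unfolding cpart_split_def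
proof (rule the_equality)
  have "q = [] \<or> gray_odd (colour_parts 0 q)"
    using one_mem_two_reduced[OF assms(2,3)] by (auto simp: gray_odd_iff)
  then show "case (p, colour_parts 0 q) of (p', y) \<Rightarrow>
    is_partition p' \<and> y \<in> P' \<and> two_reduced (map fst y) \<and> (y = [] \<or> gray_odd y) \<and>
    split_sum p q = cpart_add (white p') y"
    using assms colour_parts_P' by auto
next
  fix z assume "case z of (p', y) \<Rightarrow>
    is_partition p' \<and> y \<in> P' \<and> two_reduced (map fst y) \<and> (y = [] \<or> gray_odd y) \<and>
    split_sum p q = cpart_add (white p') y"
  then obtain p' y where z: "z = (p', y)" "is_partition p'" "y \<in> P'" "two_reduced (map fst y)"
    "y = [] \<or> gray_odd y" "split_sum p q = cpart_add (white p') y" by (cases z) auto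
  have y: "y = colour_parts 0 (map fst y)" using z(5) by (auto simp: gray_odd_iff)
  have "is_partition (map fst y)" using z(3) by (simp add: P'_def)
  then have "p = p' \<and> q = map fst y" using split_inj[of p q p' "map fst y"] assms z y by auto
  then show "z = (p, colour_parts 0 q)" using z(1) y by simp
qed

lemma cpart_at_reduce:
  assumes "length \<nu> \<le> length q"
  shows "cpart_at (reduce_sum c q \<nu>) i =
    (if i < length q then (part_at q i + part_at \<nu> i, parity_colour c (part_at q i)) else (0, White))"
  using assms unfolding cpart_at_add cpart_at_white cpart_at_colour_parts
  by (auto simp: parity_colour_def nth_default_beyond)

lemma reduce_P':
  assumes "is_partition q" "is_partition \<nu>" "length \<nu> \<le> length q"
  shows "reduce_sum c q \<nu> \<in> P'"
  unfolding P'_iff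
proof (intro conjI allI)
  show pos: "0 \<notin> fst ` set (reduce_sum c q \<nu>)"
    using assms by (intro cpart_add_pos pos_white pos_colour_parts)
  fix i
  have m: "part_at q (Suc i) \<le> part_at q i" "part_at \<nu> (Suc i) \<le> part_at \<nu> i"
    using assms by (auto simp: is_partition_iff)
  have "0 < part_at q i" if "i < length q"
    using assms(1) that by (metis bot_nat_0.not_eq_extremum is_partition_def nth_default_nth nth_mem)
  with m show "fst (cpart_at (reduce_sum c q \<nu>) (Suc i)) < fst (cpart_at (reduce_sum c q \<nu>) i) \<or>
    cpart_at (reduce_sum c q \<nu>) (Suc i) = cpart_at (reduce_sum c q \<nu>) i"
    unfolding cpart_at_reduce[OF assms(3)]
    by (cases "part_at \<nu> (Suc i) = part_at \<nu> i \<and> part_at q (Suc i) = part_at q i") auto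
qed

definition reduced_triple :: "nat list \<Rightarrow> nat list \<Rightarrow> nat \<Rightarrow> bool" where
  "reduced_triple q \<nu> c \<longleftrightarrow> is_partition q \<and> two_reduced q \<and> is_partition \<nu> \<and> length \<nu> \<le> length q \<and>
     c \<in> {0, 1} \<and> (q = [] \<longrightarrow> c = 0)"

lemma reduced_tripleD:
  assumes "reduced_triple q \<nu> c"
  shows "is_partition q" "two_reduced q" "is_partition \<nu>" "length \<nu> \<le> length q" "c \<in> {0, 1}" "q = [] \<longrightarrow> c = 0"
  using assms by (auto simp: reduced_triple_def)

lemma reduce_inj:
  assumes triple: "reduced_triple q \<nu> c" "reduced_triple q' \<nu>' c'"
    and eq: "reduce_sum c q \<nu> = reduce_sum c' q' \<nu>'"
  shows "q = q' \<and> \<nu> = \<nu>' \<and> c = c'"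
proof -
  note q = reduced_tripleD[OF triple(1)] and q' = reduced_tripleD[OF triple(2)]
  have len: "length q = length q'"
    using arg_cong[OF eq, of length] q(4) q'(4) by (simp add: length_cpart_add)
  have at: "part_at q i + part_at \<nu> i = part_at q' i + part_at \<nu>' i"
    "parity_colour c (part_at q i) = parity_colour c' (part_at q' i)" if "i < length q" for i
    using arg_cong[OF eq, of "\<lambda>x. cpart_at x i"] that len
    unfolding cpart_at_reduce[OF q(4)] cpart_at_reduce[OF q'(4)] by auto
  have "c = c'"
  proof (cases "q = []")
    case False
    moreover from False have "q' \<noteq> []" using len by auto
    ultimately have "part_at q (length q - 1) = 1" "part_at q' (length q - 1) = 1"
      using two_reduced_last_at[of q] two_reduced_last_at[of q'] q q' len by auto
    then show ?thesis using at(2)[of "length q - 1"] False q(5) q'(5)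
      by (auto simp: parity_colour_def split: if_splits)
  qed (use q q' len in simp)
  have "odd (part_at q i) = odd (part_at q' i)" for i
    using at(2)[of i] len \<open>c = c'\<close>
      by (cases "i < length q") (auto simp: nth_default_def parity_colour_def split: if_splits)
  then have "q = q'" using q q' by (intro two_reduced_eqI) auto
  have "part_at \<nu> i = part_at \<nu>' i" for i
    using at(1)[of i] \<open>q = q'\<close> q(4) q'(4) by (cases "i < length q") (auto simp: nth_default_def)
  then show ?thesis using \<open>q = q'\<close> \<open>c = c'\<close> q q' partition_eqI by blast
qed

lemma reduce_surj:
  "x \<in> P' \<Longrightarrow> \<exists>q \<nu> c. reduced_triple q \<nu> c \<and> x = reduce_sum c q \<nu>"
proof (induction x)
  case Nil
  then show ?case by (intro exI[of _ "[]"] exI[of _ 0]) (simp add: reduced_triple_def)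
next
  case (Cons b x)
  obtain k c where b: "b = (k, c)" by fastforce
  have k: "0 < k" and x: "x \<in> P'" and hd: "fst (cpart_at x 0) < k \<or> cpart_at x 0 = (k, c)"
    using Cons.prems by (auto simp: P'_Cons b)
  obtain q \<nu> d where pq: "is_partition q" "two_reduced q" "is_partition \<nu>" "length \<nu> \<le> length q"
    "d \<in> {0, 1}" "q = [] \<longrightarrow> d = 0" "x = cpart_add (colour_parts d q) (white \<nu>)"
    using Cons.IH x by (auto simp: reduced_triple_def)
  define e where "e = (if q = [] then (if c = Gray then 0 else 1) else d)"
  define v where "v = part_at q 0"
  define w where "w = (if q = [] then 1 else if c = parity_colour d v then v else Suc v)"
  have x0: "cpart_at x 0 = (part_at \<nu> 0 + v, parity_colour d v)" if "q \<noteq> []"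
    using that pq(4) by (simp add: pq(7) cpart_at_reduce v_def)
  have nu: "\<nu> = []" if "q = []" using that pq(4) by simp
  have vpos: "0 < v" if "q \<noteq> []"
    using that pq(1) by (cases q) (auto simp: v_def is_partition_Cons)
  have wk: "part_at \<nu> 0 + w \<le> k" using hd x0 nu k by (cases "q = []") (auto simp: w_def)
  have cw: "parity_colour e w = c" using pq(5) by (cases c) (auto simp: w_def e_def parity_colour_def)
  have wpos: "0 < w" using vpos by (auto simp: w_def)
  define \<nu>' where "\<nu>' = (if k - w = 0 then [] else (k - w) # \<nu>)"
  have nu0: "\<nu> = []" if "k - w = 0"
    using that wk pq(3) by (cases \<nu>) (auto simp: is_partition_Cons)
  have vw: "v \<le> w" "w \<le> v + 1" by (auto simp: w_def v_def)
  have "is_partition (w # q)" "two_reduced (w # q)"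
    using pq vw wpos by (auto simp: is_partition_Cons_at two_reduced_Cons v_def)
  moreover have "is_partition \<nu>'" "length \<nu>' \<le> length (w # q)"
    using pq wk by (auto simp: \<nu>'_def is_partition_Cons_at)
  moreover have "colour_parts d q = colour_parts e q" by (simp add: e_def)
  then have "b # x = cpart_add (colour_parts e (w # q)) (white \<nu>')"
    using pq(7) nu0 cw wk wpos b by (cases c; cases q) (auto simp: \<nu>'_def)
  moreover have "e \<in> {0, 1}" using pq(5) by (auto simp: e_def)
  ultimately show ?case unfolding reduced_triple_def by blast
qed

definition sgn_colour :: "colour \<Rightarrow> int" where
  "sgn_colour c = (if c = White then 1 else - 1)"

lemma alt_sgn_colour_parts: "alt (map (\<lambda>b. sgn_colour (snd b)) (colour_parts c q)) =
    (if c = 0 then 1 else - 1) * (of_bool (odd (length q)) - 2 * checker_sum q)"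
  by (induction q) (auto simp: parity_colour_def sgn_colour_def)

lemma map_snd_reduce:
  "length \<nu> \<le> length q \<Longrightarrow> map snd (reduce_sum c q \<nu>) = map snd (colour_parts c q)"
proof (induction q arbitrary: \<nu>)
  case (Cons a q)
  then show ?case by (cases \<nu>; cases "parity_colour c a") auto
qed simp

lemma alt_sgn_reduce:
  assumes "length \<nu> \<le> length q"
  shows "alt (map (\<lambda>b. sgn_colour (snd b)) (reduce_sum c q \<nu>)) = 0 \<longleftrightarrow>
    even (length q) \<and> checker_sum q = 0"
proof -
  have "map (\<lambda>b. sgn_colour (snd b)) (reduce_sum c q \<nu>) = map (\<lambda>b. sgn_colour (snd b)) (colour_parts c q)"
    using arg_cong[OF map_snd_reduce[OF assms], of "map sgn_colour" c] by (simp add: comp_def)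
  then have "alt (map (\<lambda>b. sgn_colour (snd b)) (reduce_sum c q \<nu>)) =
    (if c = 0 then 1 else - 1) * (of_bool (odd (length q)) - 2 * checker_sum q)"
    by (simp add: alt_sgn_colour_parts)
  moreover have "2 * checker_sum q \<noteq> 1" by presburger
  ultimately show ?thesis by (auto split: if_splits)
qed

subsection \<open>Columns\<close>

locale rank =
  fixes n :: nat
  assumes n3: "3 \<le> n"
begin

lemma length_floor_pattern: "length (floor_pattern n L) = 2 * n - 2"
  using n3 by (auto simp: floor_pattern_def)

lemma floor_at_eq:
  "floor_at n L f =
     (let i = f mod (2 * n - 2) in
      if i = 0 then (if L = LamN then HalvesFloor else SplitFloor)
      else if i < n - 1 then Cube (if L = LamN then n - i else i + 1)
      else if i = n - 1 then (if L = LamN then SplitFloor else HalvesFloor)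
      else Cube (if L = LamN then i + 2 - n else 2 * n - 1 - i))"
proof -
  define i where "i = f mod (2 * n - 2)"
  have i: "i < 2 * n - 2" using n3 unfolding i_def by (intro mod_less_divisor) auto
  have *: "floor_at n L f = floor_pattern n L ! i"
    by (simp add: floor_at_def length_floor_pattern i_def)
  obtain m where m: "n = m + 3" using n3 by (metis add.commute le_Suc_ex)
  consider "i = 0" | "0 < i" "i < n - 1" | "i = n - 1" | k where "i = n + k" "k < m + 1"
  proof -
    have "i = 0 \<or> 0 < i \<and> i < n - 1 \<or> i = n - 1 \<or> n \<le> i" by linarith
    moreover have "i - n < m + 1" if "n \<le> i" using i that m by linarith
    ultimately show thesis using that by (metis le_add_diff_inverse)
  qed
  then show ?thesis
  proof cases
    case 2
    then have "Suc (i - Suc 0) = i" "i - 1 < m + 1" using m by linarith+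
    moreover have "m + 2 - i + 1 = m + 3 - i" using 2 m by linarith
    ultimately show ?thesis using 2 m unfolding * i_def[symmetric] Let_def
      by (auto simp: floor_pattern_def nth_append nth_Cons' rev_nth)
  next
    case (4 k)
    have "[2..<n] ! (n - Suc (Suc k) - 1) = n - Suc k" using 4 m by simp
    then show ?thesis using 4 m unfolding * i_def[symmetric] Let_def
      by (auto simp: floor_pattern_def nth_append nth_Cons' rev_nth)
  qed (use m in \<open>unfold * i_def[symmetric] Let_def, auto simp: floor_pattern_def nth_append nth_Cons' rev_nth\<close>)
qed

text \<open>
  The blocks of a column are numbered from 0, the ground state block, upwards; on a split floor A
  precedes B. \<open>base f\<close> is the number of the first block of floor \<open>f\<close>. It does not depend on
  \<open>\<Lambda>\<close>, since the two floor patterns differ only in the kinds of their floors.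
\<close>

definition base :: "nat \<Rightarrow> nat" where
  "base f = 2 * n * (f div (2 * n - 2)) +
     (let i = f mod (2 * n - 2) in if i = 0 then 0 else if i < n then i + 1 else i + 2)"

lemma base_0 [simp]: "base 0 = 0"
  by (simp add: base_def)

lemma base_Suc: "base (Suc f) = base f + card (slots (floor_at n L f))"
proof -
  define q i where "q = f div (2 * n - 2)" and "i = f mod (2 * n - 2)"
  have i: "i < 2 * n - 2" using n3 unfolding i_def by (intro mod_less_divisor) auto
  have S: "Suc f div (2 * n - 2) = (if Suc i = 2 * n - 2 then Suc q else q)"
    "Suc f mod (2 * n - 2) = (if Suc i = 2 * n - 2 then 0 else Suc i)"
    by (auto simp: div_Suc mod_Suc q_def i_def)
  show ?thesis
    unfolding base_def S floor_at_eq q_def[symmetric] i_def[symmetric] Let_def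
    using i n3 by (auto simp: algebra_simps)
qed

lemma base_mod: "base f mod (2 * n) =
    (let i = f mod (2 * n - 2) in if i = 0 then 0 else if i < n then i + 1 else i + 2)"
proof -
  have "f mod (2 * n - 2) < 2 * n - 2" using n3 by (intro mod_less_divisor) auto
  then have "Suc (Suc (f mod (2 * n - 2))) < 2 * n" using n3 by linarith
  then show ?thesis using n3 by (auto simp: base_def Let_def)
qed

lemma slots_card: "1 \<le> card (slots k)" "card (slots k) \<le> 2"
  by (cases k; simp)+

lemma base_less: "base f < base (Suc f)"
  using base_Suc[of f Lam0] slots_card(1)[of "floor_at n Lam0 f"] by simp

lemma strict_mono_base: "strict_mono base"
  by (simp add: strict_mono_Suc_iff base_less)

definition index :: "place \<Rightarrow> nat" where
  "index p = base (fst p) + (if snd p \<in> {Upper, PosB} then 1 else 0)"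

definition places :: "level1 \<Rightarrow> place set" where
  "places L = {p. snd p \<in> slots (floor_at n L (fst p))}"

lemma idx_bounds: "p \<in> places L \<Longrightarrow> base (fst p) \<le> index p \<and> index p < base (Suc (fst p))"
  by (cases "floor_at n L (fst p)") (auto simp: index_def places_def base_Suc[of _ L])

lemma between_base: "\<exists>f. base f \<le> t \<and> t < base (Suc f)"
proof (induction t)
  case 0 then show ?case using base_less[of 0] by (intro exI[of _ 0]) simp
next
  case (Suc t)
  then obtain f where f: "base f \<le> t" "t < base (Suc f)" by blast
  show ?case
  proof (cases "Suc t < base (Suc f)")
    case True then show ?thesis using f by (intro exI[of _ f]) simp
  next
    case False then show ?thesis using f base_less[of "Suc f"] by (intro exI[of _ "Suc f"]) simp
  qed
qed

lemma idx_floor_mono: "p \<in> places L \<Longrightarrow> q \<in> places L \<Longrightarrow> fst p < fst q \<Longrightarrow> index p < index q"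
  using idx_bounds[of p L] idx_bounds[of q L]
    strict_mono_less_eq[OF strict_mono_base, of "Suc (fst p)" "fst q"] by linarith

lemma inj_idx: "inj_on index (places L)"
proof (rule inj_onI)
  fix p q assume pq: "p \<in> places L" "q \<in> places L" "index p = index q"
  then have "fst p = fst q"
    using idx_floor_mono[of p L q] idx_floor_mono[of q L p] by (metis less_irrefl nat_neq_iff)
  with pq show "p = q"
    by (cases p; cases q; cases "floor_at n L (fst q)") (auto simp: places_def index_def split: if_splits)
qed

lemma surj_idx: "\<exists>p \<in> places L. index p = t"
proof -
  obtain f where f: "base f \<le> t" "t < base (Suc f)" using between_base by blast
  show ?thesis
  proof (cases "floor_at n L f")
    case (Cube i)
    then show ?thesis using f
      by (intro bexI[of _ "(f, Whole)"]) (auto simp: index_def places_def base_Suc[of _ L])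
  next
    case SplitFloor
    then show ?thesis using f
      by (intro bexI[of _ "(f, if t = base f then PosA else PosB)"]) (auto simp: index_def places_def base_Suc[of _ L])
  next
    case HalvesFloor
    then show ?thesis using f
      by (intro bexI[of _ "(f, if t = base f then Lower else Upper)"]) (auto simp: index_def places_def base_Suc[of _ L])
  qed
qed

text \<open>A gray column has the B-block of its top floor instead of the A-block.\<close>

definition column_indices :: "nat \<Rightarrow> colour \<Rightarrow> nat set" where
  "column_indices N c = (if c = Gray then insert (Suc N) {..<N} else {..N})"

definition column_of :: "level1 \<Rightarrow> nat \<times> colour \<Rightarrow> column" where
  "column_of L b = {p \<in> places L. index p \<in> column_indices (fst b) (snd b)}"

definition valid :: "level1 \<Rightarrow> nat \<times> colour \<Rightarrow> bool" where
  "valid L b \<longleftrightarrow> (snd b = Gray \<longrightarrow> 0 < fst b \<and> fst b mod (2 * n) = wall_residue n L)"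

lemma idx_column_of: "index ` column_of L b = column_indices (fst b) (snd b)"
proof -
  have "t \<in> index ` column_of L b" if "t \<in> column_indices (fst b) (snd b)" for t
    using surj_idx[of L t] that by (auto simp: column_of_def)
  then show ?thesis by (auto simp: column_of_def)
qed

lemma finite_column_indices [simp]: "finite (column_indices N c)" by (simp add: column_indices_def)

lemma card_column_indices [simp]: "card (column_indices N c) = Suc N" by (simp add: column_indices_def)

lemma column_of_places: "column_of L b \<subseteq> places L" by (auto simp: column_of_def)

lemma inj_idx_column: "inj_on index (column_of L b)"
  by (rule inj_on_subset[OF inj_idx column_of_places])

lemma finite_column_of [simp]: "finite (column_of L b)"
  by (rule finite_imageD[OF _ inj_idx_column]) (simp add: idx_column_of)

lemma card_column_of [simp]: "card (column_of L b) = Suc (fst b)"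
  using card_image[OF inj_idx_column[of L b]] by (simp add: idx_column_of)

lemma floor_at_0: "floor_at n L 0 = (if L = LamN then HalvesFloor else SplitFloor)"
  by (simp add: floor_at_eq)

lemma column_of_ground: "column_of L (0, White) = ground L"
proof -
  define p0 where "p0 = (0::nat, if L = LamN then Lower else PosA)"
  have p0: "ground L = {p0}" "p0 \<in> places L" "index p0 = 0"
    by (auto simp: p0_def ground_def places_def floor_at_0 index_def)
  have "p \<in> places L \<and> index p = 0 \<longleftrightarrow> p = p0" for p
    using p0 inj_onD[OF inj_idx[of L], of p p0] by auto
  then show ?thesis by (auto simp: column_of_def column_indices_def p0(1))
qed

lemma split_floor_iff: "floor_at n L f = SplitFloor \<longleftrightarrow> base f mod (2 * n) = wall_residue n L"
proof -
  have "f mod (2 * n - 2) < 2 * n - 2" using n3 by (intro mod_less_divisor) auto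
  then show ?thesis using n3 by (auto simp: floor_at_eq base_mod Let_def wall_residue_def split: if_splits)
qed

lemma halves_floor_iff: "floor_at n L f = HalvesFloor \<longleftrightarrow> base f mod (2 * n) = n - wall_residue n L"
proof -
  have "f mod (2 * n - 2) < 2 * n - 2" using n3 by (intro mod_less_divisor) auto
  then show ?thesis using n3 by (auto simp: floor_at_eq base_mod Let_def wall_residue_def split: if_splits)
qed

lemma ground_subset_column_of:
  assumes "valid L b" shows "ground L \<subseteq> column_of L b"
  using assms unfolding column_of_ground[symmetric]
  by (cases b; cases "snd b") (auto simp: valid_def column_of_def column_indices_def)

lemma base_Suc_eq: "base (Suc f) = base f + 2 \<longleftrightarrow> base f mod (2 * n) = 0 \<or> base f mod (2 * n) = n"
  using split_floor_iff[of Lam0 f] halves_floor_iff[of Lam0 f]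
  by (cases "floor_at n Lam0 f") (auto simp: base_Suc[of f Lam0] wall_residue_def)

lemma valid_gray_base:
  assumes "valid L (N, Gray)"
  shows "\<exists>f. base f = N \<and> floor_at n L f = SplitFloor"
proof -
  have N: "N mod (2 * n) = wall_residue n L" using assms by (simp add: valid_def)
  obtain f where f: "base f \<le> N" "N < base (Suc f)" using between_base by blast
  have "base f = N"
  proof (rule ccontr)
    assume "base f \<noteq> N"
    then have *: "N = Suc (base f)" "base (Suc f) = base f + 2"
      using f slots_card(2)[of "floor_at n Lam0 f"] by (auto simp: base_Suc[of _ Lam0])
    then have "base f mod (2 * n) = 0 \<or> base f mod (2 * n) = n"
      by (subst base_Suc_eq[symmetric]) simp
    with * N show False using n3 by (auto simp: wall_residue_def mod_Suc split: if_splits)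
  qed
  with N show ?thesis using split_floor_iff by metis
qed

lemma column_of_is_column:
  assumes "valid L b" shows "is_column n L (column_of L b)"
proof -
  obtain N c where b: "b = (N, c)" by fastforce
  have nofloor: "(f, t) \<in> column_of L b"
    if "(Suc f, s) \<in> column_of L b" "t \<in> slots (floor_at n L f)" for f s t
  proof -
    have pl: "(f, t) \<in> places L" "(Suc f, s) \<in> places L" using that by (auto simp: places_def column_of_def)
    have lt: "index (f, t) < index (Suc f, s)" using idx_floor_mono[OF pl] by simp
    show ?thesis
    proof (cases "index (Suc f, s) = Suc N \<and> c = Gray")
      case True
      then obtain g where g: "base g = N" "floor_at n L g = SplitFloor"
        using valid_gray_base assms b by blast
      have "base (Suc g) = N + 2" using g by (simp add: base_Suc[of _ L])
      then have "Suc f = g"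
        using idx_bounds[OF pl(2)] True g(1) base_less
        by (metis (no_types, opaque_lifting) add_2_eq_Suc' fst_conv le_less_Suc_eq lessI less_Suc_eq_le not_less_eq strict_mono_base strict_mono_less strict_mono_less_eq)
      then have "index (f, t) < N" using idx_bounds[OF pl(1)] g by simp
      then show ?thesis using pl by (simp add: column_of_def column_indices_def b)
    next
      case False
      then show ?thesis using that(1) lt pl
        by (auto simp: column_of_def column_indices_def b split: if_splits)
    qed
  qed
  have upper: "(f, Lower) \<in> column_of L b" if "(f, Upper) \<in> column_of L b" for f
  proof -
    have pl: "(f, Upper) \<in> places L" using that by (auto simp: column_of_def)
    then have hf: "floor_at n L f = HalvesFloor"
      by (cases "floor_at n L f") (auto simp: places_def)
    have pl': "(f, Lower) \<in> places L" using hf by (simp add: places_def)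
    have i: "index (f, Upper) = Suc (base f)" "index (f, Lower) = base f" by (auto simp: index_def)
    have "\<not> (base f = N \<and> c = Gray)"
      using assms valid_gray_base[of L N] hf b strict_mono_eq[OF strict_mono_base] by fastforce
    then show ?thesis using that pl' i by (auto simp: column_of_def column_indices_def b split: if_splits)
  qed
  show ?thesis unfolding is_column_def
    using ground_subset_column_of[OF assms] nofloor upper column_of_places[of L b]
    by (intro conjI allI impI ballI finite_column_of) (auto simp: places_def)
qed

lemma is_column_lower:
  assumes "is_column n L C" "(f, s) \<in> C" "g < f" "t \<in> slots (floor_at n L g)"
  shows "(g, t) \<in> C"
  using assms(2-4)
proof (induction f arbitrary: s g t)
  case (Suc f)
  have "\<forall>t \<in> slots (floor_at n L f). (f, t) \<in> C" using assms(1) Suc.prems unfolding is_column_def by blast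
  moreover obtain u where "u \<in> slots (floor_at n L f)" by (cases "floor_at n L f") auto
  ultimately show ?case using Suc by (cases "g = f") auto
qed simp

lemma is_columnE:
  assumes C: "is_column n L C"
  obtains b where "valid L b" "C = column_of L b"
proof -
  have fin: "finite C" and gr: "ground L \<subseteq> C" and pl: "C \<subseteq> places L"
    using C by (auto simp: is_column_def places_def)
  have "C \<noteq> {}" using gr by (auto simp: ground_def split: if_splits)
  define M where "M = Max (fst ` C)"
  obtain s where s: "(M, s) \<in> C"
    using Max_in[of "fst ` C"] fin \<open>C \<noteq> {}\<close> by (fastforce simp: M_def)
  define X where "X = {t. (M, t) \<in> C}"
  have Xs: "X \<subseteq> slots (floor_at n L M)" "s \<in> X" using pl s by (auto simp: X_def places_def)
  have Ceq: "p \<in> C \<longleftrightarrow> p \<in> places L \<and> (fst p < M \<or> fst p = M \<and> snd p \<in> X)" for p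
  proof
    assume "p \<in> C"
    then have "fst p \<le> M" using fin by (auto simp: M_def)
    with \<open>p \<in> C\<close> pl show "p \<in> places L \<and> (fst p < M \<or> fst p = M \<and> snd p \<in> X)"
      by (cases p) (auto simp: X_def)
  next
    assume "p \<in> places L \<and> (fst p < M \<or> fst p = M \<and> snd p \<in> X)"
    then show "p \<in> C" using is_column_lower[OF C s] by (cases p) (auto simp: X_def places_def)
  qed
  have fl: "fst p < M \<longleftrightarrow> index p < base M" "fst p = M \<longleftrightarrow> base M \<le> index p \<and> index p < base (Suc M)"
    if "p \<in> places L" for p
  proof -
    have "base (Suc (fst p)) \<le> base M" if "fst p < M"
      using that by (simp add: strict_mono_less_eq[OF strict_mono_base])
    moreover have "base (Suc M) \<le> base (fst p)" if "M < fst p"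
      using that by (simp add: strict_mono_less_eq[OF strict_mono_base])
    ultimately show "fst p < M \<longleftrightarrow> index p < base M"
      "fst p = M \<longleftrightarrow> base M \<le> index p \<and> index p < base (Suc M)"
      using idx_bounds[OF that] base_less[of M] by (cases "fst p" M rule: linorder_cases; force)+
  qed
  consider (full) "X = slots (floor_at n L M)"
    | (A) "floor_at n L M = SplitFloor" "X = {PosA}"
    | (B) "floor_at n L M = SplitFloor" "X = {PosB}"
    | (H) "floor_at n L M = HalvesFloor" "X = {Lower}"
  proof -
    have "(M, Upper) \<in> C \<longrightarrow> (M, Lower) \<in> C" using C by (simp add: is_column_def)
    then have "Upper \<in> X \<longrightarrow> Lower \<in> X" by (simp add: X_def)
    show thesis
    proof (cases "floor_at n L M")
      case (Cube i)
      then have "X = slots (floor_at n L M)" using Xs by auto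
      then show thesis by (rule full)
    next
      case SplitFloor
      consider "X = slots SplitFloor" | "X = {PosA}" | "X = {PosB}" using Xs SplitFloor by auto
      then show thesis using full A B SplitFloor by cases auto
    next
      case HalvesFloor
      consider "X = slots HalvesFloor" | "X = {Lower}"
        using Xs HalvesFloor \<open>Upper \<in> X \<longrightarrow> Lower \<in> X\<close> by auto
      then show thesis using full H HalvesFloor by cases auto
    qed
  qed
  then show thesis
  proof cases
    case full
    have "p \<in> C \<longleftrightarrow> p \<in> places L \<and> index p \<le> base (Suc M) - 1" for p
      using Ceq[of p] fl[of p] full base_less[of M] by (cases p) (auto simp: places_def)
    then have "C = column_of L (base (Suc M) - 1, White)" by (auto simp: column_of_def column_indices_def)
    then show thesis using that[of "(base (Suc M) - 1, White)"] by (simp add: valid_def)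
  next
    case A
    have "p \<in> C \<longleftrightarrow> p \<in> places L \<and> index p \<le> base M" for p
      using Ceq[of p] fl[of p] A by (cases p) (auto simp: index_def places_def base_Suc[of M L])
    then have "C = column_of L (base M, White)" by (auto simp: column_of_def column_indices_def)
    then show thesis using that[of "(base M, White)"] by (simp add: valid_def)
  next
    case H
    have "p \<in> C \<longleftrightarrow> p \<in> places L \<and> index p \<le> base M" for p
      using Ceq[of p] fl[of p] H by (cases p) (auto simp: index_def places_def base_Suc[of M L])
    then have "C = column_of L (base M, White)" by (auto simp: column_of_def column_indices_def)
    then show thesis using that[of "(base M, White)"] by (simp add: valid_def)
  next
    case B
    have "p \<in> C \<longleftrightarrow> p \<in> places L \<and> (index p < base M \<or> index p = Suc (base M))" for p
      using Ceq[of p] fl[of p] B by (cases p) (auto simp: index_def places_def base_Suc[of M L])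
    then have "C = column_of L (base M, Gray)" by (auto simp: column_of_def column_indices_def)
    moreover have "0 < base M"
    proof (rule ccontr)
      assume "\<not> 0 < base M"
      then have "M = 0" using strict_mono_eq[OF strict_mono_base, of M 0] by simp
      then show False using gr B Ceq[of "(0, PosA)"] floor_at_0[of L]
        by (auto simp: ground_def split: if_splits)
    qed
    ultimately show thesis using that[of "(base M, Gray)"] split_floor_iff[of L M] B by (simp add: valid_def)
  qed
qed

lemma added_column_of: "valid L b \<Longrightarrow> added L (column_of L b) = fst b"
  using ground_subset_column_of[of L b] card_column_of[of L "(0, White)"]
  by (simp add: added_def card_Diff_subset finite_subset[OF _ finite_column_of] column_of_ground)

lemma top_colour_column_of:
  assumes "valid L b" shows "top_colour (column_of L b) = snd b"
proof (cases "snd b")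
  case White
  have "(f, PosA) \<in> column_of L b" if "(f, PosB) \<in> column_of L b" for f
    using that White
      by (cases "floor_at n L f") (auto simp: column_of_def column_indices_def places_def index_def)
  then show ?thesis using White by (auto simp: top_colour_def)
next
  case Gray
  then obtain f where f: "base f = fst b" "floor_at n L f = SplitFloor"
    using valid_gray_base[of L "fst b"] assms by (cases b) auto
  have "(f, PosB) \<in> column_of L b" "(f, PosA) \<notin> column_of L b"
    using f Gray by (auto simp: column_of_def column_indices_def places_def index_def)
  then show ?thesis using Gray by (auto simp: top_colour_def)
qed

end

lemma alt_eq_sum: "alt xs = (\<Sum>k<length xs. (- 1) ^ k * xs ! k)"
proof (induction xs)
  case (Cons a xs)
  show ?case
    by (simp add: Cons sum.lessThan_Suc_shift sum_negf del: sum.lessThan_Suc)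
qed simp

lemma card_upto_Suc:
  "card {t \<in> {..Suc N} - {0}. P t} = card {t \<in> {..N} - {0}. P t} + of_bool (P (Suc N))"
proof -
  have "{t \<in> {..Suc N} - {0}. P t} = {t \<in> {..N} - {0}. P t} \<union> (if P (Suc N) then {Suc N} else {})"
    by (auto simp: le_Suc_eq)
  then show ?thesis by (simp add: card_insert_if)
qed

lemma card_skip_Suc:
  "card {t \<in> insert (Suc (Suc N)) {..<Suc N} - {0}. P t} =
      card {t \<in> {..N} - {0}. P t} + of_bool (P (Suc (Suc N)))"
proof -
  have "{t \<in> insert (Suc (Suc N)) {..<Suc N} - {0}. P t} =
      {t \<in> {..N} - {0}. P t} \<union> (if P (Suc (Suc N)) then {Suc (Suc N)} else {})"
    by auto
  then show ?thesis by (simp add: card_insert_if)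
qed

context rank begin

lemma width_two:
  assumes "n dvd N" shows "\<exists>f. base f = N \<and> base (Suc f) = N + 2"
proof -
  obtain k where "N = n * k" using assms by blast
  moreover have "n * k mod (2 * n) = (if even k then 0 else n)"
    by (auto simp: mult.commute[of n] elim!: evenE oddE)
  ultimately have N: "N mod (2 * n) = 0 \<or> N mod (2 * n) = n" by presburger
  obtain f where f: "base f \<le> N" "N < base (Suc f)" using between_base by blast
  have "base f = N"
  proof (rule ccontr)
    assume "base f \<noteq> N"
    then have *: "N = Suc (base f)" "base (Suc f) = base f + 2"
      using f slots_card(2)[of "floor_at n Lam0 f"] by (auto simp: base_Suc[of _ Lam0])
    then have "base f mod (2 * n) = 0 \<or> base f mod (2 * n) = n"
      by (subst base_Suc_eq[symmetric]) simp
    with * N show False using n3 by (auto simp: mod_Suc split: if_splits)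
  qed
  with N show ?thesis using base_Suc_eq by auto
qed

lemma floor_unique:
  assumes "base f \<le> t" "t < base (Suc f)" "base g \<le> t" "t < base (Suc g)"
  shows "f = g"
proof -
  have "base f < base (Suc g)" "base g < base (Suc f)" using assms by linarith+
  then show ?thesis by (simp add: strict_mono_less[OF strict_mono_base])
qed

lemma mod_two_n_dvd: "N mod (2 * n) = 0 \<or> N mod (2 * n) = n \<Longrightarrow> n dvd N"
  by (metis dvd_mod_iff dvd_triv_right dvd_0_right dvd_refl)

lemma valid_gray_dvd: "valid L (N, Gray) \<Longrightarrow> 0 < N \<and> n dvd N"
  using mod_two_n_dvd[of N] by (auto simp: valid_def wall_residue_def split: if_splits)

lemma floors_column_of:
  assumes v: "valid L b"
  obtains f where "fst ` column_of L b = {..f}" "base f \<le> fst b" "fst b < base (Suc f)"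
proof -
  obtain N c where b: "b = (N, c)" by fastforce
  obtain f where f: "base f \<le> N" "N < base (Suc f)" using between_base by blast
  have up: "g \<le> f" if "p \<in> places L" "index p \<in> column_indices N c" "g = fst p" for p g
  proof -
    have "index p < base (Suc f)"
    proof (cases c)
      case White
      then show ?thesis using that f by (simp add: column_indices_def)
    next
      case Gray
      then obtain h where "base h = N" "base (Suc h) = N + 2"
        using valid_gray_dvd v b width_two by blast
      moreover then have "h = f" using f floor_unique[of h N f] by simp
      ultimately show ?thesis using that Gray by (auto simp: column_indices_def)
    qed
    then have "base (fst p) < base (Suc f)" using idx_bounds[OF that(1)] by linarith
    then show ?thesis using that(3) by (simp add: strict_mono_less[OF strict_mono_base])
  qed
  have down: "g \<in> fst ` column_of L b" if "g \<le> f" for g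
  proof -
    obtain t where t: "base g \<le> t" "t < base (Suc g)" "t \<in> column_indices N c"
    proof (cases "g = f \<and> c = Gray \<and> base f = N")
      case True
      then have "base (Suc f) = N + 2"
        using width_two[of N] valid_gray_dvd v b strict_mono_eq[OF strict_mono_base] by metis
      then show thesis using that[of "N + 1"] True by (auto simp: column_indices_def)
    next
      case False
      then have "base g \<in> column_indices N c"
        using f \<open>g \<le> f\<close> strict_mono_less_eq[OF strict_mono_base, of g f]
          strict_mono_eq[OF strict_mono_base, of g f]
        by (cases "g = f") (auto simp: column_indices_def)
      then show thesis using that base_less[of g] by blast
    qed
    obtain p where p: "p \<in> places L" "index p = t" using surj_idx by blast
    have "fst p = g"
      using idx_bounds[OF p(1)] t(1,2) p(2) floor_unique[of "fst p" t g] by simp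
    then show ?thesis using p t(3) b by (auto simp: column_of_def)
  qed
  have "fst ` column_of L b = {..f}"
    using up down by (auto simp: column_of_def b)
  then show thesis using f b that by simp
qed

lemma is_full_column_of:
  assumes v: "valid L b"
  shows "is_full n L (column_of L b) \<longleftrightarrow> \<not> n dvd fst b"
    and "\<not> n dvd fst b \<Longrightarrow> base (height (column_of L b)) = Suc (fst b)"
proof -
  obtain f where f: "fst ` column_of L b = {..f}" "base f \<le> fst b" "fst b < base (Suc f)"
    using floors_column_of[OF v] by blast
  obtain N c where b: "b = (N, c)" by fastforce
  have Mx: "Max (fst ` column_of L b) = f" unfolding f(1) by (intro Max_eqI) auto
  have full: "is_full n L (column_of L b) \<longleftrightarrow> (\<forall>t. base f \<le> t \<and> t < base (Suc f) \<longrightarrow> t \<in> column_indices N c)"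
    (is "_ \<longleftrightarrow> ?R")
  proof
    assume a: "is_full n L (column_of L b)"
    show ?R
    proof (intro allI impI)
      fix t assume t: "base f \<le> t \<and> t < base (Suc f)"
      obtain p where p: "p \<in> places L" "index p = t" using surj_idx by blast
      have "fst p = f"
        using idx_bounds[OF p(1)] t p(2) floor_unique[of "fst p" t f] by simp
      then have "p \<in> column_of L b" using a p(1) by (cases p) (auto simp: is_full_def Mx places_def)
      then show "t \<in> column_indices N c" using p b by (simp add: column_of_def)
    qed
  next
    assume ?R
    then show "is_full n L (column_of L b)"
      using idx_bounds[of "(f, _)" L] unfolding is_full_def Mx Let_def
      by (auto simp: column_of_def b places_def)
  qed
  have key: "(base (Suc f) = Suc N \<longleftrightarrow> \<not> n dvd N)"
  proof (cases "n dvd N")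
    case True
    then obtain h where h: "base h = N" "base (Suc h) = N + 2" using width_two by blast
    then have "h = f" using f b floor_unique[of h N f] by simp
    then show ?thesis using h True by simp
  next
    case False
    have "base (Suc f) = Suc N"
    proof (rule ccontr)
      assume "base (Suc f) \<noteq> Suc N"
      then have "base (Suc f) = base f + 2" "base f = N"
        using f b slots_card(2)[of "floor_at n Lam0 f"] by (auto simp: base_Suc[of _ Lam0])
      then show False using False mod_two_n_dvd[of N] base_Suc_eq[of f] by simp
    qed
    then show ?thesis using False by simp
  qed
  show "is_full n L (column_of L b) \<longleftrightarrow> \<not> n dvd fst b"
  proof (cases "n dvd N")
    case True
    then obtain h where h: "base h = N" "base (Suc h) = N + 2" using width_two by blast
    then have "h = f" using f b floor_unique[of h N f] by simp
    then have "\<not> is_full n L (column_of L b)" using h full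
      by (cases c) (auto simp: column_indices_def intro: exI[of _ N] exI[of _ "Suc N"])
    then show ?thesis using True b by simp
  next
    case False
    then have "c = White" using v b valid_gray_dvd by (cases c) auto
    then show ?thesis using full key False b by (auto simp: column_indices_def)
  qed
  show "base (height (column_of L b)) = Suc (fst b)" if "\<not> n dvd fst b"
    using key that b f(1) by (simp add: height_def)
qed

lemma column_of_subset:
  assumes "valid L b'" "valid L b"
  shows "column_of L b' \<subseteq> column_of L b \<longleftrightarrow> fst b' < fst b \<or> b' = b"
proof -
  have "column_of L b' \<subseteq> column_of L b \<longleftrightarrow> column_indices (fst b') (snd b') \<subseteq> column_indices (fst b) (snd b)"
  proof
    assume "column_of L b' \<subseteq> column_of L b"
    then show "column_indices (fst b') (snd b') \<subseteq> column_indices (fst b) (snd b)"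
      using image_mono[of _ _ index] by (metis idx_column_of)
  qed (auto simp: column_of_def)
  also have "\<dots> \<longleftrightarrow> fst b' < fst b \<or> b' = b"
  proof -
    obtain N c N' c' where b: "b = (N, c)" "b' = (N', c')" by fastforce
    have "n dvd N" if "c = Gray" using valid_gray_dvd assms b that by blast
    moreover have "n dvd N'" if "c' = Gray" using valid_gray_dvd assms b that by blast
    ultimately have ne: "N \<noteq> Suc N'" if "c = Gray" "c' = Gray"
      using that n3
        by (metis One_nat_def dvd_add_right_iff nat_dvd_1_iff_1 not_less_eq_eq numeral_3_eq_3 plus_1_eq_Suc Suc_le_mono add.commute le_zero_eq nat.distinct(1))
    have "column_indices N' c' \<subseteq> column_indices N c" if "N' < N"
      using that ne by (cases c; cases c') (auto simp: column_indices_def)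
    moreover have False if "column_indices N' c' \<subseteq> column_indices N c" "\<not> N' < N" "(N', c') \<noteq> (N, c)"
    proof -
      have "card (column_indices N' c') \<le> card (column_indices N c)" by (rule card_mono) (use that in auto)
      then have "N' = N" using that by simp
      then show False using that by (cases c; cases c') (auto simp: column_indices_def)
    qed
    ultimately show ?thesis unfolding b by (auto simp: )
  qed
  finally show ?thesis .
qed

text \<open>
  Counted from the bottom, the floors of one cycle are of level \<open>1, 2, \<dots>, n, \<dots>, 2\<close>. Blocks of the same
  level have the same color, except that the level \<open>split_level\<close> comprises the colors 0 and 1.
\<close>

definition level :: "nat \<Rightarrow> nat" where
  "level t = max 1 (min (t mod (2 * n)) (2 * n + 1 - t mod (2 * n)))"

definition split_level :: "level1 \<Rightarrow> nat" where
  "split_level L = (if L = LamN then n else 1)"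

definition level_color :: "level1 \<Rightarrow> nat \<Rightarrow> nat" where
  "level_color L e = (if L = LamN then n + 1 - e else e)"

definition index_color :: "level1 \<Rightarrow> nat \<Rightarrow> nat \<Rightarrow> nat" where
  "index_color L k t = (if level t = split_level L
     then (if t mod (2 * n) = wall_residue n L then posA_color L k else 1 - posA_color L k)
     else level_color L (level t))"

lemma level_bounds: "1 \<le> level t" "level t \<le> n"
  using n3 by (auto simp: level_def)

lemma level_iff:
  assumes "1 \<le> e" "e \<le> n"
  shows "level t = e \<longleftrightarrow> t mod (2 * n) = e \<or> t mod (2 * n) = (if e = 1 then 0 else 2 * n + 1 - e)"
proof -
  define j where "j = t mod (2 * n)"
  have "j < 2 * n" using n3 by (simp add: j_def)
  then show ?thesis using assms n3 unfolding level_def j_def[symmetric] by (auto simp: max_def min_def)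
qed

lemma block_color_eq:
  assumes "p \<in> places L" shows "block_color n L k p = index_color L k (index p)"
proof -
  obtain f s where p: "p = (f, s)" by fastforce
  define i where "i = f mod (2 * n - 2)"
  define g where "g = (if i = 0 then 0 else if i < n then i + 1 else i + 2)"
  have i: "i < 2 * n - 2" using n3 unfolding i_def by (intro mod_less_divisor) auto
  have b: "base f mod (2 * n) = g" by (simp add: base_mod i_def g_def Let_def)
  have g: "g < 2 * n" using i by (auto simp: g_def)
  have fl: "floor_at n L f =
     (if i = 0 then (if L = LamN then HalvesFloor else SplitFloor)
      else if i < n - 1 then Cube (if L = LamN then n - i else i + 1)
      else if i = n - 1 then (if L = LamN then SplitFloor else HalvesFloor)
      else Cube (if L = LamN then i + 2 - n else 2 * n - 1 - i))"
    by (simp add: floor_at_eq i_def Let_def)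
  have s: "s \<in> slots (floor_at n L f)" using assms by (simp add: p places_def)
  define j where "j = index p mod (2 * n)"
  have j: "j = (if s \<in> {Upper, PosB} then Suc g else g)"
  proof -
    have "Suc g < 2 * n" if "s \<in> {Upper, PosB}"
      using that s i n3 by (auto simp: fl g_def split: if_splits)
    then show ?thesis using b g by (auto simp: j_def index_def p mod_Suc)
  qed
  have level: "level (index p) = max 1 (min j (2 * n + 1 - j))" by (simp add: level_def j_def)
  have B: "index_color L k (index p) = (if max 1 (min j (2 * n + 1 - j)) = split_level L
     then (if j = wall_residue n L then posA_color L k else 1 - posA_color L k)
     else level_color L (max 1 (min j (2 * n + 1 - j))))"
    by (simp only: index_color_def level j_def[symmetric])
  have C: "block_color n L k p = (case floor_at n L f of Cube i \<Rightarrow> i | HalvesFloor \<Rightarrow> n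
      | SplitFloor \<Rightarrow> (if s = PosA then posA_color L k else 1 - posA_color L k))"
    by (simp add: block_color_def p)
  consider "i = 0" | "0 < i" "i < n - 1" | "i = n - 1" | "n \<le> i" by linarith
  then show ?thesis
  proof cases
    case 1
    then show ?thesis using s n3 unfolding B C
      by (auto simp: fl j g_def split_level_def level_color_def wall_residue_def)
  next
    case 2
    then have "j = i + 1" "s = Whole" "min (i + 1) (2 * n + 1 - (i + 1)) = i + 1" using s
      by (auto simp: fl j g_def)
    then show ?thesis using 2 n3 unfolding B C
      by (auto simp: fl split_level_def level_color_def wall_residue_def)
  next
    case 3
    then have "s \<noteq> Whole" "j = (if s \<in> {Upper, PosB} then n + 1 else n)" using s n3
      by (auto simp: fl j g_def split: if_splits)
    then show ?thesis using s 3 n3 unfolding B C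
      by (auto simp: fl split_level_def level_color_def wall_residue_def)
  next
    case 4
    then have fl4: "floor_at n L f = Cube (if L = LamN then i + 2 - n else 2 * n - 1 - i)"
      using n3 unfolding fl by auto
    have "j = i + 2" "s = Whole" "min (i + 2) (2 * n + 1 - (i + 2)) = 2 * n - 1 - i"
      using s n3 4 by (auto simp: fl4 j g_def)
    then show ?thesis using 4 n3 i unfolding B C
      by (auto simp: fl4 split_level_def level_color_def wall_residue_def)
  qed
qed

definition added_indices :: "nat \<times> colour \<Rightarrow> nat set" where
  "added_indices b = column_indices (fst b) (snd b) - {0}"

lemma finite_added_indices [simp]: "finite (added_indices b)" by (simp add: added_indices_def)

lemma card_color_column:
  assumes "valid L b"
  shows "card {p \<in> column_of L b - ground L. block_color n L k p = i} =
      card {t \<in> added_indices b. index_color L k t = i}"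
proof -
  have img: "index ` {p \<in> column_of L b - ground L. block_color n L k p = i} =
      {t \<in> added_indices b. index_color L k t = i}"
  proof -
    have "index p \<noteq> 0 \<longleftrightarrow> p \<notin> ground L" if "p \<in> places L" for p
      using that by (auto simp: column_of_ground[symmetric] column_of_def column_indices_def)
    moreover have "t \<in> index ` {p \<in> column_of L b - ground L. block_color n L k p = i}"
      if "t \<in> added_indices b" "index_color L k t = i" for t
    proof -
      obtain p where "p \<in> places L" "index p = t" using surj_idx by blast
      then show ?thesis using that calculation[of p]
        by (intro image_eqI[of _ _ p]) (auto simp: added_indices_def column_of_def block_color_eq)
    qed
    ultimately show ?thesis by (auto simp: added_indices_def column_of_def block_color_eq)
  qed
  have "inj_on index {p \<in> column_of L b - ground L. block_color n L k p = i}"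
    by (rule inj_on_subset[OF inj_idx_column[of L b]]) auto
  from card_image[OF this] show ?thesis unfolding img by simp
qed

definition level_count :: "nat \<Rightarrow> nat \<Rightarrow> nat" where
  "level_count N e = card {t \<in> {..N} - {0}. level t = e}"

lemma level_count_added:
  assumes "valid L b" shows "card {t \<in> added_indices b. level t = e} = level_count (fst b) e"
proof (cases "snd b")
  case White
  then show ?thesis by (simp add: added_indices_def column_indices_def level_count_def)
next
  case Gray
  then obtain N where N: "b = (Suc N, Gray)" "Suc N mod (2 * n) = wall_residue n L"
    using assms by (cases b; cases "fst b") (auto simp: valid_def)
  have "level (Suc (Suc N)) = level (Suc N)"
    using N(2) n3 by (auto simp: level_def mod_Suc[of "Suc N"] wall_residue_def split: if_splits)
  then show ?thesis
    using card_skip_Suc[of N "\<lambda>t. level t = e"] card_upto_Suc[of N "\<lambda>t. level t = e"]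
    by (simp add: N(1) added_indices_def column_indices_def level_count_def)
qed

lemma level_count_diff:
  assumes "1 \<le> e" "e < n"
  shows "int (level_count N e) - int (level_count N (Suc e)) =
    of_bool (N mod (2 * n) = e) - of_bool (N mod (2 * n) = 2 * n - e)"
proof (induction N)
  case 0
  then show ?case using assms by (simp add: level_count_def)
next
  case (Suc N)
  define j where "j = N mod (2 * n)"
  have j: "j < 2 * n" using n3 by (simp add: j_def)
  have S: "Suc N mod (2 * n) = (if Suc j = 2 * n then 0 else Suc j)" by (simp add: mod_Suc j_def)
  have 1: "level (Suc N) = e \<longleftrightarrow> Suc N mod (2 * n) = e \<or> j = 2 * n - e"
    using assms j by (subst level_iff) (auto simp: S)
  have 2: "level (Suc N) = Suc e \<longleftrightarrow> j = e \<or> Suc N mod (2 * n) = 2 * n - e"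
    using assms j by (subst level_iff) (auto simp: S)
  have 3: "\<not> (Suc N mod (2 * n) = e \<and> j = 2 * n - e)" "\<not> (j = e \<and> Suc N mod (2 * n) = 2 * n - e)"
    using assms by (auto simp: S)
  have "of_bool (level (Suc N) = e) - of_bool (level (Suc N) = Suc e) =
    (of_bool (Suc N mod (2 * n) = e) - of_bool (Suc N mod (2 * n) = 2 * n - e)) -
    (of_bool (j = e) - of_bool (j = 2 * n - e) :: int)"
    unfolding 1 2 using 3 by (auto simp: of_bool_def)
  then show ?case using Suc unfolding j_def[symmetric] level_count_def card_upto_Suc of_nat_add of_nat_of_bool
    by linarith
qed

lemma sum_level_count: "(\<Sum>e = 1..n. level_count N e) = N"
proof (induction N)
  case 0
  then show ?case by (simp add: level_count_def)
next
  case (Suc N)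
  have "(\<Sum>e = 1..n. of_bool (level (Suc N) = e)) = (1::nat)"
    using level_bounds[of "Suc N"] by (simp add: of_bool_def sum.delta)
  then show ?case using Suc unfolding level_count_def card_upto_Suc by (simp add: sum.distrib)
qed

text \<open>The number of added A-blocks minus the number of added B-blocks.\<close>

definition split_excess :: "level1 \<Rightarrow> nat \<times> colour \<Rightarrow> int" where
  "split_excess L b = (if L = LamN then of_bool (fst b mod (2 * n) = n) else - of_bool (fst b mod (2 * n) \<noteq> 0))
     - 2 * of_bool (snd b = Gray)"

definition count_A :: "level1 \<Rightarrow> nat set \<Rightarrow> nat" where
  "count_A L S = card {t \<in> S. t mod (2 * n) = wall_residue n L}"

definition count_B :: "level1 \<Rightarrow> nat set \<Rightarrow> nat" where
  "count_B L S = card {t \<in> S. t mod (2 * n) = Suc (wall_residue n L)}"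

lemma count_AB_white: "int (count_A L ({..N} - {0})) - int (count_B L ({..N} - {0})) =
    (if L = LamN then of_bool (N mod (2 * n) = n) else - of_bool (N mod (2 * n) \<noteq> 0))"
proof (induction N)
  case 0
  then show ?case using n3 by (auto simp: count_A_def count_B_def)
next
  case (Suc N)
  define j where "j = N mod (2 * n)"
  have j: "j < 2 * n" using n3 by (simp add: j_def)
  have S: "Suc N mod (2 * n) = (if Suc j = 2 * n then 0 else Suc j)" by (simp add: mod_Suc j_def)
  show ?case using Suc j n3 unfolding count_A_def count_B_def card_upto_Suc S j_def[symmetric]
    by (auto simp: wall_residue_def split: if_splits)
qed

lemma count_AB_added:
  assumes "valid L b" shows "int (count_A L (added_indices b)) - int (count_B L (added_indices b)) =
      split_excess L b"
proof (cases "snd b")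
  case White
  then show ?thesis using count_AB_white[of L "fst b"]
    by (simp add: added_indices_def column_indices_def split_excess_def)
next
  case Gray
  then obtain N where N: "b = (Suc N, Gray)" "Suc N mod (2 * n) = wall_residue n L"
    using assms by (cases b; cases "fst b") (auto simp: valid_def)
  have "Suc (Suc N) mod (2 * n) = Suc (wall_residue n L)"
    using N(2) n3 by (auto simp: mod_Suc[of "Suc N"] wall_residue_def split: if_splits)
  then show ?thesis using count_AB_white[of L "Suc N"] N n3
      card_skip_Suc[of N "\<lambda>t. t mod (2 * n) = wall_residue n L"]
      card_skip_Suc[of N "\<lambda>t. t mod (2 * n) = Suc (wall_residue n L)"]
      card_upto_Suc[of N "\<lambda>t. t mod (2 * n) = wall_residue n L"]
      card_upto_Suc[of N "\<lambda>t. t mod (2 * n) = Suc (wall_residue n L)"]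
    unfolding count_A_def count_B_def
      by (simp add: added_indices_def column_indices_def split_excess_def wall_residue_def split: if_splits)
qed

lemma level_split_iff: "level t = split_level L \<longleftrightarrow>
    t mod (2 * n) = wall_residue n L \<or> t mod (2 * n) = Suc (wall_residue n L)"
  using n3 by (subst level_iff) (auto simp: split_level_def wall_residue_def)

lemma card_index_color_mid:
  assumes "2 \<le> i" "i \<le> n"
  shows "card {t \<in> S. index_color L k t = i} = card {t \<in> S. level t = level_color L i}"
proof -
  have "index_color L k t = i \<longleftrightarrow> level t = level_color L i" for t
    using level_bounds[of t] assms
      by (auto simp: index_color_def level_color_def split_level_def posA_color_def split: if_splits)
  then show ?thesis by simp
qed

lemma index_color_le: "index_color L k t \<le> n"
  using level_bounds[of t] n3 by (auto simp: index_color_def level_color_def posA_color_def)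

lemma card_index_color_split:
  assumes "finite S"
  shows "card {t \<in> S. index_color L k t = (if posA_color L k = 0 then 0 else 1)} = count_A L S"
    and "card {t \<in> S. index_color L k t = (if posA_color L k = 0 then 1 else 0)} = count_B L S"
    and "count_A L S + count_B L S = card {t \<in> S. level t = split_level L}"
proof -
  have pc: "posA_color L k = 0 \<or> posA_color L k = 1" by (simp add: posA_color_def)
  have nl: "level_color L (level t) \<ge> 2" if "level t \<noteq> split_level L" for t
    using that level_bounds[of t] by (auto simp: level_color_def split_level_def)
  have "index_color L k t = (if posA_color L k = 0 then 0 else 1) \<longleftrightarrow> t mod (2 * n) = wall_residue n L"
    "index_color L k t = (if posA_color L k = 0 then 1 else 0) \<longleftrightarrow> t mod (2 * n) = Suc (wall_residue n L)" for t
    using pc nl[of t] level_split_iff[of t L] by (auto simp: index_color_def split: if_splits)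
  then show "card {t \<in> S. index_color L k t = (if posA_color L k = 0 then 0 else 1)} = count_A L S"
    "card {t \<in> S. index_color L k t = (if posA_color L k = 0 then 1 else 0)} = count_B L S"
    by (simp_all add: count_A_def count_B_def)
  have "{t \<in> S. level t = split_level L} =
      {t \<in> S. t mod (2 * n) = wall_residue n L} \<union> {t \<in> S. t mod (2 * n) = Suc (wall_residue n L)}"
    by (auto simp: level_split_iff)
  then show "count_A L S + count_B L S = card {t \<in> S. level t = split_level L}"
    using assms by (subst count_A_def, subst count_B_def, subst card_Un_disjoint[symmetric]) auto
qed

end

subsection \<open>Walls and bead lists\<close>

abbreviation positions :: "(nat \<times> colour) list \<Rightarrow> nat multiset" where
  "positions x \<equiv> image_mset fst (mset x)"

lemma size_filter_fst_mset:
  "size {#s \<in># positions x. P s#} = (\<Sum>k<length x. of_bool (P (fst (x ! k))))"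
  by (induction x) (simp_all add: sum.lessThan_Suc_shift del: sum.lessThan_Suc)

lemma sorted_wrt_mset_unique:
  assumes "\<And>a b. R a b \<Longrightarrow> R b a \<Longrightarrow> a = b"
  shows "sorted_wrt R x \<Longrightarrow> sorted_wrt R y \<Longrightarrow> mset x = mset y \<Longrightarrow> x = y"
proof (induction x arbitrary: y)
  case (Cons a x)
  then obtain b z where y: "y = b # z" by (cases y) auto
  have "a = b"
  proof (rule ccontr)
    assume "a \<noteq> b"
    moreover have "set (a # x) = set (b # z)" using Cons.prems(3) unfolding y by (metis set_mset_mset)
    ultimately have "a \<in> set z" "b \<in> set x" by auto
    then show False using Cons.prems(1,2) y \<open>a \<noteq> b\<close> assms by auto
  qed
  then show ?case using Cons y by auto
qed simp

context rank begin

definition wall_of :: "level1 \<Rightarrow> (nat \<times> colour) list \<Rightarrow> wall" where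
  "wall_of L x k = (if k < length x then column_of L (x ! k) else ground L)"

definition above :: "nat \<times> colour \<Rightarrow> nat \<times> colour \<Rightarrow> bool" where
  "above b b' \<longleftrightarrow> fst b' < fst b \<or> b' = b \<and> n dvd fst b"

definition bead_list :: "level1 \<Rightarrow> (nat \<times> colour) list \<Rightarrow> bool" where
  "bead_list L x \<longleftrightarrow> (\<forall>b \<in> set x. 0 < fst b \<and> valid L b) \<and> sorted_wrt above x"

lemma bead_list_unique: "bead_list L x \<Longrightarrow> bead_list L y \<Longrightarrow> mset x = mset y \<Longrightarrow> x = y"
  by (rule sorted_wrt_mset_unique[of above]) (auto simp: bead_list_def above_def)

lemma valid_ground: "valid L (0, White)" by (simp add: valid_def)

lemma wall_of_bead: "wall_of L x k = column_of L (if k < length x then x ! k else (0, White))"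
  by (simp add: wall_of_def column_of_ground)

lemma valid_bead: "bead_list L x \<Longrightarrow> valid L (if k < length x then x ! k else (0, White))"
  by (simp add: bead_list_def valid_ground)

lemma wall_of_proper:
  assumes x: "bead_list L x" shows "wall_of L x \<in> proper_walls n L"
proof -
  have "is_column n L (wall_of L x k)" for k
    unfolding wall_of_bead by (rule column_of_is_column[OF valid_bead[OF x]])
  moreover have "finite {k. wall_of L x k \<noteq> ground L}"
    by (rule finite_subset[of _ "{..<length x}"]) (auto simp: wall_of_def)
  moreover have "wall_of L x (Suc k) \<subseteq> wall_of L x k" for k
  proof (cases "Suc k < length x")
    case True
    then have "above (x ! k) (x ! Suc k)" using x by (simp add: bead_list_def sorted_wrt_nth_less)
    moreover have "valid L (x ! Suc k)" "valid L (x ! k)" using True x by (simp_all add: bead_list_def)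
    ultimately show ?thesis using column_of_subset True by (auto simp: wall_of_def above_def)
  next
    case False
    then have "wall_of L x (Suc k) = ground L" by (simp add: wall_of_def)
    then show ?thesis unfolding wall_of_bead[of L x k]
      using ground_subset_column_of[OF valid_bead[OF x, of k]] by simp
  qed
  moreover have "height (wall_of L x i) \<noteq> height (wall_of L x j)"
    if ij: "i < j" and f: "is_full n L (wall_of L x i)" "is_full n L (wall_of L x j)" for i j
  proof
    assume h: "height (wall_of L x i) = height (wall_of L x j)"
    let ?b = "\<lambda>k. if k < length x then x ! k else (0, White)"
    have nd: "\<not> n dvd fst (?b i)" "\<not> n dvd fst (?b j)"
      using f is_full_column_of(1)[OF valid_bead[OF x]] unfolding wall_of_bead by blast+
    then have "Suc (fst (?b i)) = Suc (fst (?b j))"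
      using is_full_column_of(2)[OF valid_bead[OF x]] h unfolding wall_of_bead by metis
    moreover have jl: "j < length x" using nd(2) by (auto split: if_splits)
    ultimately have "fst (x ! i) = fst (x ! j)" "\<not> n dvd fst (x ! i)" using nd(1) ij by simp_all
    moreover have "above (x ! i) (x ! j)" using x ij jl by (simp add: bead_list_def sorted_wrt_nth_less)
    ultimately show False by (simp add: above_def)
  qed
  then have "\<forall>i j. i \<noteq> j \<longrightarrow> is_full n L (wall_of L x i) \<longrightarrow> is_full n L (wall_of L x j) \<longrightarrow>
      height (wall_of L x i) \<noteq> height (wall_of L x j)"
    by (intro allI impI) (metis linorder_neqE_nat)
  ultimately show ?thesis unfolding proper_walls_def is_young_wall_def by blast
qed

lemma beads_wall_of:
  assumes x: "bead_list L x" shows "beads n L (wall_of L x) = mset x"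
proof -
  have a: "added L (wall_of L x k) = (if k < length x then fst (x ! k) else 0)" for k
    using added_column_of[OF valid_bead[OF x, of k]] by (simp add: wall_of_bead split: if_splits)
  have supp: "{k. added L (wall_of L x k) \<noteq> 0} = {..<length x}"
    using x by (auto simp: a bead_list_def split: if_splits)
  have val: "(added L (wall_of L x k), top_colour (wall_of L x k)) = x ! k" if "k < length x" for k
  proof -
    have "top_colour (wall_of L x k) = snd (x ! k)"
      using that top_colour_column_of[OF valid_bead[OF x, of k]] by (simp add: wall_of_bead)
    then show ?thesis using a[of k] that by simp
  qed
  have "beads n L (wall_of L x) = image_mset (\<lambda>k. x ! k) (mset_set {..<length x})"
    unfolding beads_def supp by (intro image_mset_cong val) simp
  also have "\<dots> = mset (map (\<lambda>k. x ! k) [0..<length x])"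
    by (simp add: mset_set_upto_eq_mset_upto)
  finally show ?thesis by (simp add: map_nth)
qed

lemma proper_wallE:
  assumes Y: "Y \<in> proper_walls n L"
  obtains x where "bead_list L x" "Y = wall_of L x"
proof -
  have col: "is_column n L (Y k)" and sub: "Y (Suc k) \<subseteq> Y k" and fin: "finite {k. Y k \<noteq> ground L}" for k
    using Y by (auto simp: proper_walls_def is_young_wall_def)
  have "\<exists>b. valid L b \<and> Y k = column_of L b" for k using is_columnE[OF col] by metis
  then obtain b where b: "\<And>k. valid L (b k)" "\<And>k. Y k = column_of L (b k)" by metis
  have step: "fst (b (Suc k)) < fst (b k) \<or> b (Suc k) = b k" for k
    using sub[of k] column_of_subset[OF b(1) b(1)] b(2) by simp
  have mono: "fst (b j) < fst (b i) \<or> b j = b i" if "i \<le> j" for i j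
    using that
  proof (induction j rule: dec_induct)
    case (step j) then show ?case using \<open>\<And>k. fst (b (Suc k)) < fst (b k) \<or> b (Suc k) = b k\<close>[of j] by fastforce
  qed simp
  have zero: "b k = (0, White)" if "fst (b k) = 0" for k
    using that b(1)[of k] by (cases "b k"; cases "snd (b k)") (auto simp: valid_def)
  obtain k0 where "Y k0 = ground L" using fin ex_new_if_finite[OF infinite_UNIV_nat] by blast
  then have "card (column_of L (b k0)) = card (column_of L (0, White))"
    by (simp only: b(2)[symmetric] column_of_ground)
  then have k0: "fst (b k0) = 0" by simp
  define len where "len = (LEAST k. fst (b k) = 0)"
  have len: "fst (b len) = 0" "\<And>k. k < len \<Longrightarrow> 0 < fst (b k)"
    unfolding len_def using k0 by (auto intro: LeastI dest: not_less_Least)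
  define x where "x = map b [0..<len]"
  have "Y k = wall_of L x k" for k
  proof (cases "k < len")
    case False
    then have "b k = (0, White)" using mono[of len k] len(1) zero by fastforce
    then show ?thesis using False by (simp add: b(2) x_def wall_of_def column_of_ground)
  qed (simp add: b(2) x_def wall_of_def)
  moreover have "bead_list L x"
  proof -
    have "above (b i) (b j)" if "i < j" for i j
    proof (cases "n dvd fst (b i)")
      case True
      then show ?thesis using mono[of i j] that by (auto simp: above_def)
    next
      case False
      have "height (Y i) \<noteq> height (Y j)" if "\<not> n dvd fst (b j)"
        using Y \<open>i < j\<close> False that is_full_column_of(1)[OF b(1)] b(2)
        by (simp add: proper_walls_def)
      then have "fst (b j) \<noteq> fst (b i)" using False mono[of i j] that b(2) by fastforce
      then show ?thesis using mono[of i j] that by (auto simp: above_def)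
    qed
    then show ?thesis using len b(1) by (auto simp: bead_list_def x_def sorted_wrt_iff_nth_less)
  qed
  ultimately show thesis using that by blast
qed

lemma content_wall_of:
  assumes x: "bead_list L x"
  shows "content n L (wall_of L x) i =
      (\<Sum>k<length x. card {t \<in> added_indices (x ! k). index_color L (Suc k) t = i})"
proof -
  have "{(k, p). p \<in> wall_of L x k - ground L \<and> block_color n L (Suc k) p = i} =
    (SIGMA k:{..<length x}. {p \<in> column_of L (x ! k) - ground L. block_color n L (Suc k) p = i})"
    by (auto simp: wall_of_def split: if_splits)
  then have "content n L (wall_of L x) i =
      (\<Sum>k<length x. card {p \<in> column_of L (x ! k) - ground L. block_color n L (Suc k) p = i})"
    by (simp add: content_def)
  also have "\<dots> = (\<Sum>k<length x. card {t \<in> added_indices (x ! k). index_color L (Suc k) t = i})"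
    using x by (intro sum.cong card_color_column) (auto simp: bead_list_def)
  finally show ?thesis .
qed

definition balanced :: "nat multiset \<Rightarrow> bool" where
  "balanced M \<longleftrightarrow> (\<forall>e \<in> {1..<n}. size {#s \<in># M. s mod (2 * n) = e#} = size {#s \<in># M. s mod (2 * n) = 2 * n - e#})"

lemma wt_wall_of:
  assumes x: "bead_list L x"
  shows "wt n L (wall_of L x) = minus_delta n L m \<longleftrightarrow>
    balanced (positions x) \<and> sum_list (map fst x) = 2 * n * m \<and> alt (map (split_excess L) x) = 0"
proof -
  define c where "c = content n L (wall_of L x)"
  define E where "E e = (\<Sum>k<length x. level_count (fst (x ! k)) e)" for e
  have v: "valid L (x ! k)" if "k < length x" for k using x that by (simp add: bead_list_def)
  have c: "c i = (\<Sum>k<length x. card {t \<in> added_indices (x ! k). index_color L (Suc k) t = i})" for i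
    by (simp add: c_def content_wall_of[OF x])
  have c_mid: "c i = E (level_color L i)" if "2 \<le> i" "i \<le> n" for i
    unfolding c E_def card_index_color_mid[OF that] by (intro sum.cong refl level_count_added[of L] v) auto
  have c_big: "c i = 0" if "n < i" for i
    using that index_color_le by (auto simp: c card_eq_0_iff intro!: sum.neutral) (metis not_le)
  define eps where "eps k = (if posA_color L (Suc k) = 0 then 1 else - 1 :: int)" for k
  have c01: "card {t \<in> added_indices (x ! k). index_color L (Suc k) t = 0} + card {t \<in> added_indices (x ! k). index_color L (Suc k) t = 1}
      = level_count (fst (x ! k)) (split_level L)"
    "int (card {t \<in> added_indices (x ! k). index_color L (Suc k) t = 0}) - int (card {t \<in> added_indices (x ! k). index_color L (Suc k) t = 1})
      = eps k * split_excess L (x ! k)" if "k < length x" for k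
    using card_index_color_split(1,2)[OF finite_added_indices[of "x ! k"], of L "Suc k"]
      card_index_color_split(3)[OF finite_added_indices[of "x ! k"], of L] level_count_added[OF v[OF that], of "split_level L"]
      count_AB_added[OF v[OF that]] by (auto simp: eps_def split: if_splits)
  have c_sum: "c 0 + c 1 = E (split_level L)"
    unfolding c E_def sum.distrib[symmetric] by (intro sum.cong refl c01) auto
  have eps: "eps k = (- 1) ^ k * eps 0" for k
    by (auto simp: eps_def posA_color_def)
  have "int (c 0) - int (c 1) = (\<Sum>k<length x. eps k * split_excess L (x ! k))"
    unfolding c of_nat_sum sum_subtractf[symmetric] by (intro sum.cong refl c01(2)) auto
  also have "\<dots> = eps 0 * alt (map (split_excess L) x)"
    by (subst eps) (simp add: alt_eq_sum sum_distrib_left mult_ac)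
  finally have c_diff: "c 0 = c 1 \<longleftrightarrow> alt (map (split_excess L) x) = 0"
    by (auto simp: eps_def split: if_splits)
  have lc: "level_color L (level_color L e) = e" "2 \<le> level_color L e" "level_color L e \<le> n"
    if "1 \<le> e" "e \<le> n" "e \<noteq> split_level L" for e
    using that by (auto simp: level_color_def split_level_def)
  have "wt n L (wall_of L x) = minus_delta n L m \<longleftrightarrow> (\<forall>i. c i = m * delta n i)"
    by (simp add: wt_def minus_delta_def c_def fun_eq_iff flip: of_nat_mult)
  also have "\<dots> \<longleftrightarrow> (\<forall>e \<in> {1..n}. E e = 2 * m) \<and> c 0 = c 1"
  proof (intro iffI conjI ballI allI)
    fix e assume h: "\<forall>i. c i = m * delta n i" and e: "e \<in> {1..n}"
    show "E e = 2 * m"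
    proof (cases "e = split_level L")
      case True
      then show ?thesis using h[rule_format, of 0] h[rule_format, of 1] c_sum by (simp add: delta_def)
    next
      case False
      then show ?thesis using lc[of e] e c_mid[of "level_color L e"] h by (simp add: delta_def)
    qed
  next
    assume "\<forall>i. c i = m * delta n i"
    then show "c 0 = c 1" by (simp add: delta_def)
  next
    fix i assume h: "(\<forall>e \<in> {1..n}. E e = 2 * m) \<and> c 0 = c 1"
    have s: "split_level L \<in> {1..n}" using n3 by (simp add: split_level_def)
    consider "i \<le> 1" | "2 \<le> i" "i \<le> n" | "n < i" by linarith
    then show "c i = m * delta n i"
    proof cases
      case 1
      have "c 0 = m" "c 1 = m" using h c_sum s by auto
      then show ?thesis using 1 by (cases "i = 0") (auto simp: delta_def le_Suc_eq)
    next
      case 2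
      then have "level_color L i \<in> {1..n}" by (auto simp: level_color_def)
      then show ?thesis using 2 h c_mid by (simp add: delta_def)
    next
      case 3
      then show ?thesis using c_big n3 by (simp add: delta_def)
    qed
  qed
  also have "(\<forall>e \<in> {1..n}. E e = 2 * m) \<longleftrightarrow> balanced (positions x) \<and> sum_list (map fst x) = 2 * n * m"
  proof -
    have bal: "balanced (positions x) \<longleftrightarrow> (\<forall>e \<in> {1..<n}. E e = E (Suc e))"
      unfolding balanced_def
    proof (intro ball_cong refl)
      fix e assume e: "e \<in> {1..<n}"
      have "int (E e) - int (E (Suc e)) =
          (\<Sum>k<length x. of_bool (fst (x ! k) mod (2 * n) = e) - of_bool (fst (x ! k) mod (2 * n) = 2 * n - e))"
        unfolding E_def of_nat_sum sum_subtractf[symmetric] using e level_count_diff by (intro sum.cong) auto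
      also have "\<dots> = int (size {#s \<in># positions x. s mod (2 * n) = e#}) - int (size {#s \<in># positions x. s mod (2 * n) = 2 * n - e#})"
        unfolding size_filter_fst_mset by (simp add: sum_subtractf)
      finally show "(size {#s \<in># positions x. s mod (2 * n) = e#} = size {#s \<in># positions x. s mod (2 * n) = 2 * n - e#}) = (E e = E (Suc e))"
        by linarith
    qed
    have "(\<Sum>e = 1..n. E e) = (\<Sum>k<length x. \<Sum>e = 1..n. level_count (fst (x ! k)) e)"
      unfolding E_def by (rule sum.swap)
    also have "\<dots> = sum_list (map fst x)"
      unfolding sum_level_count by (simp add: sum_list_sum_nth atLeast0LessThan)
    finally have tot: "(\<Sum>e = 1..n. E e) = sum_list (map fst x)" .
    show ?thesis unfolding bal
    proof (intro iffI conjI ballI)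
      assume h: "\<forall>e \<in> {1..n}. E e = 2 * m"
      then show "E e = E (Suc e)" if "e \<in> {1..<n}" for e using that by simp
      show "sum_list (map fst x) = 2 * n * m" using h by (simp flip: tot)
    next
      fix e assume h: "(\<forall>e \<in> {1..<n}. E e = E (Suc e)) \<and> sum_list (map fst x) = 2 * n * m" and e: "e \<in> {1..n}"
      have all: "E e = E 1" if "1 \<le> e" "e \<le> n" for e
        using that
      proof (induction e rule: dec_induct)
        case (step e) then show ?case using h by auto
      qed simp
      have "(\<Sum>e = 1..n. E e) = (\<Sum>e = 1..n. E 1)" by (intro sum.cong refl all) auto
      then have "(\<Sum>e = 1..n. E e) = n * E 1" by simp
      then have "E 1 = 2 * m" using tot h n3 by simp
      then show "E e = 2 * m" using all e by simp
    qed
  qed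
  finally show ?thesis using c_diff by blast
qed

end

subsection \<open>Bead moves\<close>

lemma parity_transfer: "a + u = p + w \<Longrightarrow> (x \<longleftrightarrow> odd (u + w)) \<Longrightarrow> odd a \<noteq> x \<longleftrightarrow> odd p"
  for a u p w :: nat
  by presburger

context rank begin

lemma rtype_III_iff: "rtype n L s = TypeIII \<longleftrightarrow> s mod (2 * n) = wall_residue n L"
  using n3 by (auto simp: rtype_def wall_residue_def)

lemma rtype_I_iff: "rtype n L s = TypeI \<longleftrightarrow> \<not> n dvd s"
proof -
  have "s mod (2 * n) = 0 \<or> s mod (2 * n) = n" if d: "n dvd s"
  proof -
    obtain k where "s = n * k" using d by (auto elim: dvdE)
    then show ?thesis by (cases "even k") (auto simp: mult.commute[of n] elim!: evenE oddE)
  qed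
  then show ?thesis using mod_two_n_dvd[of s] by (auto simp: rtype_def)
qed

lemma rtype_sub: "2 * n \<le> s \<Longrightarrow> rtype n L (s - 2 * n) = rtype n L s"
  by (simp add: rtype_def le_mod_geq[symmetric])

definition legal :: "level1 \<Rightarrow> bead_config \<Rightarrow> bool" where
  "legal L B \<longleftrightarrow> (\<forall>b \<in># B. 0 < fst b \<and> (snd b = Gray \<longrightarrow> rtype n L (fst b) = TypeIII)) \<and>
     (\<forall>s. (s, White) \<in># B \<longrightarrow> (s, Gray) \<notin># B) \<and>
     (\<forall>s. rtype n L s = TypeI \<longrightarrow> count (image_mset fst B) s \<le> 1)"

lemma legal_subset:
  assumes "legal L B" "B' \<subseteq># B" shows "legal L B'"
proof -
  have "count (image_mset fst B') s \<le> count (image_mset fst B) s" for s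
    using image_mset_subseteq_mono[OF assms(2)] by (rule mset_subset_eq_count)
  then show ?thesis using assms mset_subset_eqD[OF assms(2)] unfolding legal_def
    by (meson le_trans)
qed

lemma legal_sorted_bead_list:
  "legal L (mset x) \<Longrightarrow> sorted_wrt (\<lambda>b b'. fst b' \<le> fst b) x \<Longrightarrow> bead_list L x"
proof (induction x)
  case Nil
  then show ?case by (simp add: bead_list_def)
next
  case (Cons b x)
  have x: "bead_list L x" using Cons legal_subset[OF Cons.prems(1), of "mset x"] by simp
  have "above b b'" if b': "b' \<in> set x" for b'
  proof (cases "fst b' < fst b")
    case False
    then have f: "fst b' = fst b" using Cons.prems(2) b' by fastforce
    have "b' = b"
      using Cons.prems(1) b' f unfolding legal_def
      by (cases b; cases b'; cases "snd b"; cases "snd b'") auto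
    moreover have "n dvd fst b"
    proof (rule ccontr)
      assume "\<not> n dvd fst b"
      then have "count (image_mset fst (mset (b # x))) (fst b) \<le> 1"
        using Cons.prems(1) rtype_I_iff unfolding legal_def by blast
      then have "count (positions x) (fst b) = 0" by simp
      then have "fst b \<notin># positions x" by (simp only: count_eq_zero_iff not_False_eq_True)
      moreover have "fst b \<in># positions x" unfolding f[symmetric] using b' by simp
      ultimately show False by blast
    qed
    ultimately show ?thesis by (simp add: above_def)
  qed (simp add: above_def)
  then show ?case using x Cons.prems(1) rtype_III_iff
    by (auto simp: bead_list_def legal_def valid_def)
qed

lemma legal_bead_list:
  assumes "legal L B" obtains x where "bead_list L x" "mset x = B"
proof -
  obtain xs where xs: "mset xs = B" using ex_mset by blast
  have "sorted_wrt (\<lambda>b b'. fst b' \<le> fst b) (rev (sort_key fst xs))"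
    using sorted_sort_key[of fst xs] by (simp add: sorted_wrt_rev sorted_map)
  then show thesis
    using that[of "rev (sort_key fst xs)"] legal_sorted_bead_list[of L "rev (sort_key fst xs)"] assms xs
    by simp
qed

lemma bead_list_Cons: "bead_list L (b # x) \<longleftrightarrow>
    0 < fst b \<and> valid L b \<and> (\<forall>b' \<in> set x. above b b') \<and> bead_list L x"
  by (auto simp: bead_list_def)

lemma bead_list_legal: "bead_list L x \<Longrightarrow> legal L (mset x)"
proof (induction x)
  case (Cons b x)
  then have l: "legal L (mset x)" and ab: "\<And>b'. b' \<in> set x \<Longrightarrow> above b b'"
    and b: "0 < fst b" "valid L b" by (auto simp: bead_list_Cons)
  have "count (image_mset fst (mset (b # x))) s \<le> 1" if s: "rtype n L s = TypeI" for s
  proof (cases "fst b = s")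
    case True
    have "s \<notin># positions x"
    proof
      assume "s \<in># positions x"
      then obtain b' where "b' \<in> set x" "fst b' = s" by auto
      then show False using ab[of b'] True s rtype_I_iff by (auto simp: above_def)
    qed
    then have "count (positions x) s = 0" by (simp only: count_eq_zero_iff not_False_eq_True)
    then show ?thesis using True by simp
  next
    case False
    then show ?thesis using l s by (auto simp: legal_def)
  qed
  moreover have "(s, Gray) \<notin> set (b # x)" if "(s, White) \<in> set (b # x)" for s
    using l ab[of "(s, Gray)"] ab[of "(s, White)"] that by (auto simp: legal_def above_def)
  ultimately show ?case using l b rtype_III_iff unfolding legal_def by (auto simp: valid_def)
qed (simp add: legal_def)

lemma bead_list_sorted: "bead_list L x \<Longrightarrow> sorted_wrt (\<lambda>b b'. fst b' \<le> fst b) x"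
  by (induction x) (auto simp: bead_list_Cons above_def)

definition nonIII :: "level1 \<Rightarrow> bead_config \<Rightarrow> nat multiset" where
  "nonIII L B = {#s \<in># image_mset fst B. rtype n L s \<noteq> TypeIII#}"

definition thirds :: "level1 \<Rightarrow> bead_config \<Rightarrow> bead_config" where
  "thirds L B = {#b \<in># B. rtype n L (fst b) = TypeIII#}"

definition num_above :: "nat multiset \<Rightarrow> nat \<Rightarrow> nat" where
  "num_above P t = size {#s \<in># P. t < s#}"

definition twist :: "nat multiset \<Rightarrow> bead_config \<Rightarrow> bead_config" where
  "twist P = switch {t. odd (num_above P t)}"

text \<open>
  The color of a bead in the runner of type III, switched once for every bead of type I or II above
  it, is invariant under \<open>(B_1)\<close>--\<open>(B_5)\<close>.
\<close>

definition core :: "level1 \<Rightarrow> bead_config \<Rightarrow> bead_config" where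
  "core L B = twist (nonIII L B) (thirds L B)"

lemma flip_flip [simp]: "flip (flip c) = c" by (cases c) auto

lemma switch_switch [simp]: "switch A (switch A B) = B"
proof -
  have "switch A (switch A B) = image_mset (\<lambda>b. b) B"
    unfolding switch_def image_mset.compositionality by (intro image_mset_cong) auto
  then show ?thesis by simp
qed

lemma image_fst_switch [simp]: "image_mset fst (switch A B) = image_mset fst B"
  by (simp add: switch_def image_mset.compositionality comp_def case_prod_beta)

lemma mem_switch: "(s, c) \<in># switch A B \<longleftrightarrow> (s, if s \<in> A then flip c else c) \<in># B"
proof
  assume "(s, c) \<in># switch A B"
  then show "(s, if s \<in> A then flip c else c) \<in># B" by (auto simp: switch_def)
next
  assume "(s, if s \<in> A then flip c else c) \<in># B"
  then show "(s, c) \<in># switch A B" unfolding switch_def by (force simp: image_iff)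
qed

lemma legal_switch:
  assumes "legal L B" "\<And>b. b \<in># B \<Longrightarrow> fst b \<in> A \<Longrightarrow> rtype n L (fst b) = TypeIII"
  shows "legal L (switch A B)"
proof -
  have "0 < s \<and> (c = Gray \<longrightarrow> rtype n L s = TypeIII)" if "(s, c) \<in># switch A B" for s c
    using that assms(1) assms(2)[of "(s, if s \<in> A then flip c else c)"] unfolding mem_switch legal_def
    by (cases "s \<in> A") auto
  moreover have "(s, Gray) \<notin># switch A B" if "(s, White) \<in># switch A B" for s
    using that assms(1) unfolding mem_switch legal_def by (cases "s \<in> A") auto
  ultimately show ?thesis using assms(1) unfolding legal_def by auto
qed

lemma legal_add_nonIII:
  assumes "legal L B" "rtype n L s \<noteq> TypeIII" "0 < s" "rtype n L s = TypeI \<longrightarrow> s \<notin># image_mset fst B"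
  shows "legal L (B + {#(s, White)#})"
proof -
  have "(s, Gray) \<notin># B" using assms by (auto simp: legal_def)
  moreover have "count (image_mset fst B) s = 0" if "rtype n L s = TypeI"
    using assms(4) that by (simp only: count_eq_zero_iff not_False_eq_True)
  ultimately show ?thesis using assms(1-3) unfolding legal_def by auto
qed

lemma core_legal: "legal L B \<Longrightarrow> legal L (core L B)"
  unfolding core_def twist_def
  by (rule legal_switch) (auto simp: thirds_def intro: legal_subset)

lemma thirds_switch:
  "thirds L (switch A B) = switch A (thirds L B)"
  by (simp add: thirds_def switch_def filter_mset_image_mset case_prod_beta)

lemma nonIII_switch: "nonIII L (switch A B) = nonIII L B"
  by (simp add: nonIII_def)

lemma switch_compose: "switch A (switch C B) = switch ((A - C) \<union> (C - A)) B"
  unfolding switch_def image_mset.compositionality by (intro image_mset_cong) auto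

lemma switch_cong:
  "(\<And>b. b \<in># B \<Longrightarrow> fst b \<in> A \<longleftrightarrow> fst b \<in> C) \<Longrightarrow> switch A B = switch C B"
  unfolding switch_def by (intro image_mset_cong) (auto simp: case_prod_beta)

lemma core_switch:
  assumes U: "U \<subseteq># B" and nt: "\<And>b. b \<in># U + W \<Longrightarrow> rtype n L (fst b) \<noteq> TypeIII"
    and A: "\<And>t. rtype n L t = TypeIII \<Longrightarrow>
      t \<in> A \<longleftrightarrow> odd (size {#b \<in># U. t < fst b#} + size {#b \<in># W. t < fst b#})"
  shows "core L (switch A (B - U + W)) = core L B"
proof -
  have UW: "thirds L U = {#}" "thirds L W = {#}"
    using nt by (auto simp: thirds_def filter_mset_eq_conv)
  have BU: "B - U + W + U = B + W" using U by (metis subset_mset.diff_add union_assoc union_commute)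
  have "thirds L (B - U + W) + thirds L U = thirds L B + thirds L W"
    unfolding thirds_def filter_union_mset[symmetric] BU ..
  then have th: "thirds L (B - U + W) = thirds L B" unfolding UW by simp
  have fU: "filter_mset (\<lambda>s. rtype n L s \<noteq> TypeIII) (image_mset fst U) = image_mset fst U"
    "filter_mset (\<lambda>s. rtype n L s \<noteq> TypeIII) (image_mset fst W) = image_mset fst W"
    using nt by (auto simp: filter_mset_eq_conv)
  have sub: "image_mset fst U \<subseteq># nonIII L B"
    using multiset_filter_mono[OF image_mset_subseteq_mono[OF U, of fst], of "\<lambda>s. rtype n L s \<noteq> TypeIII"]
    unfolding fU nonIII_def .
  have nI: "nonIII L (B - U + W) + image_mset fst U = nonIII L B + image_mset fst W"
  proof -
    have "nonIII L (B - U + W) + nonIII L U = nonIII L (B + W)"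
      unfolding nonIII_def filter_union_mset[symmetric] image_mset_union[symmetric] BU ..
    moreover have "nonIII L U = image_mset fst U" "nonIII L W = image_mset fst W" using fU
      by (simp_all add: nonIII_def)
    ultimately show ?thesis by (simp add: nonIII_def)
  qed
  have "num_above (nonIII L (B - U + W)) t + size {#b \<in># U. t < fst b#} =
      num_above (nonIII L B) t + size {#b \<in># W. t < fst b#}" for t
    using arg_cong[OF nI, of "\<lambda>M. size (filter_mset (\<lambda>s. t < s) M)"]
    by (simp add: num_above_def filter_mset_image_mset)
  from parity_transfer[OF this A] have par: "odd (num_above (nonIII L (B - U + W)) t) \<noteq> (t \<in> A) \<longleftrightarrow>
      odd (num_above (nonIII L B) t)"
    if "rtype n L t = TypeIII" for t
    using that by blast
  show ?thesis
    unfolding core_def twist_def thirds_switch nonIII_switch th switch_compose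
    using par by (intro switch_cong) (auto simp: thirds_def)
qed

definition residue_count :: "nat multiset \<Rightarrow> nat \<Rightarrow> nat" where
  "residue_count M r = size {#s \<in># M. s mod (2 * n) = r#}"

definition good :: "level1 \<Rightarrow> bead_config \<Rightarrow> bool" where
  "good L B \<longleftrightarrow> legal L B \<and> balanced (image_mset fst B) \<and>
     (L \<noteq> LamN \<longrightarrow> even (residue_count (image_mset fst B) n))"

definition total :: "bead_config \<Rightarrow> nat" where
  "total B = sum_mset (image_mset fst B)"

lemma residue_count_diff:
  "U \<subseteq># B \<Longrightarrow> residue_count (image_mset fst (B - U + W)) r + residue_count (image_mset fst U) r =
    residue_count (image_mset fst B) r + residue_count (image_mset fst W) r"
proof -
  assume U: "U \<subseteq># B"
  have "image_mset fst (B - U + W) + image_mset fst U = image_mset fst B + image_mset fst W"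
    using U by (metis image_mset_union subset_mset.diff_add union_assoc union_commute)
  from arg_cong[OF this, of "\<lambda>M. size (filter_mset (\<lambda>s. s mod (2 * n) = r) M)"]
  show ?thesis by (simp add: residue_count_def)
qed

lemma total_diff: "U \<subseteq># B \<Longrightarrow> total (B - U + W) + total U = total B + total W"
proof -
  assume U: "U \<subseteq># B"
  have "image_mset fst (B - U + W) + image_mset fst U = image_mset fst B + image_mset fst W"
    using U by (metis image_mset_union subset_mset.diff_add union_assoc union_commute)
  from arg_cong[OF this, of sum_mset] show ?thesis by (simp add: total_def)
qed

lemma total_switch [simp]: "total (switch A B) = total B"
  by (simp add: total_def)

lemma good_switch_move:
  assumes g: "good L B" and U: "U \<subseteq># B" and l: "legal L (B - U + W)"
    and A: "\<And>s. s \<in> A \<Longrightarrow> rtype n L s = TypeIII"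
    and bal: "\<And>e. 1 \<le> e \<Longrightarrow> e < n \<Longrightarrow> int (residue_count (image_mset fst U) e) - int (residue_count (image_mset fst W) e) =
        int (residue_count (image_mset fst U) (2 * n - e)) - int (residue_count (image_mset fst W) (2 * n - e))"
    and par: "L \<noteq> LamN \<Longrightarrow> even (residue_count (image_mset fst U) n + residue_count (image_mset fst W) n)"
  shows "good L (switch A (B - U + W))"
proof -
  note rc = residue_count_diff[OF U, of W]
  have "balanced (image_mset fst (B - U + W))"
    unfolding balanced_def residue_count_def[symmetric]
  proof
    fix e assume e: "e \<in> {1..<n}"
    have "residue_count (image_mset fst B) e = residue_count (image_mset fst B) (2 * n - e)"
      using g e unfolding good_def balanced_def residue_count_def[symmetric] by blast
    then show "residue_count (image_mset fst (B - U + W)) e =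
        residue_count (image_mset fst (B - U + W)) (2 * n - e)"
      using rc[of e] rc[of "2 * n - e"] bal[of e] e by auto
  qed
  moreover have "even (residue_count (image_mset fst (B - U + W)) n)" if "L \<noteq> LamN"
  proof -
    have "even (residue_count (image_mset fst B) n)" using g that by (simp add: good_def)
    then show ?thesis using par[OF that] rc[of n] by (metis even_add)
  qed
  ultimately show ?thesis using legal_switch[OF l] A unfolding good_def by simp
qed

lemma rtype_III_unique:
  assumes "rtype n L s \<noteq> TypeIII" "2 * n < s" "rtype n L t = TypeIII"
  shows "t \<in> typeIII_between n L (s - 2 * n) s \<longleftrightarrow> odd (of_bool (t < s) + of_bool (t < s - 2 * n) :: nat)"
proof -
  have "rtype n L (s - 2 * n) \<noteq> TypeIII" using assms rtype_sub[of s L] by simp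
  then have "t \<noteq> s - 2 * n" "t \<noteq> s" using assms by auto
  then show ?thesis using assms by (auto simp: typeIII_between_def)
qed

lemma residue_count_empty [simp]: "residue_count {#} r = 0"
  by (simp add: residue_count_def)

lemma residue_count_add [simp]:
  "residue_count (add_mset s M) r = of_bool (s mod (2 * n) = r) + residue_count M r"
  by (simp add: residue_count_def)

lemma step_move:
  assumes g: "good L B" and s: "(s, c) \<in># B" "rtype n L s \<noteq> TypeIII" "2 * n < s"
    and I: "rtype n L s = TypeI \<Longrightarrow> \<forall>d. (s - 2 * n, d) \<notin># B"
    and B': "B' = switch (typeIII_between n L (s - 2 * n) s) (B - {#(s, c)#} + {#(s - 2 * n, c)#})"
  shows "good L B' \<and> core L B' = core L B \<and> total B' < total B"
proof -
  have l: "legal L B" using g by (simp add: good_def)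
  have U: "{#(s, c)#} \<subseteq># B" using s by simp
  have cW: "c = White" using l s by (cases c) (auto simp: legal_def)
  have rs: "rtype n L (s - 2 * n) = rtype n L s" using s rtype_sub by simp
  have ms: "(s - 2 * n) mod (2 * n) = s mod (2 * n)" using s by (simp add: le_mod_geq[symmetric])
  have notin: "s - 2 * n \<notin># image_mset fst (B - {#(s, c)#})" if "rtype n L s = TypeI"
    using I[OF that] by (auto dest: in_diffD)
  have l': "legal L (B - {#(s, c)#} + {#(s - 2 * n, c)#})"
    unfolding cW
      using legal_add_nonIII[OF legal_subset[OF l, of "B - {#(s, White)#}"], of "s - 2 * n"] s rs notin cW
    by auto
  have "good L B'"
    unfolding B' by (rule good_switch_move[OF g U l'])
      (auto simp: typeIII_between_def ms)
  moreover have "core L B' = core L B"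
    unfolding B' by (rule core_switch[OF U]) (use s rs rtype_III_unique[OF s(2,3)] in \<open>auto\<close>)
  moreover have "total B' < total B"
    using total_diff[OF U, of "{#(s - 2 * n, c)#}"] s n3 unfolding B' by (auto simp: total_def)
  ultimately show ?thesis by blast
qed

lemma step_remove:
  assumes g: "good L B" and U: "U \<subseteq># B"
    and nt: "\<And>b. b \<in># U \<Longrightarrow> rtype n L (fst b) \<noteq> TypeIII"
    and A: "\<And>t. t \<in> A \<Longrightarrow> rtype n L t = TypeIII"
      "\<And>t. rtype n L t = TypeIII \<Longrightarrow> 0 < t \<Longrightarrow> t \<in> A \<longleftrightarrow> odd (size {#b \<in># U. t < fst b#})"
    and bal: "\<And>e. 1 \<le> e \<Longrightarrow> e < n \<Longrightarrow>
        residue_count (image_mset fst U) e = residue_count (image_mset fst U) (2 * n - e)"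
    and par: "L \<noteq> LamN \<Longrightarrow> even (residue_count (image_mset fst U) n)"
    and ne: "0 < total U"
    and B': "B' = switch A (B - U)"
  shows "good L B' \<and> core L B' = core L B \<and> total B' < total B"
proof -
  have l: "legal L B" using g by (simp add: good_def)
  have l': "legal L (B - U + {#})" using legal_subset[OF l, of "B - U"] by simp
  define A' where "A' = {t. if t = 0 then rtype n L 0 = TypeIII \<and>
      odd (size {#b \<in># U. 0 < fst b#}) else t \<in> A}"
  have pos: "0 < fst b" if "b \<in># B - U" for b using l that by (auto simp: legal_def dest: in_diffD)
  have AA: "switch A (B - U) = switch A' (B - U + {#})"
    using pos by (simp, intro switch_cong) (fastforce simp: A'_def)
  have "good L B'"
    unfolding B' AA by (rule good_switch_move[OF g U l'])
      (use A bal par in \<open>auto simp: A'_def residue_count_def split: if_splits\<close>)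
  moreover have "core L B' = core L B"
    unfolding B' AA by (rule core_switch[OF U]) (use nt A in \<open>auto simp: A'_def\<close>)
  moreover have "total B' < total B"
    using total_diff[OF U, of "{#}"] ne unfolding B' by (auto simp: total_def)
  ultimately show ?thesis by blast
qed

lemma rtype_small:
  assumes "rtype n L t = TypeIII" "0 < t" "t < 2 * n" shows "t = n \<and> L = LamN"
  using assms by (auto simp: rtype_III_iff wall_residue_def split: if_splits)

lemma bead_step_good:
  assumes g: "good L B" and st: "bead_step n L B B'"
  shows "good L B' \<and> core L B' = core L B \<and> total B' < total B"
  using st
proof cases
  case (B1 s c)
  then show ?thesis by (intro step_move[OF g, of s c]) auto
next
  case (B2 s c)
  then show ?thesis by (intro step_move[OF g, of s c]) auto
next
  case (B3 s c d)
  let ?U = "{#(s, c), (2 * n - s, d)#}"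
  have s: "1 \<le> s" "s < n" "s \<noteq> 2 * n - s" "n < 2 * n - s" "2 * n - s < 2 * n" using B3 n3 by auto
  have U: "?U \<subseteq># B"
    using B3(2,3) s by (intro mset_subset_eqI) (auto simp: Suc_le_eq)
  show ?thesis
  proof (rule step_remove[OF g U])
    show "B' = switch (if rtype n L n = TypeIII then {n} else {}) (B - ?U)" using B3 by simp
    show "rtype n L (fst b) \<noteq> TypeIII" if "b \<in># ?U" for b
      using that s rtype_small[of L "fst b"] by auto
    show "rtype n L t = TypeIII" if "t \<in> (if rtype n L n = TypeIII then {n} else {})" for t
      using that by (auto split: if_splits)
    show "t \<in> (if rtype n L n = TypeIII then {n} else {}) \<longleftrightarrow> odd (size {#b \<in># ?U. t < fst b#})"
      if t: "rtype n L t = TypeIII" "0 < t" for t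
    proof (cases "t < 2 * n")
      case True
      then have "t = n" using rtype_small t by blast
      then show ?thesis using t s by auto
    qed (use s in auto)
    show "residue_count (image_mset fst ?U) e = residue_count (image_mset fst ?U) (2 * n - e)"
      if "1 \<le> e" "e < n" for e
      using s that by auto
    show "even (residue_count (image_mset fst ?U) n)"
      using s by auto
    show "0 < total ?U" using s by (simp add: total_def)
  qed
next
  case (B4 c)
  have LN: "L = LamN" using B4(2) n3 by (auto simp: rtype_def split: if_splits)
  let ?U = "{#(2 * n, c)#}"
  have U: "?U \<subseteq># B" using B4 by simp
  show ?thesis
  proof (rule step_remove[OF g U])
    show "B' = switch {n} (B - ?U)" using B4 by simp
    show "rtype n L (fst b) \<noteq> TypeIII" if "b \<in># ?U" for b using that B4 by simp
    show "rtype n L t = TypeIII" if "t \<in> {n}" for t using that LN n3 by (simp add: rtype_def)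
    show "t \<in> {n} \<longleftrightarrow> odd (size {#b \<in># ?U. t < fst b#})" if t: "rtype n L t = TypeIII" "0 < t" for t
    proof (cases "t < 2 * n")
      case True
      then have "t = n" using rtype_small t by blast
      then show ?thesis using n3 by auto
    qed (use n3 in auto)
    show "residue_count (image_mset fst ?U) e = residue_count (image_mset fst ?U) (2 * n - e)"
      if "1 \<le> e" "e < n" for e
      using that by auto
    show "even (residue_count (image_mset fst ?U) n)" if "L \<noteq> LamN" using that LN by simp
    show "0 < total ?U" using n3 by (simp add: total_def)
  qed
next
  case (B5 c d)
  let ?U = "{#(n, c), (n, d)#}"
  have LN: "L \<noteq> LamN" using B5(2) n3 by (auto simp: rtype_def split: if_splits)
  show ?thesis
  proof (rule step_remove[OF g B5(3)])
    show "B' = switch {} (B - ?U)" using B5 by (simp add: switch_def)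
    show "rtype n L (fst b) \<noteq> TypeIII" if "b \<in># ?U" for b using that B5 by auto
    show "rtype n L t = TypeIII" if "t \<in> {}" for t using that by simp
    show "t \<in> {} \<longleftrightarrow> odd (size {#b \<in># ?U. t < fst b#})" if t: "rtype n L t = TypeIII" "0 < t" for t by auto
    show "residue_count (image_mset fst ?U) e = residue_count (image_mset fst ?U) (2 * n - e)"
      if "1 \<le> e" "e < n" for e
      using that n3 by auto
    show "even (residue_count (image_mset fst ?U) n)" by simp
    show "0 < total ?U" using n3 by (simp add: total_def)
  qed
qed

lemma good_step_star:
  assumes "(bead_step n L)\<^sup>*\<^sup>* B B'" "good L B"
  shows "good L B' \<and> core L B' = core L B"
  using assms by (induction rule: rtranclp_induct) (auto dest: bead_step_good)

lemma exists_terminal: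
  "good L B \<Longrightarrow> \<exists>B'. (bead_step n L)\<^sup>*\<^sup>* B B' \<and> (\<nexists>C. bead_step n L B' C)"
proof (induction "total B" arbitrary: B rule: less_induct)
  case less
  show ?case
  proof (cases "\<exists>C. bead_step n L B C")
    case True
    then obtain C where C: "bead_step n L B C" by blast
    then have "good L C" "total C < total B" using bead_step_good[OF less.prems] by blast+
    then show ?thesis using less.hyps C by (meson converse_rtranclp_into_rtranclp)
  qed blast
qed

lemma terminal_type_I:
  assumes stuck: "\<nexists>C. bead_step n L B C" and "rtype n L s = TypeI" "(s, c) \<in># B"
  shows "\<exists>c. (s mod (2 * n), c) \<in># B"
  using assms(2,3)
proof (induction s arbitrary: c rule: less_induct)
  case (less s)
  show ?case
  proof (cases "s < 2 * n")
    case True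
    then show ?thesis using less.prems by auto
  next
    case False
    then have s: "2 * n < s" using less.prems(1) rtype_I_iff by (metis dvd_triv_right linorder_neqE_nat)
    then obtain d where "(s - 2 * n, d) \<in># B"
      using stuck bead_step.B1[OF less.prems(2,1) s] by blast
    then have "\<exists>c. ((s - 2 * n) mod (2 * n), c) \<in># B"
      using less.IH[of "s - 2 * n"] less.prems(1) rtype_sub[of s L] s n3 by auto
    then show ?thesis using s by (simp add: le_mod_geq[symmetric])
  qed
qed

lemma residue_count_pos: "0 < residue_count (image_mset fst B) r \<longleftrightarrow> (\<exists>s c. (s, c) \<in># B \<and> s mod (2 * n) = r)"
  by (auto simp: residue_count_def nonempty_has_size[symmetric] filter_mset_eq_conv multiset_eq_iff)

lemma terminal_nonIII:
  assumes g: "good L B" and stuck: "\<nexists>C. bead_step n L B C"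
  shows "nonIII L B = {#}"
proof -
  have l: "legal L B" and bal: "balanced (image_mset fst B)" using g by (auto simp: good_def)
  have noI: "rtype n L s \<noteq> TypeI" if s: "(s, c) \<in># B" for s c
  proof
    assume I: "rtype n L s = TypeI"
    define r where "r = s mod (2 * n)"
    have r: "0 < r" "r < 2 * n" "r \<noteq> n" using I n3 by (auto simp: r_def rtype_def split: if_splits)
    have I': "rtype n L t = TypeI" if "t mod (2 * n) = r \<or> t mod (2 * n) = 2 * n - r" for t
      using that r by (auto simp: rtype_def)
    have ex: "\<exists>c. (t mod (2 * n), c) \<in># B"
      if "(t, d) \<in># B" "t mod (2 * n) = r \<or> t mod (2 * n) = 2 * n - r" for t d
      using terminal_type_I[OF stuck I'[OF that(2)] that(1)] .
    define e where "e = min r (2 * n - r)"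
    have e: "1 \<le> e" "e \<le> n - 1" using r by (auto simp: e_def)
    have "residue_count (image_mset fst B) e = residue_count (image_mset fst B) (2 * n - e)"
      using bal e unfolding balanced_def residue_count_def[symmetric] by auto
    moreover have "0 < residue_count (image_mset fst B) r" using s residue_count_pos r_def by blast
    moreover have "r = e \<or> r = 2 * n - e" "2 * n - r = e \<or> 2 * n - r = 2 * n - e" using r
      by (auto simp: e_def)
    ultimately have "0 < residue_count (image_mset fst B) e"
        "0 < residue_count (image_mset fst B) (2 * n - e)" by auto
    then obtain c1 c2 where "(e, c1) \<in># B" "(2 * n - e, c2) \<in># B"
      unfolding residue_count_pos using ex r
        by (metis (no_types, lifting) e_def min_def diff_diff_cancel less_imp_le_nat)
    then show False using bead_step.B3[OF _ _ e, of c1 B c2 L] stuck by blast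
  qed
  have noII: "rtype n L s \<noteq> TypeII" if s: "(s, c) \<in># B" for s c
  proof
    assume II: "rtype n L s = TypeII"
    have s2: "t \<le> 2 * n" if "(t, d) \<in># B" "rtype n L t = TypeII" for t d
      using bead_step.B2[OF that] stuck by (meson not_le)
    have pos: "0 < s" using l s by (auto simp: legal_def)
    show False
    proof (cases "L = LamN")
      case True
      then have "s mod (2 * n) = 0" using II n3 by (auto simp: rtype_def split: if_splits)
      then have "s = 2 * n" using s2[OF s II] pos by (auto elim!: dvdE)
      then show False using bead_step.B4[of n L c B] II s stuck by blast
    next
      case False
      have at_n: "t = n" if t: "(t, d) \<in># B" "t mod (2 * n) = n" for t d
      proof -
        have "rtype n L t = TypeII" using t(2) False by (simp add: rtype_def)
        then have "t \<le> 2 * n" using s2 t by blast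
        then show ?thesis using t(2) n3 by (cases "t = 2 * n") auto
      qed
      have sn: "s mod (2 * n) = n" using II False by (auto simp: rtype_def split: if_splits)
      have white: "d = White" if "(n, d) \<in># B" for d
        using l that II at_n[OF s sn] by (cases d) (auto simp: legal_def)
      have "fst b mod (2 * n) = n \<longleftrightarrow> b = (n, White)" if "b \<in># B" for b
        using that at_n[of "fst b" "snd b"] white[of "snd b"] n3 by (cases b) auto
      then have "{#s \<in># image_mset fst B. s mod (2 * n) = n#} = image_mset fst {#b \<in># B. b = (n, White)#}"
        unfolding filter_mset_image_mset
        by (intro arg_cong[of _ _ "image_mset fst"] filter_mset_cong) auto
      then have "residue_count (image_mset fst B) n = count B (n, White)"
        by (simp add: residue_count_def filter_eq_replicate_mset)
      moreover have "0 < residue_count (image_mset fst B) n" using residue_count_pos s sn by blast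
      moreover have "even (residue_count (image_mset fst B) n)" using g False by (simp add: good_def)
      ultimately have "2 \<le> count B (n, White)" by presburger
      then have "{#(n, White), (n, White)#} \<subseteq># B" by (intro mset_subset_eqI) auto
      then show False using bead_step.B5[of n L White White B] II at_n[OF s sn] stuck by blast
    qed
  qed
  have "rtype n L s = TypeIII" if "s \<in># image_mset fst B" for s
    using that noI noII by (cases "rtype n L s") auto
  then show ?thesis by (auto simp: nonIII_def filter_mset_eq_conv)
qed

lemma core_terminal:
  assumes "nonIII L B = {#}" shows "core L B = B"
proof -
  have "rtype n L (fst b) = TypeIII" if "b \<in># B" for b
    using assms that by (auto simp: nonIII_def filter_mset_eq_conv)
  then have "thirds L B = B" by (simp add: thirds_def filter_mset_eq_conv)
  then show ?thesis using assms by (simp add: core_def twist_def num_above_def switch_def case_prod_beta)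
qed

lemma bead_core_wall_of:
  assumes x: "bead_list L x" and g: "good L (mset x)" and z: "bead_list L z" "mset z = core L (mset x)"
  shows "bead_core n L (wall_of L x) = wall_of L z"
  unfolding bead_core_def beads_wall_of[OF x]
proof (rule the_equality)
  obtain B where B: "(bead_step n L)\<^sup>*\<^sup>* (mset x) B" "\<nexists>C. bead_step n L B C" using exists_terminal[OF g]
    by blast
  have "B = mset z"
    using good_step_star[OF B(1) g] terminal_nonIII[OF _ B(2)] core_terminal z(2) by metis
  then show "wall_of L z \<in> proper_walls n L \<and> (bead_step n L)\<^sup>*\<^sup>* (mset x) (beads n L (wall_of L z)) \<and>
      (\<nexists>B. bead_step n L (beads n L (wall_of L z)) B)"
    using B wall_of_proper[OF z(1)] beads_wall_of[OF z(1)] by simp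
next
  fix Z assume Z: "Z \<in> proper_walls n L \<and> (bead_step n L)\<^sup>*\<^sup>* (mset x) (beads n L Z) \<and>
      (\<nexists>B. bead_step n L (beads n L Z) B)"
  then obtain y where y: "bead_list L y" "Z = wall_of L y" using proper_wallE by blast
  have "mset y = core L (mset x)"
    using good_step_star[of L "mset x"
        "mset y"] terminal_nonIII[of L "mset y"] core_terminal[of L "mset y"] Z g
    unfolding y(2) beads_wall_of[OF y(1)] by metis
  then show "Z = wall_of L z" using bead_list_unique[OF y(1) z(1)] z(2) y(2) by simp
qed

fun core_list :: "level1 \<Rightarrow> bool \<Rightarrow> (nat \<times> colour) list \<Rightarrow> (nat \<times> colour) list" where
  "core_list L p [] = []"
| "core_list L p (b # x) = (if rtype n L (fst b) = TypeIII
     then (fst b, if p then flip (snd b) else snd b) # core_list L p x else core_list L (\<not> p) x)"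

lemma map_fst_core_list: "map fst (core_list L p x) = filter (\<lambda>s. rtype n L s = TypeIII) (map fst x)"
  by (induction L p x rule: core_list.induct) auto

lemma mset_core_list:
  "sorted_wrt (\<lambda>b b'. fst b' \<le> fst b) x \<Longrightarrow>
    mset (core_list L p x) = switch {t. p \<noteq> odd (num_above (nonIII L (mset x)) t)} (thirds L (mset x))"
proof (induction x arbitrary: p)
  case Nil
  then show ?case by (simp add: thirds_def switch_def)
next
  case (Cons b x)
  have le: "fst b' \<le> fst b" if "b' \<in> set x" for b' using Cons.prems that by simp
  have IH: "mset (core_list L p x) =
      switch {t. p \<noteq> odd (num_above (nonIII L (mset x)) t)} (thirds L (mset x))" for p
    using Cons by simp
  show ?case
  proof (cases "rtype n L (fst b) = TypeIII")
    case True
    have nI: "nonIII L (mset (b # x)) = nonIII L (mset x)" using True by (simp add: nonIII_def)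
    have "{#s \<in># nonIII L (mset x). fst b < s#} = {#}"
      using le by (auto simp: nonIII_def filter_mset_eq_conv not_less)
    then have "num_above (nonIII L (mset x)) (fst b) = 0" by (simp add: num_above_def)
    then show ?thesis using True unfolding nI
      by (cases b) (simp add: IH thirds_def switch_def)
  next
    case False
    have "fst b' < fst b" if "b' \<in># thirds L (mset x)" for b'
      using that le[of b'] False by (auto simp: thirds_def order_less_le)
    then have "num_above (nonIII L (mset (b # x))) (fst b') = Suc (num_above (nonIII L (mset x)) (fst b'))"
      if "b' \<in># thirds L (mset x)" for b'
      using that False by (simp add: nonIII_def num_above_def)
    moreover have "thirds L (mset (b # x)) = thirds L (mset x)" using False by (simp add: thirds_def)
    ultimately show ?thesis using False by (simp add: IH) (intro switch_cong, auto)
  qed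
qed

lemma core_list_core: "bead_list L x \<Longrightarrow> mset (core_list L False x) = core L (mset x)"
  using mset_core_list[OF bead_list_sorted, where L = L and p = False] by (simp add: core_def twist_def)

lemma bead_list_core_list:
  assumes "bead_list L x" shows "bead_list L (core_list L False x)"
proof (rule legal_sorted_bead_list)
  show "legal L (mset (core_list L False x))"
    using core_legal bead_list_legal[OF assms] by (simp add: core_list_core[OF assms])
  have "sorted_wrt (\<lambda>s t. t \<le> s) (map fst (core_list L False x))"
    using bead_list_sorted[OF assms] by (simp add: map_fst_core_list sorted_wrt_filter sorted_wrt_map)
  then show "sorted_wrt (\<lambda>b b'. fst b' \<le> fst b) (core_list L False x)" by (simp add: sorted_wrt_map)
qed

text \<open>A bead of type I or II reverses all later signs, which is why the odd case is needed in the induction.\<close>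

lemma alt_core_list_01:
  assumes "L \<noteq> LamN" "\<forall>b \<in> set x. valid L b"
  shows "if even (size (nonIII L (mset x)))
     then alt (map (split_excess L) x) = alt (map (split_excess L) (core_list L False x))
     else alt (map (split_excess L) x) + alt (map (split_excess L) (core_list L True x)) = - 1"
  using assms(2)
proof (induction x)
  case (Cons b x)
  have III: "rtype n L (fst b) = TypeIII \<longleftrightarrow> fst b mod (2 * n) = 0"
    using assms(1) by (simp add: rtype_III_iff wall_residue_def)
  show ?case
  proof (cases "rtype n L (fst b) = TypeIII")
    case True
    have "split_excess L b = - 2 * of_bool (snd b = Gray)"
        "split_excess L (fst b, c) = - 2 * of_bool (c = Gray)" for c
      using True III assms(1) by (auto simp: split_excess_def)
    then show ?thesis using Cons True by (cases "snd b") (auto simp: nonIII_def split: if_splits)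
  next
    case False
    then have "snd b = White" using Cons.prems rtype_III_iff by (cases "snd b") (auto simp: valid_def)
    then have "split_excess L b = - 1" using False III assms(1) by (simp add: split_excess_def)
    then show ?thesis using Cons False by (auto simp: nonIII_def split: if_splits)
  qed
qed (simp add: nonIII_def)

lemma alt_core_list_n:
  assumes "\<forall>b \<in> set x. valid LamN b"
  shows "alt (map (split_excess LamN) (core_list LamN p x)) =
      (if p then - 1 else 1) * alt (map (split_excess LamN) x)"
  using assms
proof (induction x arbitrary: p)
  case (Cons b x)
  have III: "rtype n LamN (fst b) = TypeIII \<longleftrightarrow> fst b mod (2 * n) = n"
    by (simp add: rtype_III_iff wall_residue_def)
  show ?case
  proof (cases "rtype n LamN (fst b) = TypeIII")
    case True
    then have "split_excess LamN b = 1 - 2 * of_bool (snd b = Gray)"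
        "split_excess LamN (fst b, c) = 1 - 2 * of_bool (c = Gray)" for c
      using III by (auto simp: split_excess_def)
    then show ?thesis using Cons True by (cases "snd b") auto
  next
    case False
    then have "snd b = White" using Cons.prems rtype_III_iff by (cases "snd b") (auto simp: valid_def)
    then have "split_excess LamN b = 0" using False III by (simp add: split_excess_def)
    then show ?thesis using Cons False by simp
  qed
qed simp

lemma sum_residues: "(\<Sum>r<2 * n. f r) = f 0 + f n + (\<Sum>k = 1..<n. f k + f (2 * n - k))"
  for f :: "nat \<Rightarrow> nat"
proof -
  have "{..<2 * n} = insert 0 (insert n ({1..<n} \<union> {n + 1..<2 * n}))" using n3 by auto
  then have "(\<Sum>r<2 * n. f r) = f 0 + (f n + ((\<Sum>k = 1..<n. f k) + (\<Sum>k = n + 1..<2 * n. f k)))"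
    using n3 by (subst \<open>{..<2 * n} = _\<close>) (simp add: sum.union_disjoint)
  also have "(\<Sum>k = n + 1..<2 * n. f k) = (\<Sum>k = 1..<n. f (2 * n - k))"
    by (rule sum.reindex_bij_witness[of _ "\<lambda>k. 2 * n - k" "\<lambda>k. 2 * n - k"]) auto
  finally show ?thesis by (simp add: sum.distrib)
qed

lemma size_residues: "size M = (\<Sum>r<2 * n. residue_count M r)"
proof (induction M)
  case (add s M)
  have "s mod (2 * n) < 2 * n" using n3 by simp
  then show ?case using add by (simp add: sum.distrib of_bool_def sum.delta)
qed simp

definition residue_sum :: "nat multiset \<Rightarrow> nat \<Rightarrow> nat" where
  "residue_sum M r = sum_mset {#s \<in># M. s mod (2 * n) = r#}"

lemma sum_mset_residues: "sum_mset M = (\<Sum>r<2 * n. residue_sum M r)"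
proof (induction M)
  case (add s M)
  have "s mod (2 * n) < 2 * n" using n3 by simp
  then have "(\<Sum>r<2 * n. if s mod (2 * n) = r then s else 0) = s" by simp
  moreover have "residue_sum (add_mset s M) r = (if s mod (2 * n) = r then s else 0) + residue_sum M r" for r
    by (simp add: residue_sum_def)
  ultimately show ?case using add by (simp add: sum.distrib)
qed (simp add: residue_sum_def)

lemma residue_sum_eq: "\<exists>q. residue_sum M r = r * residue_count M r + 2 * n * q"
proof (induction M)
  case (add s M)
  then obtain q where q: "residue_sum M r = r * residue_count M r + 2 * n * q" by blast
  show ?case
  proof (cases "s mod (2 * n) = r")
    case True
    then have "s = r + 2 * n * (s div (2 * n))" by (metis mod_mult_div_eq)
    then have "residue_sum (add_mset s M) r =
        r * residue_count (add_mset s M) r + 2 * n * (s div (2 * n) + q)"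
      using q True by (simp add: residue_sum_def algebra_simps)
    then show ?thesis by blast
  next
    case False
    then show ?thesis using q by (intro exI[of _ q]) (simp add: residue_sum_def)
  qed
qed (simp add: residue_sum_def)

lemma even_count_n:
  assumes bal: "balanced M" and s: "2 * n dvd sum_mset M"
  shows "even (residue_count M n)"
proof -
  obtain q where q: "residue_sum M r = r * residue_count M r + 2 * n * q r" for r using residue_sum_eq
    by metis
  have "residue_sum M k + residue_sum M (2 * n - k) = 2 * n * (residue_count M k + q k + q (2 * n - k))"
    if "k \<in> {1..<n}" for k
  proof -
    have c1: "residue_count M (2 * n - k) = residue_count M k"
      using bal that unfolding balanced_def residue_count_def[symmetric] by auto
    have c2: "k * residue_count M k + (2 * n - k) * residue_count M k = 2 * n * residue_count M k"
      using that by (simp flip: add_mult_distrib)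
    have "a + b = x \<Longrightarrow> a + u + (b + v) = x + u + v" for a b x u v :: nat by simp
    from this[OF c2] show ?thesis unfolding q[of k] q[of "2 * n - k"] c1 distrib_left .
  qed
  then have "2 * n dvd (\<Sum>k = 1..<n. residue_sum M k + residue_sum M (2 * n - k))" by (intro dvd_sum) simp
  moreover have "2 * n dvd residue_sum M 0" using q[of 0] by simp
  ultimately have "2 * n dvd residue_sum M 0 + (\<Sum>k = 1..<n. residue_sum M k + residue_sum M (2 * n - k))"
    by (intro dvd_add)
  moreover have "sum_mset M = residue_sum M 0 + residue_sum M n + (\<Sum>k = 1..<n. residue_sum M k + residue_sum M (2 * n - k))"
    unfolding sum_mset_residues[of M] by (rule sum_residues)
  then have "2 * n dvd (residue_sum M 0 + (\<Sum>k = 1..<n. residue_sum M k + residue_sum M (2 * n - k))) + residue_sum M n"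
    using s by (simp add: add_ac)
  ultimately have "2 * n dvd residue_sum M n" by (subst (asm) dvd_add_right_iff)
  then have "2 * n dvd n * residue_count M n" unfolding q[of n] by (subst (asm) dvd_add_left_iff) auto
  then have "n * 2 dvd n * residue_count M n" by (simp only: mult.commute[of n 2])
  then show ?thesis using n3 by (simp only: nat_mult_dvd_cancel1)
qed

lemma even_size_nonIII:
  assumes bal: "balanced (image_mset fst B)" and e: "even (residue_count (image_mset fst B) n)"
    and L: "L \<noteq> LamN"
  shows "even (size (nonIII L B))"
proof -
  let ?M = "nonIII L B"
  have rc: "residue_count ?M r = (if r = 0 then 0 else residue_count (image_mset fst B) r)" for r
    using L unfolding residue_count_def nonIII_def filter_filter_mset rtype_III_iff
    by (auto simp: wall_residue_def filter_mset_eq_conv intro!: arg_cong[of _ _ size] filter_mset_cong)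
  have "residue_count ?M k + residue_count ?M (2 * n - k) = 2 * residue_count ?M k" if "k \<in> {1..<n}" for k
    using bal that unfolding balanced_def residue_count_def[symmetric] rc by auto
  then have "even (\<Sum>k = 1..<n. residue_count ?M k + residue_count ?M (2 * n - k))" by (intro dvd_sum) simp
  moreover have "even (residue_count ?M n)" using e n3 by (simp add: rc)
  ultimately show ?thesis unfolding size_residues[of ?M] sum_residues by (simp add: rc)
qed

lemma bead_list_good:
  assumes x: "bead_list L x" and bal: "balanced (positions x)"
    and s: "sum_list (map fst x) = 2 * n * m"
  shows "good L (mset x)"
proof -
  have "sum_mset (positions x) = 2 * n * m" using s by (simp flip: mset_map sum_mset_sum_list)
  then have "even (residue_count (positions x) n)" by (intro even_count_n[OF bal]) simp
  then show ?thesis using bead_list_legal[OF x] bal by (simp add: good_def)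
qed

lemma alt_core_list:
  assumes x: "bead_list L x" and g: "good L (mset x)"
  shows "alt (map (split_excess L) (core_list L False x)) = alt (map (split_excess L) x)"
proof (cases "L = LamN")
  case True
  then show ?thesis using alt_core_list_n[where p = False and x = x] x by (simp add: bead_list_def)
next
  case False
  then have "even (size (nonIII L (mset x)))" using g even_size_nonIII by (simp add: good_def)
  then show ?thesis using alt_core_list_01[OF False, of x] x by (simp add: bead_list_def)
qed

end

subsection \<open>Walls of two-colored partitions\<close>

lemma P'_above: "b # x \<in> P' \<Longrightarrow> b' \<in> set x \<Longrightarrow> fst b' < fst b \<or> b' = b"
  by (cases b; cases b'; cases "snd b"; cases "snd b'") (fastforce simp: P'_def is_partition_Cons)+

lemma P'_pos: "x \<in> P' \<Longrightarrow> b \<in> set x \<Longrightarrow> 0 < fst b"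
  by (force simp: P'_iff)

lemma P'_sorted: "x \<in> P' \<Longrightarrow> sorted_wrt (\<lambda>b b'. fst b' < fst b \<or> b' = b) x"
proof (induction x)
  case (Cons b x)
  then show ?case using P'_above[OF Cons.prems] by (auto simp: P'_Cons)
qed simp

lemma P'_mset_unique: "x \<in> P' \<Longrightarrow> y \<in> P' \<Longrightarrow> mset x = mset y \<Longrightarrow> x = y"
  by (rule sorted_wrt_mset_unique[OF _ P'_sorted P'_sorted]) auto

lemma cpart_at_update: "k < length x \<Longrightarrow> cpart_at (x[k := b]) i = (if i = k then b else cpart_at x i)"
  by (simp add: nth_default_def)

abbreviation lower :: "cpart \<Rightarrow> nat \<Rightarrow> cpart" where
  "lower x k \<equiv> x[k := (fst (x ! k) - 1, snd (x ! k))]"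

text \<open>For \<open>\<Lambda>_n\<close> this means that a \<open>\<delta>\<close>-column can be removed from the column of the \<open>k\<close>-th part.\<close>

definition removable :: "cpart \<Rightarrow> nat \<Rightarrow> bool" where
  "removable x k \<longleftrightarrow> k < length x \<and> 2 \<le> fst (x ! k) \<and>
     (fst (cpart_at x (Suc k)) + 1 < fst (x ! k) \<or> cpart_at x (Suc k) = (fst (x ! k) - 1, snd (x ! k)))"

lemma removable_update_P':
  assumes x: "x \<in> P'" and r: "removable x k"
  shows "lower x k \<in> P'"
proof -
  have k: "k < length x" "2 \<le> fst (x ! k)" using r by (auto simp: removable_def)
  have at: "cpart_at x k = x ! k" using k by (simp add: nth_default_def)
  have "fst b \<noteq> 0" if "b \<in> set (lower x k)" for b
  proof -
    have "b = (fst (x ! k) - 1, snd (x ! k)) \<or> b \<in> set x" using that set_update_subset_insert by fast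
    then show ?thesis using k P'_pos[OF x, of b] by auto
  qed
  then have "0 \<notin> fst ` set (lower x k)" by (metis imageE)
  moreover have "fst (cpart_at (lower x k) (Suc i)) < fst (cpart_at (lower x k) i) \<or>
      cpart_at (lower x k) (Suc i) = cpart_at (lower x k) i" for i
  proof -
    have step: "fst (cpart_at x (Suc i)) < fst (cpart_at x i) \<or> cpart_at x (Suc i) = cpart_at x i" using x
      by (simp add: P'_iff)
    show ?thesis using r step k at unfolding cpart_at_update[OF k(1)] removable_def by auto
  qed
  ultimately show ?thesis by (simp add: P'_iff)
qed

definition staircase_colored :: "cpart \<Rightarrow> bool" where
  "staircase_colored x \<longleftrightarrow> (\<exists>c q. c \<in> {0, 1} \<and> (q = [] \<longrightarrow>
      c = 0) \<and> is_partition q \<and> two_reduced q \<and> x = colour_parts c q)"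

lemma removable_or_staircase_colored: "x \<in> P' \<Longrightarrow> (\<exists>k. removable x k) \<or> staircase_colored x"
proof (induction x)
  case Nil
  have "staircase_colored []" unfolding staircase_colored_def by (intro exI[of _ 0] exI[of _ "[]"]) simp
  then show ?case by blast
next
  case (Cons b x)
  show ?case
  proof (cases "\<exists>k. removable x k")
    case True
    then obtain k where "removable x k" by blast
    then have "removable (b # x) (Suc k)" by (simp add: removable_def)
    then show ?thesis by blast
  next
    case False
    then obtain c q where q: "c \<in> {0, 1}" "is_partition q" "two_reduced q" "x = colour_parts c q"
      using Cons by (auto simp: P'_Cons staircase_colored_def)
    have b: "0 < fst b" "fst (cpart_at x 0) < fst b \<or> cpart_at x 0 = b" using Cons.prems
      by (auto simp: P'_Cons)
    define e where "e = (if q = [] then (if snd b = Gray then 0 else 1) else c)"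
    have ce: "colour_parts c q = colour_parts e q" by (simp add: e_def)
    have redI: "staircase_colored (b # x)"
      if "fst b \<le> part_at q 0 + 1" "part_at q 0 \<le> fst b" "snd b = parity_colour e (fst b)"
      unfolding staircase_colored_def
    proof (intro exI conjI)
      show "e \<in> {0, 1}" using q(1) by (auto simp: e_def)
      show "is_partition (fst b # q)" "two_reduced (fst b # q)"
        using that b(1) q by (auto simp: is_partition_Cons_at two_reduced_Cons)
      show "b # x = colour_parts e (fst b # q)" using that ce q(4) by (cases b) simp
    qed simp
    show ?thesis
    proof (cases "q = []")
      case True
      then show ?thesis using redI b
        by (cases "fst b = 1"; cases "snd b") (auto simp: e_def parity_colour_def removable_def q(4) intro!: exI[of _ 0])
    next
      case False
      have x0: "cpart_at x 0 = (part_at q 0, parity_colour c (part_at q 0))" using False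
        by (simp add: q(4) cpart_at_colour_parts)
      have q0: "0 < part_at q 0" using False q(2) by (cases q) (auto simp: is_partition_Cons)
      have ec: "e = c" using False by (simp add: e_def)
      consider "fst b = part_at q 0" | "fst b = part_at q 0 + 1" | "part_at q 0 + 1 < fst b" using b(2) x0
        by fastforce
      then show ?thesis
      proof cases
        case 1
        then show ?thesis using redI b(2) x0 ec by auto
      next
        case 2
        show ?thesis
        proof (cases "snd b = parity_colour c (part_at q 0)")
          case True
          then have "removable (b # x) 0" using 2 x0 q0 by (simp add: removable_def)
          then show ?thesis by blast
        next
          case False
          then have "snd b = parity_colour e (fst b)" using 2 ec
            by (cases "snd b") (auto simp: parity_colour_def split: if_splits)
          then show ?thesis using redI 2 by simp
        qed
      next
        case 3
        then have "removable (b # x) 0" using x0 by (simp add: removable_def)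
        then show ?thesis by blast
      qed
    qed
  qed
qed

lemma staircase_colored_not_removable: "staircase_colored x \<Longrightarrow> \<not> removable x k"
proof
  assume "staircase_colored x" and r: "removable x k"
  then obtain c q where q: "is_partition q" "two_reduced q" "x = colour_parts c q"
    by (auto simp: staircase_colored_def)
  have k: "k < length q" using r by (simp add: removable_def q(3))
  then have xk: "x ! k = (part_at q k, parity_colour c (part_at q k))"
    using cpart_at_colour_parts[of c q k] by (simp add: q(3) nth_default_nth)
  have "part_at q k \<le> part_at q (Suc k) + 1" using q(2) by (simp add: two_reduced_def)
  moreover have S: "cpart_at x (Suc k) =
      (if Suc k < length q then (part_at q (Suc k), parity_colour c (part_at q (Suc k))) else (0, White))"
    unfolding q(3) by (rule cpart_at_colour_parts)
  moreover have "part_at q (Suc k) = 0" if "\<not> Suc k < length q" using that by (simp add: nth_default_beyond)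
  ultimately show False using r xk
    by (cases "Suc k < length q") (auto simp: removable_def parity_colour_def split: if_splits)
qed

context rank begin

abbreviation pos :: "level1 \<Rightarrow> nat \<Rightarrow> nat" where
  "pos L \<equiv> typeIII_position n L"

lemma pos_less: "1 \<le> j \<Longrightarrow> 1 \<le> k \<Longrightarrow> pos L j < pos L k \<longleftrightarrow> j < k"
  using n3 by (auto simp: typeIII_position_def)

lemma pos_eq: "1 \<le> j \<Longrightarrow> 1 \<le> k \<Longrightarrow> pos L j = pos L k \<longleftrightarrow> j = k"
  using pos_less[of j k L] pos_less[of k j L] by linarith

lemma pos_positive: "1 \<le> k \<Longrightarrow> 0 < pos L k"
  using n3 by (auto simp: typeIII_position_def)

lemma pos_mod: "1 \<le> k \<Longrightarrow> pos L k mod (2 * n) = wall_residue n L"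
proof -
  assume "1 \<le> k"
  then obtain j where "k = Suc j" by (cases k) auto
  have "(2 * k - 1) * n = n + j * (2 * n)" using \<open>k = Suc j\<close> by (simp add: algebra_simps)
  then have "(2 * k - 1) * n mod (2 * n) = n" using n3 by (simp only: mod_mult_self1) simp
  then show ?thesis by (simp add: typeIII_position_def wall_residue_def)
qed

lemma pos_type: "1 \<le> k \<Longrightarrow> rtype n L (pos L k) = TypeIII"
  by (simp add: rtype_III_iff pos_mod)

lemma pos_dvd: "n dvd pos L k"
  by (simp add: typeIII_position_def)

lemma pos_pred: "2 \<le> k \<Longrightarrow> pos L (k - 1) + 2 * n = pos L k"
proof -
  assume "2 \<le> k"
  then obtain j where "k = Suc (Suc j)" by (metis add_2_eq_Suc le_Suc_ex)
  then show ?thesis by (simp add: typeIII_position_def algebra_simps)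
qed

lemma pos_surj:
  assumes "0 < s" "rtype n L s = TypeIII" obtains k where "1 \<le> k" "s = pos L k"
proof (cases "L = LamN")
  case True
  then have "s mod (2 * n) = n" using assms by (simp add: rtype_III_iff wall_residue_def)
  then have "s = n + 2 * n * (s div (2 * n))" by (metis mod_mult_div_eq)
  then show thesis using that[of "Suc (s div (2 * n))"] True by (simp add: typeIII_position_def algebra_simps)
next
  case False
  then have "2 * n dvd s" using assms by (simp add: rtype_III_iff wall_residue_def mod_eq_0_iff_dvd)
  then obtain k where "s = 2 * n * k" by (rule dvdE)
  then show thesis using that[of k] False assms by (simp add: typeIII_position_def)
qed

definition place_list :: "level1 \<Rightarrow> cpart \<Rightarrow> (nat \<times> colour) list" where
  "place_list L y = map (\<lambda>b. (pos L (fst b), snd b)) y"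

lemma place_list_Cons [simp]: "place_list L (b # y) = (pos L (fst b), snd b) # place_list L y"
  by (simp add: place_list_def)

lemma place_list_Nil [simp]: "place_list L [] = []"
  by (simp add: place_list_def)

lemma place_list_bead_list: "y \<in> P' \<Longrightarrow> bead_list L (place_list L y)"
proof (induction y)
  case (Cons b y)
  have y: "y \<in> P'" "1 \<le> fst b" using Cons.prems by (auto simp: P'_Cons)
  have "above (pos L (fst b), snd b) b'" if b': "b' \<in> set (place_list L y)" for b'
  proof -
    obtain d where d: "d \<in> set y" "b' = (pos L (fst d), snd d)" using b' unfolding place_list_def by auto
    have "1 \<le> fst d" using P'_pos[OF y(1) d(1)] by simp
    then show ?thesis using P'_above[OF Cons.prems d(1)] pos_less[of "fst d" "fst b" L] y(2) d(2) pos_dvd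
      by (auto simp: above_def)
  qed
  then show ?case using Cons.IH y pos_positive pos_mod by (auto simp: bead_list_Cons valid_def)
qed (simp add: bead_list_def)

lemma place_list_exists:
  "bead_list L z \<Longrightarrow> \<forall>b \<in> set z. rtype n L (fst b) = TypeIII \<Longrightarrow> \<exists>y \<in> P'. z = place_list L y"
proof (induction z)
  case Nil
  then show ?case by (intro bexI[of _ "[]"]) auto
next
  case (Cons b z)
  then obtain y where y: "y \<in> P'" "z = place_list L y" by (auto simp: bead_list_Cons)
  obtain k where k: "1 \<le> k" "fst b = pos L k" using pos_surj[of "fst b" L] Cons.prems
    by (auto simp: bead_list_Cons)
  have "fst (cpart_at y 0) < k \<or> cpart_at y 0 = (k, snd b)"
  proof (cases y)
    case Nil
    then show ?thesis using k by simp
  next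
    case (Cons d y')
    then have "above b (pos L (fst d), snd d)" "1 \<le> fst d"
      using \<open>bead_list L (b # z)\<close> y by (auto simp: bead_list_Cons P'_Cons)
    then show ?thesis using k pos_less[of "fst d" k L] pos_eq[of "fst d" k L] Cons
      by (cases b; cases d) (auto simp: above_def)
  qed
  then have "(k, snd b) # y \<in> P'" using y k by (simp add: P'_Cons)
  moreover have "b # z = place_list L ((k, snd b) # y)" using y k by (cases b) simp
  ultimately show ?case by blast
qed

lemma count_place_list:
  "1 \<le> k \<Longrightarrow> y \<in> P' \<Longrightarrow> count (mset (place_list L y)) (pos L k, c) = count (mset y) (k, c)"
proof (induction y)
  case (Cons b y)
  then have "1 \<le> fst b" "y \<in> P'" by (auto simp: P'_Cons)
  then show ?case using Cons pos_eq[of "fst b" k L] by (cases b) auto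
qed simp

lemma wall_cpart_place_list:
  assumes y: "y \<in> P'" shows "wall_cpart n L (wall_of L (place_list L y)) = y"
  unfolding wall_cpart_def beads_wall_of[OF place_list_bead_list[OF y]]
proof (rule the_equality)
  show "y \<in> P' \<and> (\<forall>k\<ge>1. \<forall>c. count (mset y) (k, c) = count (mset (place_list L y)) (pos L k, c))"
    using y count_place_list by simp
next
  fix x assume x: "x \<in> P' \<and> (\<forall>k\<ge>1. \<forall>c. count (mset x) (k, c) = count (mset (place_list L y)) (pos L k, c))"
  have "count (mset x) b = count (mset y) b" for b
  proof (cases "1 \<le> fst b")
    case True
    then show ?thesis using x count_place_list[OF True y, of L "snd b"] by (cases b) simp
  next
    case False
    then have "b \<notin> set x" "b \<notin> set y" using x y P'_pos by fastforce+
    then show ?thesis by (metis count_mset_0_iff)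
  qed
  then show "x = y" using x y by (intro P'_mset_unique multiset_eqI) auto
qed

lemma added_wall_of: "bead_list L x \<Longrightarrow> added L (wall_of L x k) = (if k < length x then fst (x ! k) else 0)"
  using added_column_of[OF valid_bead, of L x k] by (simp add: wall_of_bead split: if_splits)

lemma place_list_proper':
  assumes y: "y \<in> P'" shows "wall_of L (place_list L y) \<in> proper_walls' n L"
proof -
  have b: "bead_list L (place_list L y)" by (rule place_list_bead_list[OF y])
  have "fst (place_list L y ! k) mod (2 * n) = wall_residue n L" if "k < length (place_list L y)" for k
    using that P'_pos[OF y, of "y ! k"] pos_mod by (simp add: place_list_def Suc_le_eq)
  then show ?thesis using wall_of_proper[OF b] by (simp add: proper_walls'_def added_wall_of[OF b])
qed

lemma proper'_place_list:
  assumes "W \<in> proper_walls' n L" obtains y where "y \<in> P'" "W = wall_of L (place_list L y)"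
proof -
  obtain x where x: "bead_list L x" "W = wall_of L x" using assms proper_wallE
    by (auto simp: proper_walls'_def)
  have "rtype n L (fst b) = TypeIII" if "b \<in> set x" for b
  proof -
    obtain k where k: "k < length x" "b = x ! k" using \<open>b \<in> set x\<close> by (metis in_set_conv_nth)
    have "0 < fst b" using x(1) \<open>b \<in> set x\<close> by (simp add: bead_list_def)
    moreover have "added L (W k) = fst b" using k x added_wall_of[OF x(1), of k] by simp
    moreover have "added L (W k) \<noteq> 0 \<longrightarrow> added L (W k) mod (2 * n) = wall_residue n L"
      using assms by (simp add: proper_walls'_def)
    ultimately show ?thesis by (simp add: rtype_III_iff)
  qed
  then show thesis using place_list_exists[OF x(1)] x(2) that by blast
qed

lemma level_count_sub:
  assumes "2 * n \<le> N" "1 \<le> e" "e \<le> n" shows "level_count N e = level_count (N - 2 * n) e + 2"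
proof -
  define d where "d e = int (level_count N e) - int (level_count (N - 2 * n) e)" for e
  have m: "(N - 2 * n) mod (2 * n) = N mod (2 * n)" using assms(1) by (simp add: le_mod_geq[symmetric])
  have d: "d e = d 1" if "1 \<le> e" "e \<le> n" for e
    using that
  proof (induction e rule: dec_induct)
    case (step e)
    then have "d e = d (Suc e)"
      using level_count_diff[of e N] level_count_diff[of e "N - 2 * n"] by (simp add: d_def m)
    then show ?case using step by simp
  qed simp
  have "(\<Sum>e = 1..n. d e) = int (\<Sum>e = 1..n. level_count N e) - int (\<Sum>e = 1..n. level_count (N - 2 * n) e)"
    by (simp add: d_def sum_subtractf)
  also have "\<dots> = 2 * int n" using assms(1) unfolding sum_level_count by simp
  finally have "(\<Sum>e = 1..n. d 1) = 2 * int n" using d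
    by (metis (no_types, lifting) atLeastAtMost_iff sum.cong)
  then have "d 1 = 2" using n3 by simp
  then show ?thesis using d[OF assms(2,3)] by (simp add: d_def)
qed

lemma card_color_diff:
  assumes "valid L b" "valid L b'" "column_of L b' \<subseteq> column_of L b"
  shows "card {p \<in> column_of L b - column_of L b'. block_color n L k p = i} + card {t \<in> added_indices b'. index_color L k t = i}
    = card {t \<in> added_indices b. index_color L k t = i}"
proof -
  have "{p \<in> column_of L b - ground L. block_color n L k p = i} =
    {p \<in> column_of L b - column_of L b'. block_color n L k p = i} \<union> {p \<in> column_of L b' - ground L. block_color n L k p = i}"
    using assms ground_subset_column_of by blast
  moreover have "card \<dots> =
      card {p \<in> column_of L b - column_of L b'. block_color n L k p = i} + card {p \<in> column_of L b' - ground L. block_color n L k p = i}"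
    by (rule card_Un_disjoint) auto
  ultimately show ?thesis
    unfolding card_color_column[OF assms(1), symmetric] card_color_column[OF assms(2), symmetric] by simp
qed

lemma card_index_color_01:
  assumes "valid L b"
  shows "card {t \<in> added_indices b. index_color L k t = 0} + card {t \<in> added_indices b. index_color L k t = 1} = level_count (fst b) (split_level L)"
    and "int (card {t \<in> added_indices b. index_color L k t = 0}) - int (card {t \<in> added_indices b. index_color L k t = 1}) =
      (if posA_color L k = 0 then 1 else - 1) * split_excess L b"
  using card_index_color_split(1,2)[OF finite_added_indices[of b], of L k] card_index_color_split(3)[OF finite_added_indices[of b], of L]
    level_count_added[OF assms, of "split_level L"] count_AB_added[OF assms] by (auto split: if_splits)

lemma delta_column:
  assumes v: "valid L (N, c)" "valid L (N - 2 * n, c)" and N: "2 * n < N"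
  shows "card {p \<in> column_of L (N, c) - column_of L (N - 2 * n, c). block_color n L k p = i} = delta n i"
proof -
  have sub: "column_of L (N - 2 * n, c) \<subseteq> column_of L (N, c)" using N n3
    by (simp add: column_of_subset[OF v(2,1)])
  note d = card_color_diff[OF v sub, of k]
  have m: "(N - 2 * n) mod (2 * n) = N mod (2 * n)" using N by (simp add: le_mod_geq[symmetric])
  have split_excess: "split_excess L (N - 2 * n, c) = split_excess L (N, c)" by (simp add: split_excess_def m)
  consider "i \<le> 1" | "2 \<le> i" "i \<le> n" | "n < i" by linarith
  then show ?thesis
  proof cases
    case 1
    have s: "1 \<le> split_level L" "split_level L \<le> n" using n3 by (auto simp: split_level_def)
    have "level_count N (split_level L) = level_count (N - 2 * n) (split_level L) + 2"
      using level_count_sub s N by simp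
    then have "card {p \<in> column_of L (N, c) - column_of L (N - 2 * n, c). block_color n L k p = 0} = 1 \<and>
      card {p \<in> column_of L (N, c) - column_of L (N - 2 * n, c). block_color n L k p = 1} = 1"
      using card_index_color_01[OF v(1), of k] card_index_color_01[OF v(2), of k] d[of 0] d[of 1] split_excess
        by simp
    then show ?thesis using 1 by (cases "i = 0") (auto simp: delta_def le_Suc_eq)
  next
    case 2
    have e: "1 \<le> level_color L i" "level_color L i \<le> n" using 2 by (auto simp: level_color_def)
    have "level_count N (level_color L i) = level_count (N - 2 * n) (level_color L i) + 2"
      using level_count_sub e N by simp
    then show ?thesis
      using d[of i] 2 level_count_added[OF v(1), of "level_color L i"] level_count_added[OF v(2), of "level_color L i"]
      by (simp add: card_index_color_mid[OF 2] delta_def)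
  next
    case 3
    then have "{t \<in> added_indices (N, c). index_color L k t = i} = {}" using index_color_le
      by (fastforce simp: not_le[symmetric])
    then have "card {p \<in> column_of L (N, c) - column_of L (N - 2 * n, c). block_color n L k p = i} = 0"
      using d[of i] by (simp only: card.empty add_is_0)
    moreover have "delta n i = 0" using 3 n3 by (simp add: delta_def)
    ultimately show ?thesis by (simp only:)
  qed
qed

lemma not_reduced_if_removable:
  assumes x: "x \<in> P'" and r: "removable x k"
  shows "\<not> is_reduced n L (wall_of L (place_list L x))"
proof -
  define a c where "a = fst (x ! k)" and "c = snd (x ! k)"
  have k: "k < length x" "2 \<le> a" using r by (auto simp: removable_def a_def)
  define N where "N = pos L a"
  have "1 \<le> a - 1" using k by simp
  then have N: "pos L (a - 1) = N - 2 * n" "2 * n < N"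
    using pos_pred[OF k(2), of L] pos_positive[of "a - 1" L] unfolding N_def by linarith+
  have "x ! k = (a, c)" by (simp add: a_def c_def)
  define x' where "x' = x[k := (a - 1, c)]"
  have x': "x' \<in> P'" using removable_update_P'[OF x r] by (simp add: x'_def a_def c_def)
  have pl: "bead_list L (place_list L x)" "bead_list L (place_list L x')" using place_list_bead_list x x'
    by auto
  have at: "place_list L x ! k = (N, c)" "place_list L x' ! k = (N - 2 * n, c)"
    using k \<open>x ! k = (a, c)\<close> N(1)[unfolded One_nat_def]
      by (simp_all add: place_list_def x'_def) (simp add: N_def)
  have len: "length (place_list L x) = length x" "length (place_list L x') = length x"
    by (simp_all add: place_list_def x'_def)
  have v: "valid L (N, c)" "valid L (N - 2 * n, c)"
    using valid_bead[OF pl(1), of k] valid_bead[OF pl(2), of k] k by (simp_all add: len at)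
  define D where "D = column_of L (N, c) - column_of L (N - 2 * n, c)"
  have Yk: "wall_of L (place_list L x) k = column_of L (N, c)" using k by (simp add: wall_of_def len at)
  have sub: "column_of L (N - 2 * n, c) \<subseteq> column_of L (N, c)" using N n3
    by (simp add: column_of_subset[OF v(2,1)])
  have "D \<subseteq> wall_of L (place_list L x) k - ground L"
    using ground_subset_column_of[OF v(2)] unfolding Yk D_def by blast
  moreover have "card D = 2 * n" unfolding D_def using N sub by (simp add: card_Diff_subset)
  moreover have "\<forall>i. card {p \<in> D. block_color n L (Suc k) p = i} = delta n i"
    unfolding D_def using delta_column[OF v N(2)] by blast
  moreover have "(wall_of L (place_list L x))(k := wall_of L (place_list L x) k - D) =
      wall_of L (place_list L x')"
  proof
    fix j
    show "((wall_of L (place_list L x))(k := wall_of L (place_list L x) k - D)) j =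
        wall_of L (place_list L x') j"
    proof (cases "j = k")
      case True
      then show ?thesis using sub k by (auto simp: Yk D_def wall_of_def[of L "place_list L x'"] len at)
    next
      case False
      then show ?thesis using k by (simp add: wall_of_def len) (simp add: place_list_def x'_def)
    qed
  qed
  then have "(wall_of L (place_list L x))(k := wall_of L (place_list L x) k - D) \<in> proper_walls n L"
    using wall_of_proper[OF pl(2)] by simp
  ultimately show ?thesis unfolding is_reduced_def by blast
qed

lemma removable_if_not_reduced:
  assumes x: "x \<in> P'" and nr: "\<not> is_reduced n LamN (wall_of LamN (place_list LamN x))"
  shows "\<exists>k. removable x k"
proof -
  define L where "L = LamN"
  define Y where "Y = wall_of L (place_list L x)"
  have pl: "bead_list L (place_list L x)" by (rule place_list_bead_list[OF x])
  obtain k D where D: "D \<subseteq> Y k - ground L" "card D = 2 * n"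
    "\<And>i. card {p \<in> D. block_color n L (Suc k) p = i} = delta n i" "Y(k := Y k - D) \<in> proper_walls n L"
    using nr unfolding is_reduced_def Y_def L_def by blast
  have len: "length (place_list L x) = length x" by (simp add: place_list_def)
  have k: "k < length x"
  proof (rule ccontr)
    assume "\<not> k < length x"
    then have "Y k = ground L" by (simp add: Y_def wall_of_def len)
    then show False using D(1,2) n3 by simp
  qed
  define a c N where "a = fst (x ! k)" and "c = snd (x ! k)" and "N = pos L a"
  have a1: "1 \<le> a" using P'_pos[OF x, of "x ! k"] k by (simp add: a_def)
  have at: "place_list L x ! k = (N, c)" using k by (simp add: place_list_def N_def a_def c_def)
  have Yk: "Y k = column_of L (N, c)" using k by (simp add: Y_def wall_of_def len at)
  have v: "valid L (N, c)" using valid_bead[OF pl, of k] k by (simp add: len at)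
  have young: "is_young_wall n L (Y(k := Y k - D))" using D(4) by (simp add: proper_walls_def)
  then have "is_column n L (Y k - D)" unfolding is_young_wall_def by (metis fun_upd_same)
  then obtain b' where b': "valid L b'" "Y k - D = column_of L b'" by (rule is_columnE)
  have DY: "D \<subseteq> column_of L (N, c)" using D(1) Yk by blast
  then have Deq: "D = column_of L (N, c) - column_of L b'" using b'(2) Yk by blast
  have sub: "column_of L b' \<subseteq> column_of L (N, c)" using b'(2) Yk by blast
  have "card (column_of L b') = Suc N - 2 * n"
    using DY D(2) unfolding b'(2)[symmetric] Yk by (simp add: card_Diff_subset finite_subset[OF DY])
  then have fb': "Suc (fst b') + 2 * n = Suc N" by simp
  have m: "fst b' mod (2 * n) = N mod (2 * n)" using fb' by (metis add_Suc mod_add_self2 nat.inject)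
  note d = card_color_diff[OF v b'(1) sub, of "Suc k", folded Deq, unfolded D(3)]
  have "split_excess L b' = split_excess L (N, c)"
    using card_index_color_01(2)[OF v, of "Suc k"] card_index_color_01(2)[OF b'(1), of "Suc k"] d[of 0] d[of 1]
    by (auto simp: delta_def split: if_splits)
  then have "snd b' = c" using m by (cases "snd b'"; cases c) (auto simp: split_excess_def L_def)
  then have b'eq: "b' = (N - 2 * n, c)" using fb' by (cases b') simp
  have a2: "2 \<le> a"
  proof (rule ccontr)
    assume "\<not> 2 \<le> a"
    then have "a = 1" using a1 by simp
    then have "N = n" by (simp add: N_def L_def typeIII_position_def)
    then show False using fb' n3 by simp
  qed
  have N2: "N - 2 * n = pos L (a - 1)" using pos_pred[OF a2, of L] by (simp add: N_def)
  have "Y (Suc k) \<subseteq> column_of L b'"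
    using young b'(2) unfolding is_young_wall_def by (metis fun_upd_other fun_upd_same n_not_Suc_n)
  then have le: "fst (if Suc k < length x then place_list L x ! Suc k else (0, White)) < N - 2 * n \<or>
      (if Suc k < length x then place_list L x ! Suc k else (0, White)) = (N - 2 * n, c)"
    using column_of_subset[OF valid_bead[OF pl, of "Suc k"] b'(1)] unfolding Y_def wall_of_bead len b'eq
      by simp
  have "fst (cpart_at x (Suc k)) + 1 < a \<or> cpart_at x (Suc k) = (a - 1, c)"
  proof (cases "Suc k < length x")
    case True
    define d where "d = x ! Suc k"
    have d: "1 \<le> fst d" using P'_pos[OF x, of d] True by (simp add: d_def Suc_le_eq)
    have "pos L (fst d) < pos L (a - 1) \<or> pos L (fst d) = pos L (a - 1) \<and> snd d = c"
      using le True by (simp add: N2 place_list_def d_def)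
    then show ?thesis using pos_less[of "fst d" "a - 1" L] pos_eq[of "fst d" "a - 1" L] d a2 True
      by (cases d) (auto simp: nth_default_nth d_def)
  next
    case False
    then show ?thesis using a2 by (simp add: nth_default_beyond)
  qed
  then have "removable x k" using k a2 by (simp add: removable_def a_def c_def)
  then show ?thesis by blast
qed

lemma is_reduced_iff_staircase_colored:
  assumes "x \<in> P'" shows "is_reduced n LamN (wall_of LamN (place_list LamN x)) \<longleftrightarrow> staircase_colored x"
  using not_reduced_if_removable removable_if_not_reduced removable_or_staircase_colored staircase_colored_not_removable assms by blast

lemma cpart_reduce_eq:
  assumes triple: "reduced_triple q \<nu> c"
  shows "cpart_reduce n (reduce_sum c q \<nu>) = (colour_parts c q, \<nu>)"
  unfolding cpart_reduce_def
proof (rule the_equality)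
  note q = reduced_tripleD[OF triple]
  have "colour_parts c q \<in> P'" using q(1) by (rule colour_parts_P')
  moreover have "staircase_colored (colour_parts c q)" using q by (auto simp: staircase_colored_def)
  ultimately have "\<exists>W \<in> proper_walls' n LamN. wall_cpart n LamN W = colour_parts c q \<and> is_reduced n LamN W"
    by (intro bexI[of _ "wall_of LamN (place_list LamN (colour_parts c q))"])
      (simp_all add: place_list_proper' wall_cpart_place_list is_reduced_iff_staircase_colored)
  then show "case (colour_parts c q, \<nu>) of (\<mu>, \<nu>') \<Rightarrow> \<mu> \<in> P' \<and> is_partition \<nu>' \<and>
      reduce_sum c q \<nu> = cpart_add \<mu> (white \<nu>') \<and>
      length \<mu> = length (reduce_sum c q \<nu>) \<and>
      (\<exists>W \<in> proper_walls' n LamN. wall_cpart n LamN W = \<mu> \<and> is_reduced n LamN W)"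
    using q(3,4) \<open>colour_parts c q \<in> P'\<close> by (simp add: length_cpart_add)
next
  fix z assume "case z of (\<mu>, \<nu>') \<Rightarrow> \<mu> \<in> P' \<and> is_partition \<nu>' \<and>
      reduce_sum c q \<nu> = cpart_add \<mu> (white \<nu>') \<and>
      length \<mu> = length (reduce_sum c q \<nu>) \<and>
      (\<exists>W \<in> proper_walls' n LamN. wall_cpart n LamN W = \<mu> \<and> is_reduced n LamN W)"
  then obtain \<mu> \<nu>' W where z: "z = (\<mu>, \<nu>')" "\<mu> \<in> P'" "is_partition \<nu>'"
      "reduce_sum c q \<nu> = cpart_add \<mu> (white \<nu>')"
      "length \<mu> = length (reduce_sum c q \<nu>)"
    and W: "W \<in> proper_walls' n LamN" "wall_cpart n LamN W = \<mu>" "is_reduced n LamN W"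
    by (cases z) auto
  obtain y where y: "y \<in> P'" "W = wall_of LamN (place_list LamN y)" using proper'_place_list[OF W(1)] by blast
  have "y = \<mu>" using W(2) y wall_cpart_place_list by simp
  then have "staircase_colored \<mu>" using is_reduced_iff_staircase_colored y W(3) by blast
  then obtain c' q' where q': "c' \<in> {0, 1}" "q' = [] \<longrightarrow> c' = 0" "is_partition q'" "two_reduced q'"
      "\<mu> = colour_parts c' q'"
    by (auto simp: staircase_colored_def)
  have "length \<nu>' \<le> length q'"
    using z(5) unfolding z(4) length_cpart_add q'(5) by simp
  then have "q = q' \<and> \<nu> = \<nu>' \<and> c = c'" using reduce_inj[OF triple, of q' \<nu>' c'] q' z
    by (simp add: reduced_triple_def)
  then show "z = (colour_parts c q, \<nu>)" using z(1) q'(5) by simp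
qed

lemma pi1_n_eq:
  assumes triple: "reduced_triple q \<nu> c"
  shows "pi1_n n (wall_of LamN (place_list LamN (reduce_sum c q \<nu>))) = (q, \<nu>, c)"
proof -
  note q = reduced_tripleD[OF triple]
  have "colour_parts 0 q \<noteq> colour_parts 1 q" if "q \<noteq> []" using that
    by (cases q) (auto simp: parity_colour_def)
  then have "gray_even (colour_parts c q) \<longleftrightarrow> c = 1"
    using q one_mem_two_reduced[OF q(1,2)] by (cases "q = []") (auto simp: gray_even_iff)
  then show ?thesis
    using q(5) wall_cpart_place_list[OF reduce_P'[OF q(1,3,4), of c]]
      by (auto simp: pi1_n_def cpart_reduce_eq[OF triple])
qed

lemma pi1_01_eq:
  assumes "is_partition p" "is_partition q" "two_reduced q"
  shows "pi1_01 n L (wall_of L (place_list L (split_sum p q))) = (p, q)"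
  by (simp add: pi1_01_def wall_cpart_place_list[OF split_P'[OF assms(1,2)]] cpart_split_eq[OF assms])

end

subsection \<open>The bijections\<close>

lemma rev_sorted_list_of_mset:
  fixes xs :: "nat list"
  assumes "sorted_wrt (\<ge>) xs" shows "rev (sorted_list_of_multiset (mset xs)) = xs"
proof -
  have "sorted (rev xs)" using assms by (simp add: sorted_wrt_rev)
  then have "sort xs = rev xs" by (intro properties_for_sort) simp_all
  then show ?thesis by (metis rev_rev_ident sorted_list_of_multiset_mset)
qed

lemma filter_mset_sum: "filter_mset Q (\<Sum>i \<in> A. f i) = (\<Sum>i \<in> A. filter_mset Q (f i))"
  by (induction A rule: infinite_finite_induct) auto

lemma alt_scale: "alt (map (\<lambda>b. c * f b) x) = c * alt (map f x)"
  by (induction x) (auto simp: algebra_simps)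

lemma strict_decr_imp_decr: "strict_decr xs \<Longrightarrow> sorted_wrt (\<ge>) xs"
  by (rule sorted_wrt_mono_rel) auto

lemma strict_decr_distinct: "strict_decr xs \<Longrightarrow> distinct xs"
  by (induction xs) auto

lemma decr_distinct_strict: "sorted_wrt (\<ge>) xs \<Longrightarrow> distinct xs \<Longrightarrow> strict_decr xs"
  by (induction xs) (auto simp: order_less_le)

context rank begin

definition runner :: "nat multiset \<Rightarrow> nat \<Rightarrow> nat list" where
  "runner M j = rev (sorted_list_of_multiset {#s \<in># M. s mod (2 * n) = j mod (2 * n)#})"

definition runner_coords :: "nat multiset \<Rightarrow> nat \<Rightarrow> nat list" where
  "runner_coords M j = map (\<lambda>s. (s - j) div (2 * n)) (runner M j)"

lemma mset_runner: "mset (runner M j) = {#s \<in># M. s mod (2 * n) = j mod (2 * n)#}"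
  by (simp add: runner_def)

lemma length_runner: "length (runner M j) = size {#s \<in># M. s mod (2 * n) = j mod (2 * n)#}"
  by (metis mset_runner size_mset)

lemma sorted_runner: "sorted_wrt (\<ge>) (runner M j)"
  by (simp add: runner_def sorted_wrt_rev)

lemma runner_mod: "s \<in> set (runner M j) \<Longrightarrow> s mod (2 * n) = j mod (2 * n)"
  unfolding set_mset_mset[symmetric] mset_runner by simp

lemma runner_eqI:
  assumes "sorted_wrt (\<ge>) xs" "{#s \<in># M. s mod (2 * n) = j mod (2 * n)#} = mset xs"
  shows "runner M j = xs"
  unfolding runner_def assms(2) by (rule rev_sorted_list_of_mset[OF assms(1)])

lemma runner_coords_inverse:
  assumes "j < 2 * n" shows "runner M j = map (\<lambda>a. j + 2 * n * a) (runner_coords M j)"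
proof -
  have "j + 2 * n * ((s - j) div (2 * n)) = s" if "s \<in> set (runner M j)" for s
  proof -
    have m: "s mod (2 * n) = j" using runner_mod[OF that] assms by simp
    then have s: "s = j + 2 * n * (s div (2 * n))" by (metis mod_mult_div_eq)
    then have "s - j = 2 * n * (s div (2 * n))" by simp
    then have "(s - j) div (2 * n) = s div (2 * n)" using n3 by simp
    then show ?thesis using s by simp
  qed
  then show ?thesis by (simp add: runner_coords_def comp_def map_idI)
qed

lemma runner_coords_eqI:
  assumes "strict_decr as" "{#s \<in># M. s mod (2 * n) = j mod (2 * n)#} = mset (map (\<lambda>a. j + 2 * n * a) as)"
  shows "runner_coords M j = as"
proof -
  have "sorted_wrt (\<ge>) (map (\<lambda>a. j + 2 * n * a) as)"
    using strict_decr_imp_decr[OF assms(1)] unfolding sorted_wrt_map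
      by (rule sorted_wrt_mono_rel[rotated]) auto
  then have "runner M j = map (\<lambda>a. j + 2 * n * a) as" using assms(2) by (rule runner_eqI)
  then show ?thesis using n3 by (simp add: runner_coords_def comp_def)
qed

lemma runner_positions_wall_of:
  "bead_list L x \<Longrightarrow> runner_positions n L (wall_of L x) j = runner (positions x) j"
  by (simp add: runner_positions_def runner_def beads_wall_of)

lemma runner_seq_wall_of:
  "bead_list L x \<Longrightarrow> runner_seq n L (wall_of L x) j = runner_coords (positions x) j"
  by (simp add: runner_seq_def runner_coords_def runner_positions_wall_of)

lemma strict_decr_runner_coords:
  assumes l: "legal L B" and j: "0 < j" "j < 2 * n" "j \<noteq> n"
  shows "strict_decr (runner_coords (image_mset fst B) j)"
proof -
  have "count (mset (runner (image_mset fst B) j)) s \<le> 1" for s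
  proof (cases "s mod (2 * n) = j")
    case True
    then have "rtype n L s = TypeI" using j by (simp add: rtype_def)
    then show ?thesis using l True j by (simp add: legal_def mset_runner)
  next
    case False
    then show ?thesis using j by (simp add: mset_runner)
  qed
  then have "count (mset (runner (image_mset fst B) j)) s =
      (if s \<in> set (runner (image_mset fst B) j) then 1 else 0)" for s
    by (metis One_nat_def count_greater_zero_iff count_mset_0_iff le_Suc_eq le_zero_eq not_gr0 set_mset_mset)
  then have "distinct (runner (image_mset fst B) j)" unfolding distinct_count_atmost_1 by blast
  then have "strict_decr (runner (image_mset fst B) j)" using sorted_runner by (intro decr_distinct_strict)
  then have "strict_decr (map (\<lambda>a. j + 2 * n * a) (runner_coords (image_mset fst B) j))"
    by (subst (asm) runner_coords_inverse[OF j(2)])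
  then show ?thesis using n3 by (simp add: sorted_wrt_map)
qed

definition unit_II :: "level1 \<Rightarrow> nat" where
  "unit_II L = (if L = LamN then 2 * n else n)"

definition residue_II :: "level1 \<Rightarrow> nat" where
  "residue_II L = (if L = LamN then 0 else n)"

definition admissible :: "level1 \<Rightarrow> nat list \<Rightarrow> bool" where
  "admissible L p \<longleftrightarrow> is_partition p \<and> (L \<noteq> LamN \<longrightarrow> (\<forall>k \<in> set p. odd k))"

lemma residue_II_less: "residue_II L < 2 * n"
  using n3 by (simp add: residue_II_def)

lemma lambda0_wall_of:
  "bead_list L x \<Longrightarrow> lambda0 n L (wall_of L x) =
      map (\<lambda>s. s div unit_II L) (runner (positions x) (residue_II L))"
  unfolding lambda0_def runner_positions_wall_of
    by (simp add: unit_II_def residue_II_def runner_def runner_positions_wall_of)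

lemma mod_unit_II:
  "s mod (2 * n) = residue_II L \<longleftrightarrow> (\<exists>k. s = k * unit_II L \<and> (L \<noteq> LamN \<longrightarrow> odd k))"
proof (cases "L = LamN")
  case True
  then show ?thesis by (auto simp: residue_II_def unit_II_def mod_eq_0_iff_dvd dvd_def mult.commute)
next
  case False
  have "(\<exists>k. s = k * n \<and> odd k)" if "s mod (2 * n) = n"
  proof -
    have "s = n + 2 * n * (s div (2 * n))" using that by (metis mod_mult_div_eq)
    then have "s = (2 * (s div (2 * n)) + 1) * n" by (simp add: algebra_simps)
    then show ?thesis by (intro exI[of _ "2 * (s div (2 * n)) + 1"]) simp
  qed
  moreover have "s mod (2 * n) = n" if k: "s = k * n" "odd k" for k
  proof -
    obtain i where "k = 2 * i + 1" using k(2) by (rule oddE)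
    then have "s = n + i * (2 * n)" using k by (simp add: algebra_simps)
    then have "s mod (2 * n) = n mod (2 * n)" by (simp only: mod_mult_self1)
    then show ?thesis using n3 by simp
  qed
  ultimately show ?thesis using False by (auto simp: residue_II_def unit_II_def)
qed

lemma unit_II_pos: "0 < unit_II L"
  using n3 by (simp add: unit_II_def)

lemma runner_II:
  assumes x: "bead_list L x"
  shows "runner (positions x) (residue_II L) = map (\<lambda>k. k * unit_II L) (lambda0 n L (wall_of L x))"
    and "admissible L (lambda0 n L (wall_of L x))"
proof -
  let ?R = "runner (positions x) (residue_II L)"
  have R: "\<exists>k. s = k * unit_II L \<and> (L \<noteq> LamN \<longrightarrow> odd k)" if "s \<in> set ?R" for s
    using runner_mod[OF that] residue_II_less[of L] mod_unit_II by simp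
  have pos: "0 < s" if "s \<in> set ?R" for s
  proof -
    have "s \<in># positions x" using that unfolding set_mset_mset[symmetric] mset_runner by simp
    then show ?thesis using x by (auto simp: bead_list_def)
  qed
  show eq: "?R = map (\<lambda>k. k * unit_II L) (lambda0 n L (wall_of L x))"
    unfolding lambda0_wall_of[OF x] map_map using R unit_II_pos[of L] by (intro map_idI[symmetric]) fastforce
  have "sorted_wrt (\<lambda>j k. k * unit_II L \<le> j * unit_II L) (lambda0 n L (wall_of L x))"
    using sorted_runner[of "positions x" "residue_II L"] unfolding eq sorted_wrt_map .
  then have "sorted_wrt (\<ge>) (lambda0 n L (wall_of L x))"
    by (rule sorted_wrt_mono_rel[rotated]) (use unit_II_pos[of L] in auto)
  moreover have "0 < k \<and> (L \<noteq> LamN \<longrightarrow> odd k)" if "k \<in> set (lambda0 n L (wall_of L x))" for k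
  proof -
    have "k * unit_II L \<in> set ?R" unfolding eq set_map using that by (rule imageI)
    then show ?thesis using R pos unit_II_pos[of L] by fastforce
  qed
  ultimately show "admissible L (lambda0 n L (wall_of L x))"
    unfolding admissible_def is_partition_def by fastforce
qed

lemma pi0_wall_of:
  "bead_list L x \<Longrightarrow> pi0 n L (wall_of L x) = lambda0 n L (wall_of L x) #
    map (\<lambda>k. frobenius (runner_coords (positions x) k) (runner_coords (positions x) (2 * n - k))) [1..<n]"
  by (simp add: pi0_def runner_seq_wall_of)

lemma runner_coords_pair:
  assumes x: "bead_list L x" and bal: "balanced (positions x)" and k: "k \<in> {1..<n}"
  shows "strict_decr (runner_coords (positions x) k)"
    "strict_decr (runner_coords (positions x) (2 * n - k))"
    "length (runner_coords (positions x) k) = length (runner_coords (positions x) (2 * n - k))"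
proof -
  have l: "legal L (mset x)" using x by (rule bead_list_legal)
  show "strict_decr (runner_coords (positions x) k)"
    using k by (intro strict_decr_runner_coords[OF l]) auto
  show "strict_decr (runner_coords (positions x) (2 * n - k))"
    using k by (intro strict_decr_runner_coords[OF l]) auto
  have "k mod (2 * n) = k" "(2 * n - k) mod (2 * n) = 2 * n - k" using k by auto
  then show "length (runner_coords (positions x) k) = length (runner_coords (positions x) (2 * n - k))"
    using bal k by (simp add: balanced_def runner_coords_def length_runner)
qed

definition has_core :: "level1 \<Rightarrow> (nat \<times> colour) list \<Rightarrow> cpart \<Rightarrow> bool" where
  "has_core L x y \<longleftrightarrow> bead_list L x \<and> balanced (positions x) \<and> y \<in> P' \<and> core L (mset x) = mset (place_list L y)"

lemma residue_sum_runner: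
  "r < 2 * n \<Longrightarrow> residue_sum M r = sum_list (runner M r)"
  by (simp add: residue_sum_def mset_runner flip: sum_mset_sum_list)

lemma sum_list_affine: "sum_list (map (\<lambda>a. j + 2 * n * a) xs) = j * length xs + 2 * n * sum_list xs"
  by (induction xs) (auto simp: algebra_simps)

lemma residue_sum_coords:
  "r < 2 * n \<Longrightarrow> residue_sum M r = r * length (runner_coords M r) + 2 * n * sum_list (runner_coords M r)"
  by (metis residue_sum_runner runner_coords_inverse sum_list_affine)

lemma has_core_pi0:
  assumes st: "has_core L x y"
  obtains l F where "pi0 n L (wall_of L x) = l # F" "admissible L l" "length F = n - 1"
      "\<forall>p \<in> set F. is_partition p"
    "sum_list (map fst x) = unit_II L * sum_list l + 2 * n * sum_list (map sum_list F) + sum_list (map fst (place_list L y))"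
proof -
  have x: "bead_list L x" and bal: "balanced (positions x)"
    and core: "core L (mset x) = mset (place_list L y)"
    using st by (auto simp: has_core_def)
  define M where "M = positions x"
  define F where "F = map (\<lambda>k. frobenius (runner_coords M k) (runner_coords M (2 * n - k))) [1..<n]"
  note pair = runner_coords_pair[OF x bal, folded M_def]
  have "sum_list (map fst x) = sum_mset M" by (simp add: M_def flip: sum_mset_sum_list)
  also have "\<dots> = residue_sum M 0 + residue_sum M n + (\<Sum>k = 1..<n. residue_sum M k + residue_sum M (2 * n - k))"
    unfolding sum_mset_residues[of M] by (rule sum_residues)
  also have "(\<Sum>k = 1..<n. residue_sum M k + residue_sum M (2 * n - k)) =
      (\<Sum>k = 1..<n. 2 * n * sum_list (frobenius (runner_coords M k) (runner_coords M (2 * n - k))))"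
  proof (intro sum.cong refl)
    fix k assume k: "k \<in> {1..<n}"
    have "residue_sum M k = k * length (runner_coords M k) + 2 * n * sum_list (runner_coords M k)"
      using k by (intro residue_sum_coords) auto
    moreover have "residue_sum M (2 * n - k) =
        (2 * n - k) * length (runner_coords M (2 * n - k)) + 2 * n * sum_list (runner_coords M (2 * n - k))"
      using k by (intro residue_sum_coords) auto
    moreover have "k * length (runner_coords M k) + (2 * n - k) * length (runner_coords M k) =
        2 * n * length (runner_coords M k)"
      using k by (simp flip: add_mult_distrib)
    moreover have "sum_list (frobenius (runner_coords M k) (runner_coords M (2 * n - k))) =
        sum_list (runner_coords M k) + sum_list (runner_coords M (2 * n - k)) + length (runner_coords M k)"
      using pair[OF k] by (rule frob_coords_frobenius(3))
    moreover have "a + b = d \<Longrightarrow> (a + u) + (b + v) = u + v + d" for a b d u v :: nat by simp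
    ultimately show "residue_sum M k + residue_sum M (2 * n - k) =
        2 * n * sum_list (frobenius (runner_coords M k) (runner_coords M (2 * n - k)))"
      using pair(3)[OF k] by (simp only: distrib_left)
  qed
  also have "\<dots> = 2 * n * sum_list (map sum_list F)"
    by (simp add: F_def comp_def sum_distrib_left interv_sum_list_conv_sum_set_nat)
  also have "residue_sum M 0 + residue_sum M n =
      residue_sum M (residue_II L) + residue_sum M (wall_residue n L)"
    by (simp add: residue_II_def wall_residue_def)
  also have "residue_sum M (residue_II L) = unit_II L * sum_list (lambda0 n L (wall_of L x))"
    unfolding residue_sum_runner[OF residue_II_less] M_def runner_II(1)[OF x]
    by (simp add: sum_list_mult_const mult.commute)
  also have "residue_sum M (wall_residue n L) = sum_list (map fst (place_list L y))"
  proof -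
    have "{#s \<in># M. s mod (2 * n) = wall_residue n L#} = image_mset fst (thirds L (mset x))"
      by (simp add: M_def thirds_def filter_mset_image_mset rtype_III_iff)
    also have "\<dots> = image_mset fst (mset (place_list L y))" by (simp add: core[symmetric] core_def twist_def)
    finally show ?thesis by (simp add: residue_sum_def flip: sum_mset_sum_list)
  qed
  finally have "sum_list (map fst x) =
      unit_II L * sum_list (lambda0 n L (wall_of L x)) + 2 * n * sum_list (map sum_list F) + sum_list (map fst (place_list L y))"
    by simp
  moreover have "pi0 n L (wall_of L x) = lambda0 n L (wall_of L x) # F"
    by (simp add: pi0_wall_of[OF x] F_def M_def)
  moreover have "\<forall>p \<in> set F. is_partition p" using frob_coords_frobenius(2)[OF pair] by (auto simp: F_def)
  moreover have "length F = n - 1" by (simp add: F_def)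
  ultimately show thesis using that runner_II(2)[OF x] by blast
qed

lemma legal_decompose:
  assumes "legal L B" shows "B = image_mset (\<lambda>s. (s, White)) (nonIII L B) + thirds L B"
proof -
  have "image_mset (\<lambda>s. (s, White)) (nonIII L B) =
      image_mset (\<lambda>b. (fst b, White)) {#b \<in># B. rtype n L (fst b) \<noteq> TypeIII#}"
    by (simp add: nonIII_def filter_mset_image_mset image_mset.compositionality comp_def)
  also have "\<dots> = image_mset (\<lambda>b. b) {#b \<in># B. rtype n L (fst b) \<noteq> TypeIII#}"
  proof (intro image_mset_cong)
    fix b assume "b \<in># {#b \<in># B. rtype n L (fst b) \<noteq> TypeIII#}"
    then show "(fst b, White) = b" using assms by (cases b; cases "snd b") (auto simp: legal_def)
  qed
  finally show ?thesis by (simp add: thirds_def union_commute flip: multiset_partition)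
qed

lemma has_core_inj:
  assumes s: "has_core L x y" "has_core L x' y" and eq: "pi0 n L (wall_of L x) = pi0 n L (wall_of L x')"
  shows "x = x'"
proof -
  have x: "bead_list L x" "bead_list L x'" using s by (auto simp: has_core_def)
  define M M' where "M = positions x" and "M' = positions x'"
  note pair = runner_coords_pair[OF x(1), folded M_def] runner_coords_pair[OF x(2), folded M'_def]
  have bal: "balanced M" "balanced M'" using s by (auto simp: has_core_def M_def M'_def)
  have eqs: "lambda0 n L (wall_of L x) = lambda0 n L (wall_of L x')"
    "\<And>k. k \<in> {1..<n} \<Longrightarrow> frobenius (runner_coords M k) (runner_coords M (2 * n - k)) =
        frobenius (runner_coords M' k) (runner_coords M' (2 * n - k))"
    using eq unfolding pi0_wall_of[OF x(1)] pi0_wall_of[OF x(2)] M_def M'_def by auto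
  have pe: "runner_coords M k = runner_coords M' k \<and>
      runner_coords M (2 * n - k) = runner_coords M' (2 * n - k)" if "k \<in> {1..<n}" for k
    using frobenius_inj[OF pair(1-3)[OF bal(1) that] pair(4-6)[OF bal(2) that]] eqs(2)[OF that] by blast
  have run: "runner M r = runner M' r" if r: "r < 2 * n" "r \<noteq> wall_residue n L" for r
  proof -
    consider "r = residue_II L" | "r \<in> {1..<n}" | "2 * n - r \<in> {1..<n}" "r = 2 * n - (2 * n - r)"
    proof -
      have "r = 0 \<or> r \<in> {1..<n} \<or> r = n \<or> 2 * n - r \<in> {1..<n} \<and> r = 2 * n - (2 * n - r)" using r by auto
      then show thesis using that r(2) by (auto simp: residue_II_def wall_residue_def split: if_splits)
    qed
    then show ?thesis
    proof cases
      case 1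
      then show ?thesis using runner_II(1)[OF x(1)] runner_II(1)[OF x(2)] eqs(1) by (simp add: M_def M'_def)
    next
      case 2
      then show ?thesis using pe[OF 2] runner_coords_inverse[OF r(1)] by metis
    next
      case 3
      then show ?thesis using pe[OF 3(1)] runner_coords_inverse[OF r(1)] by metis
    qed
  qed
  have "count (nonIII L (mset x)) s = count (nonIII L (mset x')) s" for s
  proof (cases "s mod (2 * n) = wall_residue n L")
    case True
    then show ?thesis by (simp add: nonIII_def rtype_III_iff)
  next
    case False
    have "s mod (2 * n) < 2 * n" using n3 by simp
    then have "count (mset (runner M (s mod (2 * n)))) s = count (mset (runner M' (s mod (2 * n)))) s"
      using run False by simp
    then show ?thesis using False by (simp add: mset_runner nonIII_def rtype_III_iff M_def M'_def)
  qed
  then have nI: "nonIII L (mset x) = nonIII L (mset x')" by (rule multiset_eqI)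
  have "core L (mset x) = core L (mset x')" using s by (simp add: has_core_def)
  then have "thirds L (mset x) = thirds L (mset x')"
    unfolding core_def twist_def nI by (metis switch_switch)
  then have "mset x = mset x'"
    using nI legal_decompose[OF bead_list_legal[OF x(1)]] legal_decompose[OF bead_list_legal[OF x(2)]] by simp
  then show ?thesis using bead_list_unique x by blast
qed

lemma has_core_surj:
  assumes l: "admissible L l" and F: "length F = n - 1" "\<forall>p \<in> set F. is_partition p" and y: "y \<in> P'"
  obtains x where "has_core L x y" "pi0 n L (wall_of L x) = l # F"
proof -
  have "\<exists>la. strict_decr (fst la) \<and> strict_decr (snd la) \<and> length (fst la) = length (snd la) \<and>
      frobenius (fst la) (snd la) = F ! (k - 1)"
    if "k \<in> {1..<n}" for k
  proof -
    have "is_partition (F ! (k - 1))" using F that by (intro F(2)[rule_format] nth_mem) auto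
    then obtain ls as where "strict_decr ls" "strict_decr as" "length ls = length as"
        "frobenius ls as = F ! (k - 1)"
      by (rule frobenius_surj)
    then show ?thesis by (intro exI[of _ "(ls, as)"]) simp
  qed
  then obtain la where la: "\<And>k. k \<in> {1..<n} \<Longrightarrow> strict_decr (fst (la k)) \<and> strict_decr (snd (la k)) \<and>
      length (fst (la k)) = length (snd (la k)) \<and> frobenius (fst (la k)) (snd (la k)) = F ! (k - 1)" by metis
  define R where "R r = (if r = residue_II L then map (\<lambda>k. k * unit_II L) l
      else if r \<in> {1..<n} then map (\<lambda>a. r + 2 * n * a) (fst (la r))
      else if r \<in> {n + 1..<2 * n} then map (\<lambda>a. r + 2 * n * a) (snd (la (2 * n - r))) else [])" for r
  have Rk: "R k = map (\<lambda>a. k + 2 * n * a) (fst (la k))"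
    "R (2 * n - k) = map (\<lambda>a. 2 * n - k + 2 * n * a) (snd (la k))" if "k \<in> {1..<n}" for k
    using that by (auto simp: R_def residue_II_def)
  have Rwr: "R (wall_residue n L) = []" using n3 by (auto simp: R_def residue_II_def wall_residue_def)
  have RII: "R (residue_II L) = map (\<lambda>k. k * unit_II L) l" by (simp add: R_def)
  have Rmod: "s mod (2 * n) = r" if "r < 2 * n" "s \<in> set (R r)" for r s
  proof (cases "r = residue_II L")
    case True
    then show ?thesis using that l unfolding True RII mod_unit_II by (auto simp: admissible_def)
  next
    case False
    then show ?thesis using that by (auto simp: R_def split: if_splits)
  qed
  have Rpos: "0 < s" if "r < 2 * n" and s: "s \<in> set (R r)" for r s
  proof (cases "r = residue_II L")
    case True
    obtain k where k: "k \<in> set l" "s = k * unit_II L" using s unfolding True RII by auto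
    have "k \<noteq> 0" using k(1) l unfolding admissible_def is_partition_def by metis
    then show ?thesis using k(2) unit_II_pos[of L] by simp
  next
    case False
    then show ?thesis using that by (auto simp: R_def split: if_splits)
  qed
  have Rdist: "distinct (R r)" if "r < 2 * n" "r \<noteq> 0" "r \<noteq> n" for r
  proof -
    have "r \<in> {1..<n} \<or> (2 * n - r \<in> {1..<n} \<and> r = 2 * n - (2 * n - r))" using that by auto
    then obtain xs where "R r = map (\<lambda>a. r + 2 * n * a) xs" "strict_decr xs" using Rk la by metis
    then show ?thesis using strict_decr_distinct[of xs] n3 by (simp add: distinct_map inj_on_def)
  qed
  define M0 where "M0 = (\<Sum>r<2 * n. mset (R r))"
  have M0r: "{#s \<in># M0. s mod (2 * n) = r#} = mset (R r)" if r: "r < 2 * n" for r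
  proof -
    have "filter_mset (\<lambda>s. s mod (2 * n) = r) (mset (R i)) = (if r = i then mset (R i) else {#})"
      if "i < 2 * n" for i
      using Rmod[OF that] by (auto simp: filter_mset_eq_conv)
    then have "filter_mset (\<lambda>s. s mod (2 * n) = r) M0 = (\<Sum>i<2 * n. if r = i then mset (R i) else {#})"
      unfolding M0_def filter_mset_sum by (intro sum.cong) auto
    then show ?thesis using r by simp
  qed
  have M0mem: "s \<in> set (R (s mod (2 * n)))" if "s \<in># M0" for s
  proof -
    have "s mod (2 * n) < 2 * n" using n3 by simp
    from M0r[OF this] that show ?thesis
      by (metis (mono_tags, lifting) mem_Collect_eq set_mset_filter set_mset_mset)
  qed
  have M0nt: "rtype n L s \<noteq> TypeIII" "0 < s" if "s \<in># M0" for s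
  proof -
    have m: "s mod (2 * n) < 2 * n" using n3 by simp
    show "0 < s" using Rpos[OF m M0mem[OF that]] .
    show "rtype n L s \<noteq> TypeIII" using M0mem[OF that] Rwr by (auto simp: rtype_III_iff)
  qed
  define T where "T = switch {t. odd (num_above M0 t)} (mset (place_list L y))"
  define B where "B = image_mset (\<lambda>s. (s, White)) M0 + T"
  have plL: "legal L (mset (place_list L y))" using bead_list_legal[OF place_list_bead_list[OF y]] .
  have pl3: "rtype n L (fst b) = TypeIII" if "b \<in># mset (place_list L y)" for b
    using that P'_pos[OF y] pos_type by (fastforce simp: place_list_def Suc_le_eq)
  have TL: "legal L T" unfolding T_def using plL pl3 by (intro legal_switch) auto
  have T3: "rtype n L (fst b) = TypeIII" if "b \<in># T" for b
    using that pl3 unfolding T_def by (cases b) (force simp: mem_switch)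
  have fstB: "image_mset fst B = M0 + image_mset fst T"
    by (simp add: B_def image_mset.compositionality comp_def)
  have nI: "nonIII L B = M0"
  proof -
    have "filter_mset (\<lambda>s. rtype n L s \<noteq> TypeIII) M0 = M0" using M0nt by (auto simp: filter_mset_eq_conv)
    moreover have "filter_mset (\<lambda>s. rtype n L s \<noteq> TypeIII) (image_mset fst T) = {#}" using T3
      by (auto simp: filter_mset_eq_conv)
    ultimately show ?thesis by (simp add: nonIII_def fstB)
  qed
  have th: "thirds L B = T"
  proof -
    have "filter_mset (\<lambda>b. rtype n L (fst b) = TypeIII) (image_mset (\<lambda>s. (s, White)) M0) = {#}" using M0nt
      by (auto simp: filter_mset_eq_conv)
    moreover have "filter_mset (\<lambda>b. rtype n L (fst b) = TypeIII) T = T" using T3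
      by (auto simp: filter_mset_eq_conv)
    ultimately show ?thesis by (simp add: thirds_def B_def)
  qed
  have core: "core L B = mset (place_list L y)" unfolding core_def twist_def nI th T_def by simp
  have legB: "legal L B"
    unfolding legal_def
  proof (intro conjI ballI allI impI)
    fix b assume "b \<in># B"
    then show "0 < fst b" "snd b = Gray \<Longrightarrow> rtype n L (fst b) = TypeIII"
      using M0nt TL by (auto simp: B_def legal_def)
  next
    fix s assume w: "(s, White) \<in># B"
    show "(s, Gray) \<notin># B"
    proof
      assume "(s, Gray) \<in># B"
      then have g: "(s, Gray) \<in># T" by (auto simp: B_def)
      then have "(s, White) \<in># T" using w T3 M0nt by (fastforce simp: B_def)
      then show False using g TL by (auto simp: legal_def)
    qed
  next
    fix s assume s: "rtype n L s = TypeI"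
    have "s \<notin># image_mset fst T" using T3 s by auto
    then have "count (image_mset fst T) s = 0" by (simp only: count_eq_zero_iff not_False_eq_True)
    moreover have "count M0 s \<le> 1"
    proof -
      define r where "r = s mod (2 * n)"
      have r: "r < 2 * n" "r \<noteq> 0" "r \<noteq> n" using s n3 by (auto simp: r_def rtype_def split: if_splits)
      have "count M0 s = count {#s \<in># M0. s mod (2 * n) = r#} s" by (simp add: r_def)
      also have "\<dots> = count (mset (R r)) s" by (simp only: M0r[OF r(1)])
      also have "\<dots> \<le> 1" using Rdist[OF r] by (simp add: distinct_count_atmost_1)
      finally show ?thesis .
    qed
    ultimately show "count (image_mset fst B) s \<le> 1" by (simp add: fstB)
  qed
  obtain x where x: "bead_list L x" "mset x = B" using legal_bead_list[OF legB] by blast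
  have Br: "{#s \<in># positions x. s mod (2 * n) = r#} = mset (R r)"
    if r: "r < 2 * n" "r \<noteq> wall_residue n L" for r
  proof -
    have "filter_mset (\<lambda>s. s mod (2 * n) = r) (image_mset fst T) = {#}"
      using T3 r(2) by (auto simp: filter_mset_eq_conv rtype_III_iff)
    then show ?thesis using M0r[OF r(1)] by (simp add: x(2) fstB)
  qed
  have kwr: "k < 2 * n" "2 * n - k < 2 * n" "k \<noteq> wall_residue n L" "2 * n - k \<noteq> wall_residue n L"
    if "k \<in> {1..<n}" for k
    using that by (auto simp: wall_residue_def)
  have "balanced (positions x)"
    unfolding balanced_def
  proof
    fix k assume k: "k \<in> {1..<n}"
    show "size {#s \<in># positions x. s mod (2 * n) = k#} = size {#s \<in># positions x. s mod (2 * n) = 2 * n - k#}"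
      unfolding Br[OF kwr(1,3)[OF k]] Br[OF kwr(2,4)[OF k]] Rk[OF k] using la[OF k] by simp
  qed
  then have "has_core L x y" using x y core by (simp add: has_core_def)
  moreover have "pi0 n L (wall_of L x) = l # F"
  proof -
    have "residue_II L \<noteq> wall_residue n L" using n3 by (simp add: residue_II_def wall_residue_def)
    then have "runner (positions x) (residue_II L) = map (\<lambda>k. k * unit_II L) l"
    proof (intro runner_eqI)
      have "sorted_wrt (\<ge>) l" using l by (simp add: admissible_def is_partition_def)
      then show "sorted_wrt (\<ge>) (map (\<lambda>k. k * unit_II L) l)"
        unfolding sorted_wrt_map by (rule sorted_wrt_mono_rel[rotated]) simp
    qed (use Br[OF residue_II_less] RII residue_II_less[of L] in simp)
    then have "lambda0 n L (wall_of L x) = l"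
      using unit_II_pos[of L] by (simp add: lambda0_wall_of[OF x(1)] comp_def)
    moreover have "runner_coords (positions x) k = fst (la k)"
      "runner_coords (positions x) (2 * n - k) = snd (la k)" if k: "k \<in> {1..<n}" for k
      using la[OF k] Br[OF kwr(1,3)[OF k]] Br[OF kwr(2,4)[OF k]] Rk[OF k] kwr[OF k]
      by (auto intro!: runner_coords_eqI)
    then have "map (\<lambda>k. frobenius (runner_coords (positions x) k) (runner_coords (positions x) (2 * n - k))) [1..<n] =
        map (\<lambda>k. F ! (k - 1)) [1..<n]" using la by (intro map_cong refl) auto
    moreover have "map (\<lambda>k. F ! (k - 1)) [1..<n] = F"
      using F(1) n3 by (intro nth_equalityI) auto
    ultimately show ?thesis unfolding pi0_wall_of[OF x(1)] by (simp only:)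
  qed
  ultimately show thesis using that by blast
qed

lemma proper_walls_wt_iff:
  "Y \<in> proper_walls_wt n L (minus_delta n L m) \<longleftrightarrow>
    (\<exists>x y. Y = wall_of L x \<and> has_core L x y \<and> sum_list (map fst x) = 2 * n * m \<and> alt (map (split_excess L) (place_list L y)) = 0)"
proof -
  have alt: "alt (map (split_excess L) (place_list L y)) = alt (map (split_excess L) x)"
    if st: "has_core L x y" "sum_list (map fst x) = 2 * n * m" for x y
  proof -
    have x: "bead_list L x" and y: "y \<in> P'" using st by (auto simp: has_core_def)
    have g: "good L (mset x)" using st by (intro bead_list_good) (auto simp: has_core_def)
    have "place_list L y = core_list L False x"
      using bead_list_unique[OF place_list_bead_list[OF y] bead_list_core_list[OF x]] core_list_core[OF x] st
      by (simp add: has_core_def)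
    then show ?thesis using alt_core_list[OF x g] by simp
  qed
  have ex: "\<exists>y. has_core L x y" if x: "bead_list L x" and bal: "balanced (positions x)" for x
  proof -
    have "rtype n L (fst b) = TypeIII" if "b \<in> set (core_list L False x)" for b
    proof -
      have "fst b \<in> set (map fst (core_list L False x))" using that by simp
      then show ?thesis unfolding map_fst_core_list by simp
    qed
    then obtain y where "y \<in> P'" "core_list L False x = place_list L y"
      using place_list_exists[OF bead_list_core_list[OF x]] by blast
    then show ?thesis using core_list_core[OF x] x bal by (intro exI[of _ y]) (simp add: has_core_def)
  qed
  show ?thesis
  proof
    assume "Y \<in> proper_walls_wt n L (minus_delta n L m)"
    then have Y: "Y \<in> proper_walls n L" "wt n L Y = minus_delta n L m" by (auto simp: proper_walls_wt_def)
    obtain x where x: "bead_list L x" "Y = wall_of L x" using proper_wallE[OF Y(1)] by blast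
    have w: "balanced (positions x)" "sum_list (map fst x) = 2 * n * m" "alt (map (split_excess L) x) = 0"
      using Y(2) wt_wall_of[OF x(1)] x(2) by auto
    obtain y where y: "has_core L x y" using ex[OF x(1) w(1)] by blast
    then show "\<exists>x y. Y = wall_of L x \<and> has_core L x y \<and> sum_list (map fst x) = 2 * n * m \<and>
        alt (map (split_excess L) (place_list L y)) = 0"
      using x(2) w alt[OF y w(2)] by (intro exI[of _ x] exI[of _ y]) simp
  next
    assume "\<exists>x y. Y = wall_of L x \<and> has_core L x y \<and> sum_list (map fst x) = 2 * n * m \<and>
        alt (map (split_excess L) (place_list L y)) = 0"
    then obtain x y where xy: "Y = wall_of L x" "has_core L x y" "sum_list (map fst x) = 2 * n * m"
        "alt (map (split_excess L) (place_list L y)) = 0" by blast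
    then show "Y \<in> proper_walls_wt n L (minus_delta n L m)"
      using wall_of_proper[of L x] wt_wall_of[of L x m] alt[OF xy(2,3)]
      by (simp add: proper_walls_wt_def has_core_def)
  qed
qed

lemma has_core_bead_core:
  assumes "has_core L x y" "sum_list (map fst x) = 2 * n * m"
  shows "bead_core n L (wall_of L x) = wall_of L (place_list L y)"
  using assms by (intro bead_core_wall_of bead_list_good place_list_bead_list) (auto simp: has_core_def)

lemma map_split_excess_01:
  "L \<noteq> LamN \<Longrightarrow> map (split_excess L) (place_list L y) = map (\<lambda>b. - 2 * of_bool (snd b = Gray)) y"
  by (simp add: place_list_def split_excess_def typeIII_position_def comp_def)

lemma map_split_excess_n:
  assumes "y \<in> P'" shows "map (split_excess LamN) (place_list LamN y) = map (\<lambda>b. sgn_colour (snd b)) y"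
proof -
  have "split_excess LamN (pos LamN (fst b), snd b) = sgn_colour (snd b)" if "b \<in> set y" for b
    using pos_mod[of "fst b" LamN] P'_pos[OF assms that]
    by (cases "snd b") (auto simp: split_excess_def sgn_colour_def wall_residue_def)
  then show ?thesis by (simp add: place_list_def)
qed

lemma sum_place_list_01: "L \<noteq> LamN \<Longrightarrow> sum_list (map fst (place_list L y)) = 2 * n * sum_list (map fst y)"
  by (induction y) (auto simp: typeIII_position_def algebra_simps)

lemma sum_place_list_n:
  "y \<in> P' \<Longrightarrow> sum_list (map fst (place_list LamN y)) + n * length y = 2 * n * sum_list (map fst y)"
proof (induction y)
  case (Cons b y)
  then obtain k where "fst b = Suc k" by (cases "fst b") (auto simp: P'_Cons)
  then show ?case using Cons by (auto simp: typeIII_position_def P'_Cons algebra_simps)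
qed simp

lemma sum_cpart_split:
  "sum_list (map fst (split_sum p q)) = sum_list p + sum_list q"
  by (simp add: sum_cpart_add)

lemma partition_tuples_snoc:
  "F @ [p] \<in> partition_tuples n k \<longleftrightarrow>
    length F = n - 1 \<and> (\<forall>p \<in> set F. is_partition p) \<and> is_partition p \<and> sum_list (map sum_list F) + sum_list p = k"
  using n3 by (auto simp: partition_tuples_def)

lemma mem_target_01:
  "(l, F @ [p], q) \<in> target_01 n m \<longleftrightarrow>
    admissible Lam0 l \<and> length F = n - 1 \<and> (\<forall>p \<in> set F. is_partition p) \<and> is_partition p \<and>
    is_partition q \<and> two_reduced q \<and> checker_sum q = 0 \<and>
    sum_list l + 2 * (sum_list (map sum_list F) + sum_list p + sum_list q) = 2 * m"
    (is "?A \<longleftrightarrow> ?B")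
proof
  assume ?A
  then show ?B
    by (auto simp: target_01_def partition_tuples_snoc odd_partitions_def DP0_iff admissible_def)
next
  assume B: ?B
  then have "even (sum_list q)" using checker_sum_parity[of q] by simp
  then obtain m3 where m3: "sum_list q = 2 * m3" by (auto elim: evenE)
  have "even (sum_list l)"
    using B by (metis dvd_add_left_iff dvd_triv_left)
  then obtain m1 where m1: "sum_list l = 2 * m1" by (auto elim: evenE)
  have "l \<in> odd_partitions (2 * m1)" using B m1 by (simp add: odd_partitions_def admissible_def)
  moreover have "F @ [p] \<in> partition_tuples n (sum_list (map sum_list F) + sum_list p)"
    using B by (simp add: partition_tuples_snoc)
  moreover have "q \<in> DP0 m3" using B m3 by (simp add: DP0_iff)
  moreover have "m1 + (sum_list (map sum_list F) + sum_list p) + 2 * m3 = m" using B m1 m3 by simp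
  ultimately show ?A unfolding target_01_def by blast
qed

lemma mem_target_n:
  "(l # F, \<mu>, \<nu>, c) \<in> target_n n m \<longleftrightarrow>
    admissible LamN l \<and> length F = n - 1 \<and> (\<forall>p \<in> set F. is_partition p) \<and>
    reduced_triple \<mu> \<nu> c \<and> even (length \<mu>) \<and> checker_sum \<mu> = 0 \<and>
    sum_list l + sum_list (map sum_list F) + sum_list \<mu> + sum_list \<nu> = m + length \<mu> div 2"
    (is "?A \<longleftrightarrow> ?B")
proof
  assume ?A
  then show ?B
    using n3 by (auto simp: target_n_def partition_tuples_def Q_triples_def DP0_iff admissible_def reduced_triple_def)
next
  assume B: ?B
  have "length \<mu> div 2 \<le> sum_list \<mu>"
  proof -
    have "length xs \<le> sum_list xs" if "is_partition xs" for xs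
      using that by (induction xs) (auto simp: is_partition_Cons)
    then have "length \<mu> \<le> sum_list \<mu>" using B by (simp add: reduced_triple_def)
    then show ?thesis by linarith
  qed
  then obtain m2 where m2: "sum_list \<mu> + sum_list \<nu> = m2 + length \<mu> div 2"
    by (metis add.commute le_Suc_ex trans_le_add1)
  have "l # F \<in> partition_tuples n (sum_list l + sum_list (map sum_list F))"
    using B n3 by (auto simp: partition_tuples_def admissible_def)
  moreover have "(\<mu>, \<nu>, c) \<in> Q_triples m2"
  proof -
    have "\<mu> \<in> (\<Union>k. DP0 k)" unfolding DP0_Union_iff using B by (simp add: reduced_triple_def)
    then show ?thesis using B m2 by (simp add: Q_triples_def reduced_triple_def)
  qed
  moreover have "(sum_list l + sum_list (map sum_list F)) + m2 = m" using B m2 by simp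
  ultimately show ?A unfolding target_n_def by blast
qed

lemma bij_walls:
  fixes enc :: "'a \<Rightarrow> cpart"
  assumes enc: "bij_betw enc A {y \<in> P'. alt (map (split_excess L) (place_list L y)) = 0}"
    and dec: "\<And>a. a \<in> A \<Longrightarrow> dec (wall_of L (place_list L (enc a))) = a"
  shows "bij_betw (\<lambda>Y. (pi0 n L Y, dec (bead_core n L Y))) (proper_walls_wt n L (minus_delta n L m))
    {(l # F, a) | l F a. admissible L l \<and> length F = n - 1 \<and> (\<forall>p \<in> set F. is_partition p) \<and> a \<in> A \<and>
      unit_II L * sum_list l + 2 * n * sum_list (map sum_list F) + sum_list (map fst (place_list L (enc a))) = 2 * n * m}"
    (is "bij_betw ?f ?W ?T")
proof (rule bij_betwI')
  have wall: "\<exists>x a. Y = wall_of L x \<and> has_core L x (enc a) \<and> sum_list (map fst x) = 2 * n * m \<and> a \<in> A \<and>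
      ?f Y = (pi0 n L (wall_of L x), a)" if Y: "Y \<in> ?W" for Y
  proof -
    obtain x y where x: "Y = wall_of L x" "has_core L x y" "sum_list (map fst x) = 2 * n * m"
        "alt (map (split_excess L) (place_list L y)) = 0"
      using Y unfolding proper_walls_wt_iff by blast
    then have "y \<in> enc ` A" using enc by (simp add: bij_betw_def has_core_def)
    then obtain a where "a \<in> A" "y = enc a" by blast
    then show ?thesis using x has_core_bead_core[OF x(2,3)] dec by (intro exI[of _ x] exI[of _ a]) simp
  qed
  have mem: "(pi0 n L (wall_of L x), a) \<in> ?T \<longleftrightarrow> sum_list (map fst x) = 2 * n * m"
    if "has_core L x (enc a)" "a \<in> A" for x a
    by (rule has_core_pi0[OF that(1)]) (use that(2) in auto)
  show "?f Y \<in> ?T" if Y: "Y \<in> ?W" for Y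
  proof -
    obtain x a where x: "has_core L x (enc a)" "sum_list (map fst x) = 2 * n * m" "a \<in> A"
        "?f Y = (pi0 n L (wall_of L x), a)"
      using wall[OF Y] by blast
    show ?thesis unfolding x(4) using mem[OF x(1,3)] x(2) by (rule iffD2)
  qed
  show "(?f Y = ?f Y') = (Y = Y')" if Y: "Y \<in> ?W" "Y' \<in> ?W" for Y Y'
  proof -
    obtain x a where x: "Y = wall_of L x" "has_core L x (enc a)" "?f Y = (pi0 n L (wall_of L x), a)"
      using wall[OF Y(1)] by blast
    obtain x' a' where x': "Y' = wall_of L x'" "has_core L x' (enc a')" "?f Y' = (pi0 n L (wall_of L x'), a')"
      using wall[OF Y(2)] by blast
    have "Y = Y'" if "?f Y = ?f Y'"
    proof -
      have "pi0 n L (wall_of L x) = pi0 n L (wall_of L x')" "a = a'" using that unfolding x(3) x'(3)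
        by simp_all
      then show ?thesis using has_core_inj[of L x "enc a" x'] x(1,2) x'(1,2) by simp
    qed
    then show ?thesis by blast
  qed
  show "\<exists>Y \<in> ?W. t = ?f Y" if "t \<in> ?T" for t
  proof -
    obtain l F a where t: "t = (l # F, a)" "admissible L l" "length F = n - 1" "\<forall>p \<in> set F. is_partition p"
        "a \<in> A"
      using \<open>t \<in> ?T\<close> by blast
    have "enc a \<in> {y \<in> P'. alt (map (split_excess L) (place_list L y)) = 0}"
      using bij_betwE[OF enc] t(5) by blast
    then have y: "enc a \<in> P'" "alt (map (split_excess L) (place_list L (enc a))) = 0" by auto
    obtain x where x: "has_core L x (enc a)" "pi0 n L (wall_of L x) = l # F"
      by (rule has_core_surj[OF t(2-4) y(1)])
    have s: "sum_list (map fst x) = 2 * n * m" using mem[OF x(1) t(5)] that unfolding t(1) x(2) by blast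
    have "wall_of L x \<in> ?W" unfolding proper_walls_wt_iff using x(1) s y(2) by blast
    moreover have "t = ?f (wall_of L x)" using t x(2) dec has_core_bead_core[OF x(1) s] by simp
    ultimately show ?thesis by blast
  qed
qed

lemma bij_split_sum:
  assumes L: "L \<noteq> LamN"
  shows "bij_betw (\<lambda>(p, q). split_sum p q) {(p, q). is_partition p \<and> is_partition q \<and> two_reduced q \<and> checker_sum q = 0}
    {y \<in> P'. alt (map (split_excess L) (place_list L y)) = 0}"
proof -
  have alt: "alt (map (split_excess L) (place_list L (split_sum p q))) = - 2 * checker_sum q" for p q
    unfolding map_split_excess_01[OF L] alt_scale alt_gray_split ..
  show ?thesis unfolding bij_betw_def
  proof (intro conjI inj_onI equalityI subsetI)
    fix y assume y: "y \<in> {y \<in> P'. alt (map (split_excess L) (place_list L y)) = 0}"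
    then obtain p q where pq: "is_partition p" "is_partition q" "two_reduced q" "y = split_sum p q"
      using split_surj[of y] by auto
    then have "checker_sum q = 0" using y alt by simp
    with pq show "y \<in> (\<lambda>(p, q). split_sum p q) ` {(p, q). is_partition p \<and> is_partition q \<and> two_reduced q \<and>
        checker_sum q = 0}"
      by (intro image_eqI[of _ _ "(p, q)"]) auto
  next
    fix y assume "y \<in> (\<lambda>(p, q). split_sum p q) ` {(p, q). is_partition p \<and> is_partition q \<and> two_reduced q \<and>
        checker_sum q = 0}"
    then obtain p q where pq: "y = split_sum p q" "is_partition p" "is_partition q" "checker_sum q = 0"
      by auto
    have "alt (map (split_excess L) (place_list L y)) = 0" unfolding pq(1) alt pq(4) by simp
    then show "y \<in> {y \<in> P'. alt (map (split_excess L) (place_list L y)) = 0}" using split_P'[OF pq(2,3)] pq(1)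
      by simp
  qed (auto dest: split_inj)
qed

lemma bij_reduce_sum:
  "bij_betw (\<lambda>(q, \<nu>, c). reduce_sum c q \<nu>) {(q, \<nu>, c). reduced_triple q \<nu> c \<and> even (length q) \<and> checker_sum q = 0}
    {y \<in> P'. alt (map (split_excess LamN) (place_list LamN y)) = 0}"
  (is "bij_betw ?e ?A ?B")
proof -
  have alt: "reduce_sum c q \<nu> \<in> ?B \<longleftrightarrow> even (length q) \<and> checker_sum q = 0" if "reduced_triple q \<nu> c" for q \<nu> c
    using reduce_P'[OF reduced_tripleD(1,3,4)[OF that], of c] alt_sgn_reduce[OF reduced_tripleD(4)[OF that], of c]
    by (simp add: map_split_excess_n)
  show ?thesis unfolding bij_betw_def
  proof (intro conjI inj_onI equalityI subsetI)
    fix y assume y: "y \<in> ?B"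
    then obtain q \<nu> c where "reduced_triple q \<nu> c" "y = reduce_sum c q \<nu>" using reduce_surj[of y] by blast
    with y alt show "y \<in> ?e ` ?A" by (intro image_eqI[of _ _ "(q, \<nu>, c)"]) auto
  next
    fix y assume "y \<in> ?e ` ?A"
    then obtain q \<nu> c where q: "reduced_triple q \<nu> c" "even (length q)"
        "checker_sum q = 0" and y: "y = reduce_sum c q \<nu>"
      by auto
    show "y \<in> ?B" unfolding y alt[OF q(1)] using q(2,3) by blast
  qed (auto dest: reduce_inj)
qed

lemma bij_pi_01:
  assumes L: "L \<noteq> LamN"
  shows "bij_betw (pi_01 n L) (proper_walls_wt n L (minus_delta n L m)) (target_01 n m)"
proof -
  let ?h = "\<lambda>(ps :: nat list list, p :: nat list, q :: nat list). (hd ps, tl ps @ [p], q)"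
  let ?A = "{(p, q). is_partition p \<and> is_partition q \<and> two_reduced q \<and> checker_sum q = 0}"
  let ?T = "{(l # F, a) | l F a. admissible L l \<and> length F = n - 1 \<and> (\<forall>p \<in> set F. is_partition p) \<and> a \<in> ?A \<and>
      unit_II L * sum_list l + 2 * n * sum_list (map sum_list F) +
        sum_list (map fst (place_list L (case a of (p, q) \<Rightarrow> split_sum p q))) = 2 * n * m}"
  have "bij_betw (\<lambda>Y. (pi0 n L Y, pi1_01 n L (bead_core n L Y))) (proper_walls_wt n L (minus_delta n L m)) ?T"
    by (rule bij_walls[OF bij_split_sum[OF L]]) (auto simp: pi1_01_eq)
  moreover have "bij_betw ?h ?T (target_01 n m)"
  proof (rule bij_betw_imageI)
    have size: "n * a + 2 * n * b + 2 * n * c = 2 * n * m \<longleftrightarrow> a + 2 * (b + c) = 2 * m" for a b c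
    proof -
      have "n * a + 2 * n * b + 2 * n * c = n * (a + 2 * (b + c))" "2 * n * m = n * (2 * m)"
        by (simp_all add: algebra_simps)
      then show ?thesis using n3 by simp
    qed
    have iff: "(l # F, p, q) \<in> ?T \<longleftrightarrow> (l, F @ [p], q) \<in> target_01 n m" for l F p q
      using size[of "sum_list l" "sum_list (map sum_list F)" "sum_list p + sum_list q"] L
      unfolding mem_target_01
        by (auto simp: admissible_def unit_II_def sum_place_list_01 sum_cpart_split add.assoc)
    show "inj_on ?h ?T" by (auto simp: inj_on_def)
    show "?h ` ?T = target_01 n m"
    proof (intro equalityI subsetI)
      fix t assume "t \<in> ?h ` ?T"
      then obtain l F p q where "t = (l, F @ [p], q)" "(l # F, p, q) \<in> ?T" by fastforce
      then show "t \<in> target_01 n m" using iff by blast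
    next
      fix t assume t: "t \<in> target_01 n m"
      obtain l G q where lGq: "t = (l, G, q)" by (cases t) auto
      have "G \<noteq> []" using t n3 by (auto simp: lGq target_01_def partition_tuples_def)
      then obtain F p where "G = F @ [p]" by (metis rev_exhaust)
      then show "t \<in> ?h ` ?T" using iff t lGq by (intro image_eqI[of _ _ "(l # F, p, q)"]) auto
    qed
  qed
  ultimately have "bij_betw (?h \<circ> (\<lambda>Y. (pi0 n L Y, pi1_01 n L (bead_core n L Y)))) (proper_walls_wt n L (minus_delta n L m)) (target_01 n m)"
    by (rule bij_betw_trans)
  then show ?thesis by (simp add: pi_01_def comp_def case_prod_beta cong: bij_betw_cong)
qed

lemma size_n:
  assumes triple: "reduced_triple q \<nu> c" and ev: "even (length q)"
    and s: "s = unit_II LamN * a + 2 * n * b + sum_list (map fst (place_list LamN (reduce_sum c q \<nu>)))"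
  shows "s = 2 * n * m \<longleftrightarrow> a + b + sum_list q + sum_list \<nu> = m + length q div 2"
proof -
  have "sum_list (map fst (place_list LamN (reduce_sum c q \<nu>))) + n * length q =
      2 * n * (sum_list q + sum_list \<nu>)"
    using sum_place_list_n[OF reduce_P'[OF reduced_tripleD(1,3,4)[OF triple], of c]] reduced_tripleD(4)[OF triple] by (simp add: length_cpart_add sum_cpart_add max_def)
  moreover have "n * length q = 2 * n * (length q div 2)" using ev by (auto elim!: evenE)
  ultimately have "s + 2 * n * (length q div 2) = 2 * n * (a + b + sum_list q + sum_list \<nu>)"
    unfolding s unit_II_def by (simp add: algebra_simps)
  then have "s = 2 * n * m \<longleftrightarrow> 2 * n * (m + length q div 2) = 2 * n * (a + b + sum_list q + sum_list \<nu>)"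
    unfolding distrib_left[of "2 * n" m] by linarith
  also have "\<dots> \<longleftrightarrow> a + b + sum_list q + sum_list \<nu> = m + length q div 2" using n3 by auto
  finally show ?thesis .
qed

lemma bij_pi_n: "bij_betw (pi_n n) (proper_walls_wt n LamN (minus_delta n LamN m)) (target_n n m)"
proof -
  let ?A = "{(q, \<nu>, c). reduced_triple q \<nu> c \<and> even (length q) \<and> checker_sum q = 0}"
  let ?T = "{(l # F, a) | l F a. admissible LamN l \<and> length F = n - 1 \<and> (\<forall>p \<in> set F. is_partition p) \<and> a \<in> ?A \<and>
      unit_II LamN * sum_list l + 2 * n * sum_list (map sum_list F) +
        sum_list (map fst (place_list LamN (case a of (q, \<nu>, c) \<Rightarrow> reduce_sum c q \<nu>))) = 2 * n * m}"
  have iff: "(l # F, q, \<nu>, c) \<in> ?T \<longleftrightarrow> (l # F, q, \<nu>, c) \<in> target_n n m" for l F q \<nu> c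
    using size_n[of q \<nu> c _ "sum_list l" "sum_list (map sum_list F)" m] unfolding mem_target_n by auto
  have "t \<in> ?T \<longleftrightarrow> t \<in> target_n n m" for t
  proof -
    obtain G q \<nu> c where t: "t = (G, q, \<nu>, c)" by (cases t) auto
    show ?thesis
    proof (cases G)
      case Nil
      then show ?thesis using n3 by (auto simp: t target_n_def partition_tuples_def)
    next
      case (Cons l F)
      then show ?thesis using iff t by simp
    qed
  qed
  then have "?T = target_n n m" by blast
  moreover have "bij_betw (\<lambda>Y. (pi0 n LamN Y, pi1_n n (bead_core n LamN Y))) (proper_walls_wt n LamN (minus_delta n LamN m)) ?T"
    by (rule bij_walls[OF bij_reduce_sum]) (auto simp: pi1_n_eq)
  ultimately show ?thesis by (simp add: pi_n_def[abs_def])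
qed

end

theorem theorem6p10:
  fixes n :: nat
  assumes "n \<ge> 3"
  shows "(\<forall>L \<in> {Lam0, Lam1}. \<forall>m::nat.
            bij_betw (pi_01 n L) (proper_walls_wt n L (minus_delta n L m)) (target_01 n m)) \<and>
         (\<forall>m::nat.
            bij_betw (pi_n n) (proper_walls_wt n LamN (minus_delta n LamN m)) (target_n n m))"
proof -
  interpret rank n using assms by unfold_locales
  show ?thesis using bij_pi_01 bij_pi_n by blast
qed

end
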